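(* Fix $\lambda>0$, $\kappa>0$ and $0\le\alpha\le 1$, and let $\delta_1,\delta_2,\zeta\in\mathbb{R}$ satisfy $$\min\{\zeta,\delta_1,\delta_2\}>0,\qquad \delta_1+\zeta<1,\qquad \delta_2<1,\qquad \zeta<\alpha .$$ Then there exists a constant $C$ such that for every $s>0$ and all $f,g\in L^2(\mathbb{R}^2)$ with $e^{\lambda s^{\alpha/\kappa}\Lambda^\alpha}f\in\dot{\mathbb H}^{1+\delta_1}$ and $e^{\lambda s^{\alpha/\kappa}\Lambda^\alpha}g\in\dot{\mathbb H}^{\delta_2}$, there is a sequence $\{c_j\}_{j\in\mathbb{Z}}$ (which may depend on $s,f,g$) with $c_j\ge 0$ and $\sum_{j\in\mathbb{Z}} c_j^2\le 1$ such that for all $j\in\mathbb{Z}$ $$\big\|[f,e^{\lambda s^{\alpha/\kappa}\Lambda^\alpha}\Delta_j]g\big\|_{L^2}\le C c_j\,\|e^{\lambda s^{\alpha/\kappa}\Lambda^\alpha}f\|_{\dot{\mathbb H}^{1+\delta_1}}\,\|e^{\lambda s^{\alpha/\kappa}\Lambda^\alpha}g\|_{\dot{\mathbb H}^{\delta_2}}\Big\{s^{\frac{\alpha-\zeta}{\kappa}}2^{-(\delta_1+\delta_2+\zeta-\alpha)j}+2^{-(\delta_1+\delta_2)j}\Big\}.$$ The constant $C$ is independent of $j,s,f,g$.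
   Context: The space is $\mathbb{R}^2$; $\mathcal F$ is the Fourier transform. $\Lambda=(-\Delta)^{1/2}$, i.e. $\mathcal F(\Lambda^m f)(\xi)=|\xi|^m\mathcal F f(\xi)$, and $e^{\lambda s^{\alpha/\kappa}\Lambda^\alpha}$ is the Fourier multiplier with symbol $e^{\lambda s^{\alpha/\kappa}|\xi|^\alpha}$. The homogeneous Sobolev norm is $\|f\|_{\dot{\mathbb H}^m}=\|\Lambda^m f\|_{L^2}=\left(\int|\xi|^{2m}|\mathcal F f(\xi)|^2\,d\xi\right)^{1/2}$. Littlewood-Paley operators: let $\psi,\phi$ be fixed smooth compactly supported functions on $\mathbb{R}^2$ with ranges in $[0,1]$ such that $\psi(\xi)=1$ for $|\xi|\le\frac12$, $\psi(\xi)=0$ for $|\xi|\ge1$, and $\phi(\xi)=\psi(\xi/2)-\psi(\xi)$. For $j\in\mathbb{Z}$, the (homogeneous) dyadic operator $\Delta_j$ is defined by $\mathcal F(\Delta_jf)=\phi(\cdot/2^j)\mathcal F f$. Commutator: $[A,B]=AB-BA$, where $f$ is regarded as the operator of multiplication by $f$; thus $[f,e^{\lambda s^{\alpha/\kappa}\Lambda^\alpha}\Delta_j]g=f\,\big(e^{\lambda s^{\alpha/\kappa}\Lambda^\alpha}\Delta_jg\big)-e^{\lambda s^{\alpha/\kappa}\Lambda^\alpha}\Delta_j(fg)$. *)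

theory Defs
  imports "HOL-Analysis.Analysis"
begin

type_synonym plane = "real ^ 2"

definition L2 :: "(plane \<Rightarrow> complex) set" where
  "L2 = {f. f \<in> borel_measurable lborel \<and> integrable lborel (\<lambda>x. (cmod (f x))\<^sup>2)}"

definition L2_norm :: "(plane \<Rightarrow> complex) \<Rightarrow> real" where
  "L2_norm f = sqrt (LINT x|lborel. (cmod (f x))\<^sup>2)"


text \<open>
  The normalisation of the Fourier transform is the one for which both
  \<open>F (\<Lambda>\<^sup>m f) = |\<xi>|\<^sup>m F f\<close> with \<open>\<Lambda> = (-\<Delta>)\<^sup>1\<^sup>/\<^sup>2\<close> and
  \<open>\<parallel>F f\<parallel> = \<parallel>f\<parallel>\<close> on \<open>L\<^sup>2\<close> of the plane hold.
\<close>

definition fourier_integral :: "(plane \<Rightarrow> complex) \<Rightarrow> plane \<Rightarrow> complex" where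
  "fourier_integral f \<xi> = (1 / (2 * pi)) *\<^sub>R (LINT x|lborel. exp (- \<i> * of_real (x \<bullet> \<xi>)) * f x)"

text \<open>
  Plancherel's extension: \<open>F\<close> is the limit in \<open>L\<^sup>2\<close> of the Fourier integrals of the
  truncations of \<open>f\<close> to balls.  The distance is an extended nonnegative integral, so
  that the convergence is meaningful without knowing the differences to be square integrable.
\<close>

definition has_L2_fourier :: "(plane \<Rightarrow> complex) \<Rightarrow> (plane \<Rightarrow> complex) \<Rightarrow> bool" where
  "has_L2_fourier f F \<longleftrightarrow> F \<in> L2 \<and>
     (\<lambda>n::nat. \<integral>\<^sup>+\<xi>. ennreal
        ((cmod (F \<xi> - fourier_integral (\<lambda>x. indicator (ball 0 (real n)) x * f x) \<xi>))\<^sup>2) \<partial>lborel)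
       \<longlonglongrightarrow> 0"

text \<open>
  The Fourier transform on \<open>L\<^sup>1 \<union> L\<^sup>2\<close>; it is needed on \<open>L\<^sup>1\<close> for the product of two
  functions of \<open>L\<^sup>2\<close>.  On \<open>L\<^sup>1 \<inter> L\<^sup>2\<close> the two clauses agree almost everywhere, and the
  choice in the second clause is unique up to a null set.
\<close>

definition fourier :: "(plane \<Rightarrow> complex) \<Rightarrow> plane \<Rightarrow> complex" where
  "fourier f = (if integrable lborel f then fourier_integral f else (SOME F. has_L2_fourier f F))"

definition inv_fourier :: "(plane \<Rightarrow> complex) \<Rightarrow> plane \<Rightarrow> complex" where
  "inv_fourier F x = fourier F (- x)"

definition fourier_multiplier :: "(plane \<Rightarrow> real) \<Rightarrow> (plane \<Rightarrow> complex) \<Rightarrow> plane \<Rightarrow> complex" where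
  "fourier_multiplier \<sigma> f = inv_fourier (\<lambda>\<xi>. of_real (\<sigma> \<xi>) * fourier f \<xi>)"

definition gevrey_symbol :: "real \<Rightarrow> real \<Rightarrow> real \<Rightarrow> real \<Rightarrow> plane \<Rightarrow> real" where
  "gevrey_symbol lam \<kappa> \<alpha> s \<xi> = exp (lam * s powr (\<alpha> / \<kappa>) * norm \<xi> powr \<alpha>)"

definition gevrey :: "real \<Rightarrow> real \<Rightarrow> real \<Rightarrow> real \<Rightarrow> (plane \<Rightarrow> complex) \<Rightarrow> plane \<Rightarrow> complex" where
  "gevrey lam \<kappa> \<alpha> s = fourier_multiplier (gevrey_symbol lam \<kappa> \<alpha> s)"

definition Hdot_norm :: "real \<Rightarrow> (plane \<Rightarrow> complex) \<Rightarrow> real" where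
  "Hdot_norm m u = sqrt (LINT \<xi>|lborel. norm \<xi> powr (2 * m) * (cmod (fourier u \<xi>))\<^sup>2)"

text \<open>
  The functions \<open>f \<in> L\<^sup>2\<close> for which \<open>gevrey lam \<kappa> \<alpha> s f\<close> belongs to the homogeneous
  Sobolev space of order \<open>m\<close>.  As the symbol is unbounded, the multiplier is not
  defined on all of \<open>L\<^sup>2\<close>, and membership is a condition on its Fourier transform, that is, on
  \<open>gevrey_symbol\<close> times \<open>fourier f\<close>.  If \<open>m \<ge> 0\<close> and \<open>\<alpha> \<ge> 0\<close>, this product is then itself in
  \<open>L\<^sup>2\<close> (the symbol is bounded on the unit ball, and \<open>|\<xi>|\<^sup>m \<ge> 1\<close> outside),
  so that \<open>gevrey lam \<kappa> \<alpha> s f\<close> is a function in \<open>L\<^sup>2\<close> with exactly this Fourier transform.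
\<close>

definition gevrey_Hdot :: "real \<Rightarrow> real \<Rightarrow> real \<Rightarrow> real \<Rightarrow> real \<Rightarrow> (plane \<Rightarrow> complex) set" where
  "gevrey_Hdot lam \<kappa> \<alpha> s m = {f \<in> L2. integrable lborel
     (\<lambda>\<xi>. norm \<xi> powr (2 * m) * (cmod (of_real (gevrey_symbol lam \<kappa> \<alpha> s \<xi>) * fourier f \<xi>))\<^sup>2)}"


primrec continuously_differentiable :: "nat \<Rightarrow> (plane \<Rightarrow> real) \<Rightarrow> bool" where
  "continuously_differentiable 0 f \<longleftrightarrow> continuous_on UNIV f"
| "continuously_differentiable (Suc n) f \<longleftrightarrow> (\<forall>x. f differentiable (at x)) \<and>
     (\<forall>v. continuously_differentiable n (\<lambda>x. frechet_derivative f (at x) v))"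

definition smooth :: "(plane \<Rightarrow> real) \<Rightarrow> bool" where
  "smooth f \<longleftrightarrow> (\<forall>n. continuously_differentiable n f)"

definition lp_cutoff :: "(plane \<Rightarrow> real) \<Rightarrow> bool" where
  "lp_cutoff \<psi> \<longleftrightarrow> smooth \<psi> \<and> range \<psi> \<subseteq> {0..1} \<and>
     (\<forall>\<xi>. norm \<xi> \<le> 1/2 \<longrightarrow> \<psi> \<xi> = 1) \<and> (\<forall>\<xi>. norm \<xi> \<ge> 1 \<longrightarrow> \<psi> \<xi> = 0)"

definition lp_phi :: "(plane \<Rightarrow> real) \<Rightarrow> plane \<Rightarrow> real" where
  "lp_phi \<psi> \<xi> = \<psi> (\<xi> /\<^sub>R 2) - \<psi> \<xi>"

lemma lp_phi_range:
  assumes "lp_cutoff \<psi>"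
  shows "range (lp_phi \<psi>) \<subseteq> {0..1}"
proof -
  have "lp_phi \<psi> \<xi> \<in> {0..1}" for \<xi>
  proof -
    have r: "\<psi> x \<in> {0..1}" for x
      using assms unfolding lp_cutoff_def by blast
    show ?thesis
    proof (cases "norm \<xi> \<le> 1")
      case True
      then have "\<psi> (\<xi> /\<^sub>R 2) = 1"
        using assms by (simp add: lp_cutoff_def)
      with r[of \<xi>] show ?thesis by (simp add: lp_phi_def)
    next
      case False
      then have "\<psi> \<xi> = 0"
        using assms by (simp add: lp_cutoff_def)
      with r[of "\<xi> /\<^sub>R 2"] show ?thesis by (simp add: lp_phi_def)
    qed
  qed
  then show ?thesis by blast
qed

definition lp_block :: "(plane \<Rightarrow> real) \<Rightarrow> int \<Rightarrow> (plane \<Rightarrow> complex) \<Rightarrow> plane \<Rightarrow> complex" where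
  "lp_block \<psi> j = fourier_multiplier (\<lambda>\<xi>. lp_phi \<psi> (\<xi> /\<^sub>R (2 powi j)))"

definition mult_commutator ::
    "(plane \<Rightarrow> complex) \<Rightarrow> ((plane \<Rightarrow> complex) \<Rightarrow> plane \<Rightarrow> complex) \<Rightarrow>
     (plane \<Rightarrow> complex) \<Rightarrow> plane \<Rightarrow> complex" where
  "mult_commutator f T g = (\<lambda>x. f x * T g x - T (\<lambda>y. f y * g y) x)"

end

theory Submission
  imports Defs "HOL-Probability.Probability"
begin

text \<open>
  By Plancherel's theorem and the convolution theorem, the commutator is on the Fourier side the
  integral of \<open>f^(\<xi> - \<eta>) (m(\<eta>) - m(\<xi>)) g^(\<eta>)\<close> over \<open>\<eta>\<close>, where \<open>m = e \<cdot> \<phi>(\<cdot>/2\<^sup>j)\<close> and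
  \<open>e(\<xi>) = exp (\<tau> |\<xi>|\<^sup>\<alpha>)\<close>, \<open>\<tau> = \<lambda> s\<^bsup>\<alpha>/\<kappa>\<^esup>\<close>. Since \<open>\<alpha> \<le> 1\<close>, \<open>e\<close> is submultiplicative, so that always
  \<open>|m(\<eta>) - m(\<xi>)| \<le> e(\<xi> - \<eta>) e(\<eta>)\<close>. Put \<open>R = 2\<^sup>j\<close>. If \<open>|\<xi> - \<eta>| > R/4\<close>, this trivial bound suffices: the
  derivatives on \<open>f\<close> pay for \<open>R\<close>. If \<open>|\<xi> - \<eta>| \<le> R/4\<close>, then \<open>\<xi>\<close> and \<open>\<eta>\<close> both have size \<open>R\<close>; the Lipschitz bound
  for \<open>\<phi>\<close> gains \<open>|\<xi> - \<eta>|/R\<close>, and \<open>|1 - e\<^sup>t| e\<^bsup>-y\<^esup> \<le> 2 |t| y\<^bsup>-\<zeta>/\<alpha>\<^esup>\<close> with \<open>y = \<tau> |\<xi> - \<eta>|\<^sup>\<alpha>\<close> and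
  \<open>|t| \<le> 4 \<tau> R\<^bsup>\<alpha>-1\<^esup> |\<xi> - \<eta>|\<close> gives the term with the power of \<open>s\<close>. Young's and the Cauchy-Schwarz inequality
  turn these kernel bounds into norm bounds, in which one of the two functions enters only through the
  weight \<open>(R/|x|)\<^sup>2\<close> on \<open>|x| \<ge> R/4\<close>; the sum of these weights over \<open>j\<close> is bounded, whence the \<open>c\<^sub>j\<close>.
\<close>

section \<open>The space L2 of the plane\<close>

text \<open>The two regions of the overview become three. If
  \<open>norm (\<xi> - \<eta>) > R / 4\<close> and \<open>norm \<eta> \<le> 4 * R\<close>, the
  weight |\<eta>|^(-\<delta>_2) is square integrable on a ball of the plane because \<delta>_2 < 1,
  so the factor from g is handled in L1. If \<open>norm \<eta> > 4 * R\<close>, the cutoff vanishes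
  at \<eta>, only \<open>norm \<xi> \<le> 2 * R\<close> matters, and there |\<eta>| <= 2 |\<xi> -
  \<eta>|: all derivatives count at \<eta>, and the area of the ball of radius 2 R makes up for the
  missing integrability. In the near region the weights |x|^(-\<delta>_1) and |x|^(-(\<zeta> +
  \<delta>_1)) must be square integrable at 0, whence \<delta>_1 + \<zeta> < 1; \<zeta> < \<alpha>
  keeps \<zeta>/\<alpha> below 1. In every region the factor at high frequency has a power R/|x| to
  spare, which is the weight summed over j. A separate obstacle is that f g is only known to be
  integrable, so its transform is merely bounded; the symbol, having bounded support for each j,
  brings the second term of the commutator back into L2. That step is qualitative, with bounds
  depending on j; the uniform estimate starts from the resulting formula and works with moduli in
  \<open>ennreal\<close>.\<close>

lemma nn_integral_Cauchy_Schwarz: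
  fixes f g :: "'a \<Rightarrow> real"
  assumes [measurable]: "f \<in> borel_measurable M" "g \<in> borel_measurable M"
    and nonneg: "\<And>x. 0 \<le> f x" "\<And>x. 0 \<le> g x"
  shows "(\<integral>\<^sup>+x. ennreal (f x * g x) \<partial>M)\<^sup>2
    \<le> (\<integral>\<^sup>+x. ennreal ((f x)\<^sup>2) \<partial>M) * (\<integral>\<^sup>+x. ennreal ((g x)\<^sup>2) \<partial>M)"
    (is "?P\<^sup>2 \<le> ?A * ?B")
proof (cases "?A = 0 \<or> ?B = 0")
  case True
  then have "AE x in M. f x * g x = 0"
    by (auto simp: nn_integral_0_iff_AE)
  then have "?P = 0"
    by (subst nn_integral_0_iff_AE) auto
  then show ?thesis by simp
next
  case nz: False
  show ?thesis
  proof (cases "?A = \<infinity> \<or> ?B = \<infinity>")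
    case True
    with nz have "?A * ?B = \<infinity>" by (auto simp: ennreal_mult_eq_top_iff)
    then show ?thesis by simp
  next
    case False
    define A B where "A = enn2real ?A" and "B = enn2real ?B"
    with False have A: "?A = ennreal A" "0 \<le> A" and B: "?B = ennreal B" "0 \<le> B"
      by (simp_all add: less_top)
    with nz have pos: "A > 0" "B > 0" by (auto simp: less_le)
    \<comment> \<open>This t minimises t A + B/t: both terms equal sqrt (A B), so 2 f g <= t f^2 +
      g^2/t integrates to the sharp bound.\<close>
    define t where "t = sqrt (B / A)"
    have t: "t > 0" using pos by (simp add: t_def)
    have "2 * ?P = (\<integral>\<^sup>+x. ennreal (2 * (f x * g x)) \<partial>M)"
      by (subst nn_integral_cmult[symmetric]) (auto simp: ennreal_mult' nonneg)
    also have "\<dots> \<le> (\<integral>\<^sup>+x. ennreal t * ennreal ((f x)\<^sup>2) + ennreal (1/t) * ennreal ((g x)\<^sup>2) \<partial>M)"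
    proof (rule nn_integral_mono)
      fix x
      have "0 \<le> (t * f x - g x)\<^sup>2 / t" using t by simp
      also have "\<dots> = t * (f x)\<^sup>2 + 1/t * (g x)\<^sup>2 - 2 * (f x * g x)"
        using t by (simp add: power2_eq_square field_simps)
      finally have "2 * (f x * g x) \<le> t * (f x)\<^sup>2 + 1/t * (g x)\<^sup>2" by simp
      then show "ennreal (2 * (f x * g x)) \<le> ennreal t * ennreal ((f x)\<^sup>2) + ennreal (1/t) * ennreal ((g x)\<^sup>2)"
        using t by (simp add: ennreal_mult'[symmetric] ennreal_plus[symmetric] del: ennreal_plus) 
    qed
    also have "\<dots> = ennreal t * ?A + ennreal (1/t) * ?B"
      by (subst nn_integral_add) (auto simp: nn_integral_cmult)
    also have "\<dots> = ennreal (t * A + 1/t * B)"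
      using A B t by (simp add: ennreal_mult'[symmetric] ennreal_plus[symmetric] del: ennreal_plus)
    also have "t * A + 1/t * B = 2 * sqrt (A * B)"
    proof -
      have "t * A = sqrt (A * B)"
        using pos by (simp add: t_def real_sqrt_divide real_sqrt_mult field_simps)
      moreover have "1/t * B = sqrt (A * B)"
        using pos by (simp add: t_def real_sqrt_divide real_sqrt_mult field_simps)
      ultimately show ?thesis by simp
    qed
    finally have "2 * ?P \<le> 2 * ennreal (sqrt (A * B))"
      by (simp add: ennreal_mult')
    then have "?P \<le> ennreal (sqrt (A * B))"
      by (simp add: ennreal_mult_le_mult_iff)
    then have "?P\<^sup>2 \<le> (ennreal (sqrt (A * B)))\<^sup>2"
      by (rule power_mono) simp
    also have "\<dots> = ennreal (A * B)"
      using pos by (simp add: ennreal_power)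
    also have "\<dots> = ?A * ?B" using A B by (simp add: ennreal_mult)
    finally show ?thesis .
  qed
qed

lemma ennreal_power2_le:
  fixes a b :: ennreal
  assumes "a\<^sup>2 \<le> b\<^sup>2" shows "a \<le> b"
  using assms by (cases a; cases b) (auto simp: ennreal_power ennreal_le_iff power2_le_iff_abs_le top_unique)

text \<open>Extended values allow Fatou arguments and Plancherel's identity to be stated for
  functions not yet known to be square integrable.\<close>

definition nn_L2 :: "(plane \<Rightarrow> complex) \<Rightarrow> ennreal" where
  "nn_L2 f = (\<integral>\<^sup>+x. ennreal ((cmod (f x))\<^sup>2) \<partial>lborel)"

lemma L2_measurable [measurable_dest]: "f \<in> L2 \<Longrightarrow> f \<in> borel_measurable lborel"
  by (simp add: L2_def)

lemma L2_norm_nonneg [simp]: "0 \<le> L2_norm f"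
  by (simp add: L2_norm_def)

lemma L2_iff: "f \<in> L2 \<longleftrightarrow> f \<in> borel_measurable lborel \<and> nn_L2 f < \<infinity>"
  unfolding L2_def nn_L2_def by (auto simp: integrable_iff_bounded)

lemma L2_norm_power2: "(L2_norm f)\<^sup>2 = (LINT x|lborel. (cmod (f x))\<^sup>2)"
  by (simp add: L2_norm_def)

lemma nn_L2_eq: "f \<in> L2 \<Longrightarrow> nn_L2 f = ennreal ((L2_norm f)\<^sup>2)"
  unfolding L2_norm_power2 nn_L2_def L2_def by (simp add: nn_integral_eq_integral)

lemma nn_L2_cong_AE: "AE x in lborel. f x = g x \<Longrightarrow> nn_L2 f = nn_L2 g"
  unfolding nn_L2_def by (intro nn_integral_cong_AE) auto

lemma L2_norm_cong_AE:
  assumes "f \<in> L2" "g \<in> L2" "AE x in lborel. f x = g x"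
  shows "L2_norm f = L2_norm g"
  using nn_L2_cong_AE[OF assms(3)] assms(1,2)
  by (simp add: nn_L2_eq ennreal_inj power2_eq_iff_nonneg)

lemma L2_cong_AE:
  assumes "f \<in> L2" "g \<in> borel_measurable lborel" "AE x in lborel. f x = g x"
  shows "g \<in> L2"
  using nn_L2_cong_AE[OF assms(3)] assms(1,2) by (simp add: L2_iff)

lemma L2_norm_le_iff:
  assumes "f \<in> L2" "0 \<le> c" shows "L2_norm f \<le> c \<longleftrightarrow> nn_L2 f \<le> ennreal (c\<^sup>2)"
  using assms by (simp add: nn_L2_eq ennreal_le_iff power2_le_iff_abs_le)

lemma L2_mono:
  assumes "f \<in> L2" "g \<in> borel_measurable lborel" "AE x in lborel. cmod (g x) \<le> cmod (f x)"
  shows "g \<in> L2" "L2_norm g \<le> L2_norm f"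
proof -
  have "nn_L2 g \<le> nn_L2 f"
    unfolding nn_L2_def using assms(3) by (intro nn_integral_mono_AE) (auto intro!: ennreal_leI power_mono)
  moreover from this show "g \<in> L2" using assms(1,2) by (auto simp: L2_iff)
  ultimately show "L2_norm g \<le> L2_norm f"
    using L2_norm_le_iff[of g "L2_norm f"] nn_L2_eq[OF assms(1)] by simp
qed

lemma L2_cmult:
  assumes "f \<in> L2"
  shows "(\<lambda>x. c * f x) \<in> L2" "L2_norm (\<lambda>x. c * f x) = cmod c * L2_norm f"
  using assms by (auto simp: L2_def L2_norm_def norm_mult power_mult_distrib real_sqrt_mult)

lemma L2_zero [simp]: "(\<lambda>x. 0) \<in> L2" "L2_norm (\<lambda>x. 0) = 0"
  by (auto simp: L2_def L2_norm_def)

lemma borel_measurable_cnj [measurable (raw)]: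
  "f \<in> borel_measurable M \<Longrightarrow> (\<lambda>x. cnj (f x)) \<in> borel_measurable M"
  by (rule borel_measurable_continuous_on[OF continuous_on_cnj[OF continuous_on_id]])

lemma L2_cnj:
  assumes "f \<in> L2" shows "(\<lambda>x. cnj (f x)) \<in> L2" "L2_norm (\<lambda>x. cnj (f x)) = L2_norm f"
  using assms by (auto simp: L2_def L2_norm_def)

lemma L2_add:
  assumes "f \<in> L2" "g \<in> L2" shows "(\<lambda>x. f x + g x) \<in> L2"
proof -
  have [measurable]: "f \<in> borel_measurable lborel" "g \<in> borel_measurable lborel"
    using assms by (auto simp: L2_def)
  have "integrable lborel (\<lambda>x. 2 * (cmod (f x))\<^sup>2 + 2 * (cmod (g x))\<^sup>2)"
    using assms by (auto simp: L2_def)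
  then have "integrable lborel (\<lambda>x. (cmod (f x + g x))\<^sup>2)"
  proof (rule Bochner_Integration.integrable_bound)
    show "AE x in lborel. norm ((cmod (f x + g x))\<^sup>2) \<le> norm (2 * (cmod (f x))\<^sup>2 + 2 * (cmod (g x))\<^sup>2)"
    proof (intro AE_I2)
      fix x
      have "(cmod (f x + g x))\<^sup>2 \<le> (cmod (f x) + cmod (g x))\<^sup>2"
        by (intro power_mono norm_triangle_ineq) simp
      also have "\<dots> \<le> 2 * (cmod (f x))\<^sup>2 + 2 * (cmod (g x))\<^sup>2"
        using sum_squares_ge_zero[of "cmod (f x) - cmod (g x)" 0] 
        by (simp add: power2_eq_square algebra_simps)
      finally show "norm ((cmod (f x + g x))\<^sup>2) \<le> norm (2 * (cmod (f x))\<^sup>2 + 2 * (cmod (g x))\<^sup>2)"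
        by simp
    qed
  qed simp
  then show ?thesis by (simp add: L2_def)
qed

lemma L2_diff:
  assumes "f \<in> L2" "g \<in> L2" shows "(\<lambda>x. f x - g x) \<in> L2"
  using L2_add[OF assms(1) L2_cmult(1)[OF assms(2), of "-1"]] by simp

lemma nn_integral_L2_mult:
  assumes "f \<in> L2" "g \<in> L2"
  shows "(\<integral>\<^sup>+x. ennreal (cmod (f x) * cmod (g x)) \<partial>lborel) \<le> ennreal (L2_norm f * L2_norm g)"
proof -
  have [measurable]: "f \<in> borel_measurable lborel" "g \<in> borel_measurable lborel"
    using assms by (auto simp: L2_def)
  have "(\<integral>\<^sup>+x. ennreal (cmod (f x) * cmod (g x)) \<partial>lborel)\<^sup>2 \<le> nn_L2 f * nn_L2 g"
    unfolding nn_L2_def by (rule nn_integral_Cauchy_Schwarz) auto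
  also have "\<dots> = (ennreal (L2_norm f * L2_norm g))\<^sup>2"
    using assms by (simp add: nn_L2_eq ennreal_power ennreal_mult power_mult_distrib)
  finally show ?thesis
    by (rule ennreal_power2_le)
qed

lemma L2_mult:
  assumes "f \<in> L2" "g \<in> L2"
  shows "integrable lborel (\<lambda>x. f x * g x)"
    and "cmod (LINT x|lborel. f x * g x) \<le> L2_norm f * L2_norm g"
proof -
  have [measurable]: "f \<in> borel_measurable lborel" "g \<in> borel_measurable lborel"
    using assms by (auto simp: L2_def)
  have le: "(\<integral>\<^sup>+x. ennreal (norm (f x * g x)) \<partial>lborel) \<le> ennreal (L2_norm f * L2_norm g)"
    using nn_integral_L2_mult[OF assms] by (simp add: norm_mult)
  then show int: "integrable lborel (\<lambda>x. f x * g x)"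
    by (auto simp: integrable_iff_bounded intro: le_less_trans)
  have "ennreal (cmod (LINT x|lborel. f x * g x)) \<le> (\<integral>\<^sup>+x. ennreal (norm (f x * g x)) \<partial>lborel)"
    using integral_norm_bound_ennreal[OF int] by simp
  also note le
  finally show "cmod (LINT x|lborel. f x * g x) \<le> L2_norm f * L2_norm g"
    by (simp add: ennreal_le_iff)
qed

text \<open>Besides the triangle inequality this gives the equality case of Cauchy-Schwarz: equal
  norms together with a maximal inner product force equal functions, which is how Fourier inversion
  is obtained.\<close>

lemma L2_norm_add_power2:
  assumes "f \<in> L2" "g \<in> L2"
  shows "(L2_norm (\<lambda>x. f x + g x))\<^sup>2
    = (L2_norm f)\<^sup>2 + (L2_norm g)\<^sup>2 + 2 * Re (LINT x|lborel. f x * cnj (g x))"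
proof -
  have i: "integrable lborel (\<lambda>x. f x * cnj (g x))"
    using L2_mult(1)[OF assms(1) L2_cnj(1)[OF assms(2)]] .
  have "(L2_norm (\<lambda>x. f x + g x))\<^sup>2
      = (LINT x|lborel. ((cmod (f x))\<^sup>2 + (cmod (g x))\<^sup>2) + 2 * Re (f x * cnj (g x)))"
    unfolding L2_norm_power2
    by (intro Bochner_Integration.integral_cong refl)
       (unfold cmod_power2, simp add: power2_eq_square algebra_simps)
  also have "\<dots> = ((L2_norm f)\<^sup>2 + (L2_norm g)\<^sup>2) + 2 * Re (LINT x|lborel. f x * cnj (g x))"
  proof -
    have "integrable lborel (\<lambda>x. Re (f x * cnj (g x)))"
      "(LINT x|lborel. Re (f x * cnj (g x))) = Re (LINT x|lborel. f x * cnj (g x))"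
      using i by (rule integrable_Re, rule integral_Re)
    then show ?thesis
      using assms unfolding L2_norm_power2 L2_def
      by (simp del: times_complex.sel)
  qed
  finally show ?thesis .
qed

lemma L2_norm_triangle:
  assumes "f \<in> L2" "g \<in> L2"
  shows "L2_norm (\<lambda>x. f x + g x) \<le> L2_norm f + L2_norm g"
proof (rule power2_le_imp_le)
  have "Re (LINT x|lborel. f x * cnj (g x)) \<le> L2_norm f * L2_norm g"
    using L2_mult(2)[OF assms(1) L2_cnj(1)[OF assms(2)]]
    unfolding L2_cnj(2)[OF assms(2)] by (rule order_trans[OF complex_Re_le_cmod])
  then show "(L2_norm (\<lambda>x. f x + g x))\<^sup>2 \<le> (L2_norm f + L2_norm g)\<^sup>2"
    unfolding L2_norm_add_power2[OF assms] by (simp add: power2_sum)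
qed simp

lemma L2_norm_minus: "L2_norm (\<lambda>x. f x - g x) = L2_norm (\<lambda>x. g x - f x)"
  by (simp add: L2_norm_def norm_minus_commute)

lemma L2_norm_triangle_diff:
  assumes "f \<in> L2" "g \<in> L2" "h \<in> L2"
  shows "L2_norm (\<lambda>x. f x - h x) \<le> L2_norm (\<lambda>x. f x - g x) + L2_norm (\<lambda>x. g x - h x)"
  using L2_norm_triangle[OF L2_diff[OF assms(1,2)] L2_diff[OF assms(2,3)]] by simp

lemma L2_norm_diff_abs:
  assumes "f \<in> L2" "g \<in> L2"
  shows "\<bar>L2_norm f - L2_norm g\<bar> \<le> L2_norm (\<lambda>x. f x - g x)"
  using L2_norm_triangle[OF L2_diff[OF assms] assms(2)]
    L2_norm_triangle[OF L2_diff[OF assms(2,1)] assms(1)] L2_norm_minus[of f g]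
  by simp

lemma L2_norm_eq_0_AE:
  assumes "f \<in> L2" "L2_norm f = 0" shows "AE x in lborel. f x = 0"
proof -
  have "nn_L2 f = 0" using assms by (simp add: nn_L2_eq)
  then show ?thesis
    unfolding nn_L2_def using assms(1) by (subst (asm) nn_integral_0_iff_AE) (auto simp: L2_def)
qed

lemma L2_norm_diff_eq_0_AE:
  assumes "f \<in> L2" "g \<in> L2" "L2_norm (\<lambda>x. f x - g x) = 0" shows "AE x in lborel. f x = g x"
  using L2_norm_eq_0_AE[OF L2_diff[OF assms(1,2)] assms(3)] by simp

lemma L2_norm_tendsto:
  assumes "\<And>n. u n \<in> L2" "f \<in> L2" "(\<lambda>n. L2_norm (\<lambda>x. u n x - f x)) \<longlonglongrightarrow> 0"
  shows "(\<lambda>n. L2_norm (u n)) \<longlonglongrightarrow> L2_norm f"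
proof -
  have "(\<lambda>n. L2_norm (u n) - L2_norm f) \<longlonglongrightarrow> 0"
    by (rule Lim_null_comparison[OF _ assms(3)])
       (use L2_norm_diff_abs[OF assms(1,2)] in auto)
  then show ?thesis by (simp add: LIM_zero_iff)
qed

text \<open>Write u v - f g = (u - f) v + f (v - g); the norms of \<open>v n\<close> converge, so
  both terms vanish in the limit. The pairing carries no conjugate, to match the multiplication
  formula.\<close>

lemma L2_pairing_tendsto:
  assumes u: "\<And>n. u n \<in> L2" "f \<in> L2" "(\<lambda>n. L2_norm (\<lambda>x. u n x - f x)) \<longlonglongrightarrow> 0"
    and v: "\<And>n. v n \<in> L2" "g \<in> L2" "(\<lambda>n. L2_norm (\<lambda>x. v n x - g x)) \<longlonglongrightarrow> 0"
  shows "(\<lambda>n. LINT x|lborel. u n x * v n x) \<longlonglongrightarrow> (LINT x|lborel. f x * g x)"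
proof -
  have "(\<lambda>n. (LINT x|lborel. u n x * v n x) - (LINT x|lborel. f x * g x)) \<longlonglongrightarrow> 0"
  proof (rule Lim_null_comparison)
    show "(\<lambda>n. L2_norm (\<lambda>x. u n x - f x) * L2_norm (v n) + L2_norm f * L2_norm (\<lambda>x. v n x - g x)) \<longlonglongrightarrow> 0"
      using tendsto_add[OF tendsto_mult[OF u(3) L2_norm_tendsto[OF v]] tendsto_mult[OF tendsto_const[of "L2_norm f"] v(3)]]
      by simp
    show "\<forall>\<^sub>F n in sequentially. norm ((LINT x|lborel. u n x * v n x) - (LINT x|lborel. f x * g x))
        \<le> L2_norm (\<lambda>x. u n x - f x) * L2_norm (v n) + L2_norm f * L2_norm (\<lambda>x. v n x - g x)"
    proof (intro always_eventually allI)
      fix n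
      have "(LINT x|lborel. u n x * v n x) - (LINT x|lborel. f x * g x)
          = (LINT x|lborel. (u n x - f x) * v n x) + (LINT x|lborel. f x * (v n x - g x))"
      proof -
        note I = L2_mult(1)[OF u(1) v(1)] L2_mult(1)[OF u(2) v(2)] L2_mult(1)[OF u(2) v(1)[of n]]
        show ?thesis
          using I by (simp add: left_diff_distrib right_diff_distrib)
      qed
      also have "norm \<dots> \<le> L2_norm (\<lambda>x. u n x - f x) * L2_norm (v n) + L2_norm f * L2_norm (\<lambda>x. v n x - g x)"
        by (rule order_trans[OF norm_triangle_ineq])
           (intro add_mono L2_mult L2_diff u v)
      finally show "norm ((LINT x|lborel. u n x * v n x) - (LINT x|lborel. f x * g x)) \<le> \<dots>" .
    qed
  qed
  then show ?thesis by (simp add: LIM_zero_iff)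
qed

text \<open>Bounds that vary with n serve Plancherel's theorem; bounds that hold eventually serve
  completeness.\<close>

lemma nn_L2_Fatou:
  assumes "\<And>n. u n \<in> borel_measurable lborel" "AE x in lborel. (\<lambda>n. u n x) \<longlonglongrightarrow> f x"
    and "\<forall>\<^sub>F n in sequentially. nn_L2 (u n) \<le> ennreal (c n)" "c \<longlonglongrightarrow> b"
  shows "nn_L2 f \<le> ennreal b"
proof -
  have "nn_L2 f = (\<integral>\<^sup>+x. liminf (\<lambda>n. ennreal ((cmod (u n x))\<^sup>2)) \<partial>lborel)"
    unfolding nn_L2_def
  proof (rule nn_integral_cong_AE)
    show "AE x in lborel. ennreal ((cmod (f x))\<^sup>2) = liminf (\<lambda>n. ennreal ((cmod (u n x))\<^sup>2))"
      using assms(2)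
    proof eventually_elim
      case (elim x)
      then have "(\<lambda>n. ennreal ((cmod (u n x))\<^sup>2)) \<longlonglongrightarrow> ennreal ((cmod (f x))\<^sup>2)"
        by (intro tendsto_intros)
      then show ?case by (rule lim_imp_Liminf[symmetric, OF sequentially_bot])
    qed
  qed
  also have "\<dots> \<le> liminf (\<lambda>n. nn_L2 (u n))"
    unfolding nn_L2_def using assms(1) by (intro nn_integral_liminf) auto
  also have "\<dots> \<le> liminf (\<lambda>n. ennreal (c n))"
    using assms(3) by (rule Liminf_mono)
  also have "\<dots> = ennreal b"
    using assms(4) by (intro lim_imp_Liminf tendsto_ennrealI) auto
  finally show ?thesis .
qed

text \<open>
  A subsequence \<open>v\<close> with \<open>\<parallel>v (n+1) - v n\<parallel>\<^sup>2 \<le> 4\<^sup>-\<^sup>n\<close> has \<open>\<Sum> 2\<^sup>n |v (n+1) - v n|\<^sup>2\<close>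
  integrable, so it converges almost everywhere; Fatou's lemma turns this into convergence in the mean.
\<close>

lemma L2_complete:
  assumes u: "\<And>n. u n \<in> L2"
    and cauchy: "\<And>e. e > 0 \<Longrightarrow> \<exists>N::nat. \<forall>m\<ge>N. \<forall>n\<ge>N. L2_norm (\<lambda>x. u m x - u n x) \<le> e"
  obtains f where "f \<in> L2" "(\<lambda>n. L2_norm (\<lambda>x. u n x - f x)) \<longlonglongrightarrow> 0"
proof -
  have "\<forall>k::nat. \<exists>N. \<forall>m\<ge>N. \<forall>n\<ge>N. L2_norm (\<lambda>x. u m x - u n x) \<le> (1/2)^k"
    by (intro allI cauchy) simp
  then obtain N where N: "\<And>k m n. m \<ge> N k \<Longrightarrow> n \<ge> N k \<Longrightarrow> L2_norm (\<lambda>x. u m x - u n x) \<le> (1/2)^k"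
    by metis
  \<comment> \<open>The sum puts both \<open>M k\<close> and \<open>M (Suc k)\<close> above
    \<open>N k\<close>, so consecutive terms of v are 2^-k close; the summand k drives
    \<open>M k\<close> to infinity.\<close>
  define M where "M k = k + (\<Sum>i\<le>k. N i)" for k
  have M: "M k \<ge> N k" "M (Suc k) \<ge> N k" "M k \<ge> k" for k
  proof -
    have "N k \<le> (\<Sum>i\<le>k. N i)" by (rule member_le_sum) auto
    then show "M k \<ge> N k" "M (Suc k) \<ge> N k" "M k \<ge> k" unfolding M_def by auto
  qed
  define v where "v k = u (M k)" for k
  have v: "v k \<in> L2" for k by (simp add: v_def u)
  have [measurable]: "v k \<in> borel_measurable lborel" for k using v by (auto simp: L2_def)
  have d: "L2_norm (\<lambda>x. v (Suc k) x - v k x) \<le> (1/2)^k" for k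
    unfolding v_def using M by (intro N) auto
  define B where "B x = (\<Sum>k. ennreal (2^k * (cmod (v (Suc k) x - v k x))\<^sup>2))" for x
  have "(\<integral>\<^sup>+x. B x \<partial>lborel) = (\<Sum>k. \<integral>\<^sup>+x. ennreal (2^k * (cmod (v (Suc k) x - v k x))\<^sup>2) \<partial>lborel)"
    unfolding B_def by (rule nn_integral_suminf) measurable
  also have "\<dots> \<le> (\<Sum>k. ennreal ((1/2)^k))"
  proof (intro suminf_le)
    fix k
    have "(\<integral>\<^sup>+x. ennreal (2^k * (cmod (v (Suc k) x - v k x))\<^sup>2) \<partial>lborel)
        = ennreal (2^k) * nn_L2 (\<lambda>x. v (Suc k) x - v k x)"
      unfolding nn_L2_def by (subst nn_integral_cmult[symmetric]) (auto simp: ennreal_mult')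
    also have "nn_L2 (\<lambda>x. v (Suc k) x - v k x) \<le> ennreal (((1/2)^k)\<^sup>2)"
      using d[of k] L2_norm_le_iff[OF L2_diff[OF v v]] by simp
    also have "ennreal (2^k) * ennreal (((1/2)^k)\<^sup>2) = ennreal ((1/2)^k)"
      by (simp add: ennreal_mult'[symmetric] power2_eq_square power_mult_distrib[symmetric] 
          flip: mult.assoc)
    finally show "(\<integral>\<^sup>+x. ennreal (2^k * (cmod (v (Suc k) x - v k x))\<^sup>2) \<partial>lborel) \<le> ennreal ((1/2)^k)"
      by (simp add: mult_left_mono)
  qed auto
  also have "\<dots> < \<infinity>"
    by (subst suminf_ennreal2) (auto simp: summable_geometric)
  finally have "AE x in lborel. B x \<noteq> \<infinity>"
    unfolding B_def by (intro nn_integral_noteq_infinite) (auto simp: less_top)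
  then have conv: "AE x in lborel. convergent (\<lambda>n. v n x)"
  proof eventually_elim
    case (elim x)
    define d where "d k = v (Suc k) x - v k x" for k
    have "summable (\<lambda>k. 2^k * (cmod (d k))\<^sup>2)"
      using elim unfolding B_def d_def by (intro summable_suminf_not_top) (auto simp: less_top)
    then have "summable (\<lambda>k. 2^k * (cmod (d k))\<^sup>2 + (1/2)^k)"
      by (intro summable_add summable_geometric) auto
    then have "summable (\<lambda>k. norm (d k))"
    proof (rule summable_comparison_test'[where N=0])
      fix k :: nat
      \<comment> \<open>Either |d k| is at most 2^-k, or 2^k |d k| >= 1 and multiplying |d k| by
        this factor only enlarges it.\<close>
      have "cmod (d k) \<le> 2^k * (cmod (d k))\<^sup>2 + (1/2)^k"
      proof (cases "cmod (d k) \<le> (1/2)^k")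
        case False
        then have "1 \<le> 2^k * cmod (d k)" by (simp add: field_simps)
        then have "1 * cmod (d k) \<le> (2^k * cmod (d k)) * cmod (d k)"
          by (intro mult_right_mono) auto
        then show ?thesis by (simp add: power2_eq_square add_increasing2)
      qed (simp add: add_increasing)
      then show "norm (norm (d k)) \<le> 2^k * (cmod (d k))\<^sup>2 + (1/2)^k" by simp
    qed
    then have "summable d" by (rule summable_norm_cancel)
    then have "convergent (\<lambda>n. \<Sum>k<n. d k)" by (simp add: summable_iff_convergent)
    moreover have "(\<Sum>k<n. d k) = v n x - v 0 x" for n
      unfolding d_def by (rule sum_lessThan_telescope)
    ultimately have "convergent (\<lambda>n. v n x - v 0 x)" by simp
    then have "convergent (\<lambda>n. (v n x - v 0 x) + v 0 x)"
      by (intro convergent_add convergent_const)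
    then show "convergent (\<lambda>n. v n x)" by simp
  qed
  define f where "f x = lim (\<lambda>n. v n x)" for x
  have [measurable]: "f \<in> borel_measurable lborel"
    unfolding f_def by (rule borel_measurable_lim_metric) measurable
  have lim: "AE x in lborel. (\<lambda>n. v n x) \<longlonglongrightarrow> f x"
    using conv unfolding f_def by eventually_elim (simp add: convergent_LIMSEQ_iff)
  \<comment> \<open>Fatou along v turns the Cauchy bound between \<open>u n\<close> and later terms
    into a bound on the distance from \<open>u n\<close> to the limit.\<close>
  have close: "nn_L2 (\<lambda>x. u n x - f x) \<le> ennreal (e\<^sup>2)"
    if "e > 0" and n: "\<And>m. m \<ge> K \<Longrightarrow> L2_norm (\<lambda>x. u n x - u m x) \<le> e" for e n K
  proof (rule nn_L2_Fatou[OF _ _ _ tendsto_const])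
    show "AE x in lborel. (\<lambda>k. u n x - v k x) \<longlonglongrightarrow> u n x - f x"
      using lim by eventually_elim (intro tendsto_intros)
    show "\<forall>\<^sub>F k in sequentially. nn_L2 (\<lambda>x. u n x - v k x) \<le> ennreal (e\<^sup>2)"
      using eventually_ge_at_top[of K]
    proof eventually_elim
      case (elim k)
      then have "M k \<ge> K" using M(3)[of k] by simp
      then have "L2_norm (\<lambda>x. u n x - v k x) \<le> e" unfolding v_def by (rule n)
      then show ?case using L2_norm_le_iff[OF L2_diff[OF u v]] \<open>e > 0\<close> by simp
    qed
  qed (use L2_diff[OF u v] L2_measurable in blast)
  obtain n where n: "\<forall>m\<ge>n. L2_norm (\<lambda>x. u n x - u m x) \<le> 1"
    using cauchy[of 1] by auto
  have "(\<lambda>x. u n x - f x) \<in> L2"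
    using close[of 1 n n] n u[of n] by (auto simp: L2_iff intro: le_less_trans)
  from L2_diff[OF u[of n] this] have f: "f \<in> L2" by simp
  have "(\<lambda>n. L2_norm (\<lambda>x. u n x - f x)) \<longlonglongrightarrow> 0"
  proof (rule LIMSEQ_I)
    fix r :: real assume "r > 0"
    then obtain K where K: "\<forall>m\<ge>K. \<forall>n\<ge>K. L2_norm (\<lambda>x. u m x - u n x) \<le> r/2"
      using cauchy[of "r/2"] by auto
    have "L2_norm (\<lambda>x. u n x - f x) \<le> r/2" if "n \<ge> K" for n
    proof -
      have "nn_L2 (\<lambda>x. u n x - f x) \<le> ennreal ((r/2)\<^sup>2)"
        using K that \<open>r > 0\<close> by (intro close[where K=K]) auto
      then show ?thesis
        using \<open>r > 0\<close> by (intro L2_norm_le_iff[OF L2_diff[OF u f], THEN iffD2]) simp_all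
    qed
    then have "L2_norm (\<lambda>x. u n x - f x) < r" if "n \<ge> K" for n
      by (rule le_less_trans) (use that \<open>r > 0\<close> in auto)
    then show "\<exists>no. \<forall>n\<ge>no. norm (L2_norm (\<lambda>x. u n x - f x) - 0) < r"
      by (intro exI[of _ K]) simp
  qed
  with f show ?thesis by (rule that)
qed

section \<open>Fourier integrals\<close>

lemma nn_integral_lborel_affine:
  fixes f :: "'a::euclidean_space \<Rightarrow> ennreal"
  assumes [measurable]: "f \<in> borel_measurable borel" and "c \<noteq> 0"
  shows "(\<integral>\<^sup>+x. f x \<partial>lborel) = ennreal (\<bar>c\<bar> ^ DIM('a)) * (\<integral>\<^sup>+x. f (t + c *\<^sub>R x) \<partial>lborel)"
  by (subst lborel_affine[OF \<open>c \<noteq> 0\<close>, of t])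
     (simp add: nn_integral_density nn_integral_distr nn_integral_cmult)

lemma integral_lborel_affine:
  fixes f :: "'a::euclidean_space \<Rightarrow> 'b::{banach, second_countable_topology}"
  assumes [measurable]: "f \<in> borel_measurable borel" and "c \<noteq> 0"
  shows "(LINT x|lborel. f x) = (\<bar>c\<bar> ^ DIM('a)) *\<^sub>R (LINT x|lborel. f (t + c *\<^sub>R x))"
  by (subst lborel_affine[OF \<open>c \<noteq> 0\<close>, of t])
     (simp add: integral_density integral_distr)

lemma integrable_lborel_affine_iff:
  fixes f :: "'a::euclidean_space \<Rightarrow> 'b::{banach, second_countable_topology}"
  assumes [measurable]: "f \<in> borel_measurable borel" and "c \<noteq> 0"
  shows "integrable lborel (\<lambda>x. f (t + c *\<^sub>R x)) \<longleftrightarrow> integrable lborel f"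
  using nn_integral_lborel_affine[of "\<lambda>x. ennreal (norm (f x))" c t] \<open>c \<noteq> 0\<close>
  by (auto simp: integrable_iff_bounded ennreal_mult_less_top)

lemma AE_lborel_affine:
  fixes P :: "'a::euclidean_space \<Rightarrow> bool"
  assumes "AE x in lborel. P x" "c \<noteq> 0"
  shows "AE x in lborel. P (t + c *\<^sub>R x)"
proof -
  have "AE x in distr lborel borel (\<lambda>x. t + c *\<^sub>R x). P x"
    using assms(1) by (subst (asm) lborel_affine[OF \<open>c \<noteq> 0\<close>, of t]) (simp add: AE_density \<open>c \<noteq> 0\<close>)
  then show ?thesis by (rule AE_distrD[rotated]) simp
qed

text \<open>Lebesgue measure is the image of a product of one-dimensional ones, so Fubini factors
  the integral. It reduces the Gaussian on the plane to the line.\<close>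

lemma has_bochner_integral_lborel_prod:
  fixes f :: "'a::euclidean_space \<Rightarrow> real \<Rightarrow> complex"
  assumes "\<And>b. b \<in> Basis \<Longrightarrow> has_bochner_integral lborel (f b) (v b)"
  shows "has_bochner_integral lborel (\<lambda>x. \<Prod>b\<in>Basis. f b (x \<bullet> b)) (\<Prod>b\<in>Basis. v b)"
proof -
  interpret product_sigma_finite "\<lambda>b::'a. lborel :: real measure" ..
  have i: "integrable lborel (f b)" and v: "integral\<^sup>L lborel (f b) = v b" if "b \<in> Basis" for b
    using assms[OF that] by (auto simp: has_bochner_integral_iff)
  have [measurable]: "f b \<in> borel_measurable borel" if "b \<in> Basis" for b
    using borel_measurable_integrable[OF i[OF that]] by simp
  have [simp]: "((\<Sum>b\<in>Basis. y b *\<^sub>R b) \<bullet> a) = y a" if "a \<in> Basis" for y and a :: 'a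
    using that by simp
  have eq: "lborel = distr (\<Pi>\<^sub>M b\<in>Basis. lborel) borel (\<lambda>y. \<Sum>b\<in>Basis. y b *\<^sub>R (b::'a))"
    by (subst lborel_eq) simp
  have 1: "(\<lambda>x. \<Prod>b\<in>Basis. f b (x \<bullet> b)) \<in> borel_measurable borel"
    by measurable
  show ?thesis
    unfolding has_bochner_integral_iff
  proof
    show "integrable lborel (\<lambda>x. \<Prod>b\<in>Basis. f b (x \<bullet> b))"
      by (subst eq, subst integrable_distr_eq[OF _ 1])
         (use product_integrable_prod[OF finite_Basis i] in \<open>simp_all cong: prod.cong\<close>)
    show "(LINT x|lborel. (\<Prod>b\<in>Basis. f b (x \<bullet> b))) = (\<Prod>b\<in>Basis. v b)"
      by (subst eq, subst integral_distr[OF _ 1])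
         (use product_integral_prod[OF finite_Basis i] v in \<open>simp_all cong: prod.cong\<close>)
  qed
qed

text \<open>The characteristic function of the standard normal law at -t, multiplied by sqrt (2 pi)
  to undo the normalisation of the density.\<close>

lemma has_bochner_integral_gauss_1:
  "has_bochner_integral lborel (\<lambda>x::real. exp (- \<i> * of_real (t * x)) * exp (- of_real (x\<^sup>2) / 2))
     (of_real (sqrt (2 * pi) * exp (- t\<^sup>2 / 2)))"
proof -
  let ?f = "\<lambda>x::real. exp (- \<i> * of_real (t * x)) :: complex"
  have int: "integrable std_normal_distribution ?f"
  proof -
    interpret prob_space std_normal_distribution
      by (rule prob_space_normal_density) simp
    show ?thesis by (rule integrable_const_bound[where B=1]) (auto simp: norm_exp_eq_Re)
  qed
  have "(LINT x|std_normal_distribution. ?f x) = char std_normal_distribution (- t)"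
    unfolding char_def by (intro Bochner_Integration.integral_cong) (auto simp: mult_ac)
  also have "\<dots> = of_real (exp (- t\<^sup>2 / 2))"
    by (simp add: char_std_normal_distribution)
  finally have "has_bochner_integral lborel (\<lambda>x. std_normal_density x *\<^sub>R ?f x) (of_real (exp (- t\<^sup>2 / 2)))"
    using int by (simp add: has_bochner_integral_iff integral_density integrable_density normal_density_nonneg)
  from has_bochner_integral_mult_right[OF this, of "of_real (sqrt (2*pi))"]
  show ?thesis
    by (simp add: std_normal_density_def scaleR_conv_of_real exp_of_real[symmetric] mult_ac
        del: exp_of_real real_sqrt_mult)
qed

text \<open>Gaussian and character both factor over the coordinates; the two factors sqrt (2 pi)
  give 2 pi, the constant that \<open>fourier_integral\<close> divides by.\<close>

lemma has_bochner_integral_gauss: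
  "has_bochner_integral lborel (\<lambda>x::plane. exp (- \<i> * of_real (x \<bullet> w)) * of_real (exp (- (norm x)\<^sup>2 / 2)))
     (of_real (2 * pi * exp (- (norm w)\<^sup>2 / 2)))"
proof -
  have B: "(norm y)\<^sup>2 = (\<Sum>b\<in>Basis. (y \<bullet> b)\<^sup>2)" for y :: plane
    by (subst power2_norm_eq_inner, subst euclidean_inner) (simp add: power2_eq_square)
  have e1: "exp (- \<i> * of_real (x \<bullet> w)) * of_real (exp (- (norm x)\<^sup>2 / 2))
     = (\<Prod>b\<in>Basis. exp (- \<i> * of_real ((w \<bullet> b) * (x \<bullet> b))) * exp (- of_real ((x \<bullet> b)\<^sup>2) / 2))" for x :: plane
    unfolding B
    by (simp add: prod.distrib exp_sum[symmetric] exp_of_real[symmetric] sum_negf sum_distrib_left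
       euclidean_inner[of x w] sum_divide_distrib mult_ac del: exp_of_real)
  have e2: "of_real (2 * pi * exp (- (norm w)\<^sup>2 / 2))
     = (\<Prod>b\<in>(Basis::plane set). complex_of_real (sqrt (2 * pi) * exp (- (w \<bullet> b)\<^sup>2 / 2)))"
    unfolding B of_real_prod[symmetric]
    by (simp add: prod.distrib exp_sum[symmetric] sum_negf sum_divide_distrib del: real_sqrt_mult)
  show ?thesis
    unfolding e1 e2 by (rule has_bochner_integral_lborel_prod) (rule has_bochner_integral_gauss_1)
qed

lemma fourier_integrand:
  assumes "integrable lborel f"
  shows "integrable lborel (\<lambda>x. exp (- \<i> * of_real (x \<bullet> \<xi>)) * f x)"
proof (rule Bochner_Integration.integrable_bound[OF assms])
  have [measurable]: "f \<in> borel_measurable borel"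
    using borel_measurable_integrable[OF assms] by simp
  show "(\<lambda>x. exp (- \<i> * of_real (x \<bullet> \<xi>)) * f x) \<in> borel_measurable lborel" by measurable
qed (simp add: norm_mult norm_exp_eq_Re)

lemma fourier_integral_measurable [measurable (raw)]:
  assumes [measurable]: "f \<in> borel_measurable borel"
  shows "fourier_integral f \<in> borel_measurable borel"
  unfolding fourier_integral_def by measurable

lemma fourier_integral_diff:
  assumes "integrable lborel f" "integrable lborel g"
  shows "fourier_integral (\<lambda>x. f x - g x) \<xi> = fourier_integral f \<xi> - fourier_integral g \<xi>"
  unfolding fourier_integral_def right_diff_distrib scaleR_diff_right[symmetric]
    Bochner_Integration.integral_diff[OF fourier_integrand[OF assms(1)] fourier_integrand[OF assms(2)]] ..

lemma fourier_integral_cong_AE: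
  assumes "AE x in lborel. f x = g x" "f \<in> borel_measurable borel" "g \<in> borel_measurable borel"
  shows "fourier_integral f \<xi> = fourier_integral g \<xi>"
proof -
  note [measurable] = assms(2,3)
  show ?thesis
    unfolding fourier_integral_def using assms(1)
    by (intro arg_cong2[where f=scaleR] refl integral_cong_AE) auto
qed

lemma fourier_integral_modulate:
  "fourier_integral (\<lambda>x. exp (\<i> * of_real (x \<bullet> a)) * f x) \<xi> = fourier_integral f (\<xi> - a)"
proof -
  have "exp (- \<i> * of_real (x \<bullet> \<xi>)) * (exp (\<i> * of_real (x \<bullet> a)) * f x)
      = exp (- \<i> * of_real (x \<bullet> (\<xi> - a))) * f x" for x
    unfolding mult.assoc[symmetric] exp_add[symmetric] by (simp add: inner_diff_right right_diff_distrib)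
  then show ?thesis unfolding fourier_integral_def by presburger
qed

lemma fourier_integral_cnj:
  "fourier_integral (\<lambda>x. cnj (f x)) \<xi> = cnj (fourier_integral f (- \<xi>))"
  unfolding fourier_integral_def complex_cnj_scaleR Bochner_Integration.integral_cnj[symmetric]
  by (simp add: exp_cnj)

lemma fourier_integral_bound:
  assumes "integrable lborel f"
  shows "cmod (fourier_integral f \<xi>) \<le> (LINT x|lborel. cmod (f x))"
proof -
  have "cmod (LINT x|lborel. exp (- \<i> * of_real (x \<bullet> \<xi>)) * f x) \<le> (LINT x|lborel. cmod (f x))"
    using integral_norm_bound[of lborel "\<lambda>x. exp (- \<i> * of_real (x \<bullet> \<xi>)) * f x"]
    by (simp add: norm_mult norm_exp_eq_Re)
  then have "\<bar>1 / (2 * pi)\<bar> * cmod (LINT x|lborel. exp (- \<i> * of_real (x \<bullet> \<xi>)) * f x)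
      \<le> 1 * (LINT x|lborel. cmod (f x))"
    using pi_gt3 by (intro mult_mono) auto
  then show ?thesis
    unfolding fourier_integral_def norm_scaleR by simp
qed

text \<open>Fubini: the kernel has modulus |f x| |g \<xi>|, integrable on the product, and the
  character is symmetric in x and \<xi>.\<close>

lemma fourier_integral_multiplication:
  assumes f: "integrable lborel f" and g: "integrable lborel g"
  shows "(LINT \<xi>|lborel. fourier_integral f \<xi> * g \<xi>) = (LINT x|lborel. f x * fourier_integral g x)"
proof -
  have [measurable]: "f \<in> borel_measurable borel" "g \<in> borel_measurable borel"
    using f g by auto
  let ?K = "\<lambda>(x::plane) (\<xi>::plane). exp (- \<i> * of_real (x \<bullet> \<xi>)) * f x * g \<xi>"
  have "integrable (lborel \<Otimes>\<^sub>M lborel) (\<lambda>z. f (fst z) * g (snd z))"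
  proof (rule lborel_pair.Fubini_integrable)
    show "integrable lborel (\<lambda>x. LINT y|lborel. norm (f (fst (x, y)) * g (snd (x, y))))"
      using f by (simp add: norm_mult)
  qed (use g in auto)
  then have "integrable (lborel \<Otimes>\<^sub>M lborel) (case_prod ?K)"
    by (rule Bochner_Integration.integrable_bound)
       (auto simp: norm_mult norm_exp_eq_Re split: prod.split)
  from lborel_pair.Fubini_integral[OF this]
  have eq: "(LINT \<xi>|lborel. LINT x|lborel. ?K x \<xi>) = (LINT x|lborel. LINT \<xi>|lborel. ?K x \<xi>)" .
  have 1: "fourier_integral f \<xi> * g \<xi> = (1 / (2 * pi)) *\<^sub>R (LINT x|lborel. ?K x \<xi>)" for \<xi>
    unfolding fourier_integral_def by simp
  have 2: "f x * fourier_integral g x = (1 / (2 * pi)) *\<^sub>R (LINT \<xi>|lborel. ?K x \<xi>)" for x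
  proof -
    have "?K x \<xi> = f x * (exp (- \<i> * of_real (\<xi> \<bullet> x)) * g \<xi>)" for \<xi>
      by (simp add: inner_commute)
    then have "(LINT \<xi>|lborel. ?K x \<xi>) = f x * (LINT \<xi>|lborel. exp (- \<i> * of_real (\<xi> \<bullet> x)) * g \<xi>)"
      unfolding integral_mult_right_zero[symmetric] by presburger
    then show ?thesis unfolding fourier_integral_def by simp
  qed
  show ?thesis unfolding 1 2 integral_scaleR_right eq ..
qed

lemma integrable_gauss: "integrable lborel (\<lambda>x::plane. exp (- (norm x)\<^sup>2 / 2))"
proof -
  have "integrable lborel (\<lambda>x::plane. complex_of_real (exp (- (norm x)\<^sup>2 / 2)))"
    using has_bochner_integral_gauss[of 0] by (simp add: has_bochner_integral_iff)
  then show ?thesis by (simp only: complex_of_real_integrable_eq)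
qed

lemma fourier_integral_gauss:
  assumes "e > 0"
  shows "fourier_integral (\<lambda>x. of_real (exp (- (norm (e *\<^sub>R x))\<^sup>2 / 2))) w
     = of_real (exp (- (norm (w /\<^sub>R e))\<^sup>2 / 2) / e\<^sup>2)"
proof -
  let ?f = "\<lambda>x::plane. exp (- \<i> * of_real (x \<bullet> (w /\<^sub>R e))) * of_real (exp (- (norm x)\<^sup>2 / 2)) :: complex"
  have "(LINT x|lborel. ?f x) = (\<bar>e\<bar> ^ DIM(plane)) *\<^sub>R (LINT x|lborel. ?f (0 + e *\<^sub>R x))"
    by (rule integral_lborel_affine) (use assms in auto)
  also have "(\<lambda>x. ?f (0 + e *\<^sub>R x))
      = (\<lambda>x. exp (- \<i> * of_real (x \<bullet> w)) * of_real (exp (- (norm (e *\<^sub>R x))\<^sup>2 / 2)))"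
  proof -
    have "(0 + e *\<^sub>R x) \<bullet> (w /\<^sub>R e) = x \<bullet> w" for x using assms by simp
    then show ?thesis by (simp only: add_0)
  qed
  also have "(LINT x|lborel. ?f x) = of_real (2 * pi * exp (- (norm (w /\<^sub>R e))\<^sup>2 / 2))"
    using has_bochner_integral_gauss by (rule has_bochner_integral_integral_eq)
  finally show ?thesis
    using assms unfolding fourier_integral_def by (auto simp: scaleR_conv_of_real field_simps power2_eq_square)
qed

text \<open>Fourier inversion with a Gaussian damping. The multiplication formula moves the
  transform from f to the modulated Gaussian, whose transform is a Gaussian of width e centred at x;
  the result is an average of f near x. Conjugation lets the forward transform play the role of the
  inverse one.\<close>

lemma fourier_integral_gauss_smoothing:
  assumes f: "integrable lborel f" and e: "e > 0"
  shows "fourier_integral (\<lambda>\<xi>. cnj (fourier_integral f \<xi>) * of_real (exp (- (norm (e *\<^sub>R \<xi>))\<^sup>2 / 2))) x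
    = cnj ((1 / (2 * pi)) *\<^sub>R (LINT z|lborel. f (x + e *\<^sub>R z) * of_real (exp (- (norm z)\<^sup>2 / 2))))"
proof -
  have [measurable]: "f \<in> borel_measurable borel" using f by auto
  let ?g = "\<lambda>\<xi>::plane. complex_of_real (exp (- (norm (e *\<^sub>R \<xi>))\<^sup>2 / 2))"
  let ?k = "\<lambda>\<xi>. exp (\<i> * of_real (\<xi> \<bullet> x)) * ?g \<xi>"
  have g: "integrable lborel ?g"
    using integrable_gauss e integrable_lborel_affine_iff[of "\<lambda>x::plane. exp (- (norm x)\<^sup>2 / 2)" e 0] by auto
  have k: "integrable lborel ?k"
    using fourier_integrand[OF g, of "- x"] by simp
  have "fourier_integral (\<lambda>\<xi>. cnj (fourier_integral f \<xi>) * ?g \<xi>) x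
      = cnj ((1 / (2 * pi)) *\<^sub>R (LINT \<xi>|lborel. fourier_integral f \<xi> * ?k \<xi>))"
    unfolding fourier_integral_def[of _ x] complex_cnj_scaleR Bochner_Integration.integral_cnj[symmetric]
    by (simp add: exp_cnj mult_ac)
  also have "(LINT \<xi>|lborel. fourier_integral f \<xi> * ?k \<xi>) = (LINT y|lborel. f y * fourier_integral ?k y)"
    by (rule fourier_integral_multiplication[OF f k])
  also have "\<dots> = (LINT y|lborel. f y * of_real (exp (- (norm ((y - x) /\<^sub>R e))\<^sup>2 / 2) / e\<^sup>2))"
    unfolding fourier_integral_modulate fourier_integral_gauss[OF e] ..
  also have "\<dots> = (\<bar>e\<bar> ^ DIM(plane)) *\<^sub>R (LINT z|lborel.
      f (x + e *\<^sub>R z) * of_real (exp (- (norm ((x + e *\<^sub>R z - x) /\<^sub>R e))\<^sup>2 / 2) / e\<^sup>2))"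
    by (rule integral_lborel_affine) (use e in auto)
  also have "\<dots> = (LINT z|lborel. f (x + e *\<^sub>R z) * of_real (exp (- (norm z)\<^sup>2 / 2)))"
  proof -
    have "f (x + e *\<^sub>R z) * of_real (exp (- (norm ((x + e *\<^sub>R z - x) /\<^sub>R e))\<^sup>2 / 2) / e\<^sup>2)
       = (1 / e\<^sup>2) *\<^sub>R (f (x + e *\<^sub>R z) * of_real (exp (- (norm z)\<^sup>2 / 2)))" for z
    proof -
      have "(x + e *\<^sub>R z - x) /\<^sub>R e = z" using e by simp
      then show ?thesis by (simp add: scaleR_conv_of_real)
    qed
    then show ?thesis using e by (simp only: integral_scaleR_right) simp
  qed
  finally show ?thesis .
qed

text \<open>The damped integrals of |F|^2 are pairings of f with its Gaussian averages. Continuity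
  makes the averages converge to f pointwise, boundedness and bounded support allow dominated
  convergence, and the limit is the squared norm of f.\<close>

lemma plancherel_continuous:
  assumes cont: "continuous_on UNIV f" and supp: "\<And>x. norm x \<ge> N \<Longrightarrow> f x = 0"
  shows "integrable lborel f" "f \<in> L2" "nn_L2 (fourier_integral f) = nn_L2 f"
proof -
  have [measurable]: "f \<in> borel_measurable borel"
    using cont by (rule borel_measurable_continuous_onI)
  have "compact (f ` cball 0 N)"
    by (intro compact_continuous_image continuous_on_subset[OF cont]) auto
  then obtain B where "\<forall>x\<in>cball 0 N. cmod (f x) \<le> B"
    by (auto dest!: compact_imp_bounded simp: bounded_iff)
  then have B: "cmod (f x) \<le> B" if "norm x \<le> N" for x using that by simp
  \<comment> \<open>If N < 0 the ball is empty and B could be negative.\<close>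
  define M where "M = max B 0"
  have M: "cmod (f x) \<le> M" and "0 \<le> M" for x
    using B[of x] supp[of x] by (cases "norm x \<le> N"; auto simp: M_def)+
  have ind: "integrable lborel (indicat_real (cball (0::plane) N))"
    by (intro integrable_real_indicator emeasure_bounded_finite) auto
  have le: "cmod (f x) \<le> M * indicat_real (cball 0 N) x" for x
    using M[of x] supp[of x] by (auto simp: indicator_def)
  show f: "integrable lborel f"
    by (rule Bochner_Integration.integrable_bound[OF integrable_mult_right[OF ind, of M]])
       (use le in \<open>auto intro!: AE_I2 order_trans[OF _ abs_ge_self]\<close>)
  have "integrable lborel (\<lambda>x. (cmod (f x))\<^sup>2)"
  proof (rule Bochner_Integration.integrable_bound[OF integrable_mult_right[OF ind, of "M\<^sup>2"]])
    have "norm ((cmod (f x))\<^sup>2) \<le> norm (M\<^sup>2 * indicat_real (cball 0 N) x)" for x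
      using power_mono[OF le[of x], of 2] by (auto simp: indicator_def power_mult_distrib)
    then show "AE x in lborel. norm ((cmod (f x))\<^sup>2) \<le> norm (M\<^sup>2 * indicat_real (cball 0 N) x)"
      by simp
  qed simp
  then show L2: "f \<in> L2" by (simp add: L2_def)
  define e where "e n = 1 / real (Suc n)" for n
  have e: "e n > 0" for n by (simp add: e_def)
  have e0: "e \<longlonglongrightarrow> 0" unfolding e_def by (rule LIMSEQ_Suc[OF lim_1_over_n])
  \<comment> \<open>So far F is only known to be bounded; this weight makes |F|^2 integrable and
    tends to 1 pointwise.\<close>
  define G where "G n \<xi> = exp (- (norm (e n *\<^sub>R \<xi>))\<^sup>2 / 2)" for n and \<xi> :: plane
  have [measurable]: "G n \<in> borel_measurable borel" for n unfolding G_def by measurable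
  have G1: "0 \<le> G n \<xi>" "G n \<xi> \<le> 1" for n \<xi> by (auto simp: G_def)
  have G: "integrable lborel (G n)" for n
    using integrable_gauss e[of n] integrable_lborel_affine_iff[of "\<lambda>x::plane. exp (- (norm x)\<^sup>2 / 2)" "e n" 0]
    unfolding G_def by auto
  let ?F = "fourier_integral f"
  define S where "S n x = (1 / (2 * pi)) *\<^sub>R (LINT z|lborel. f (x + e n *\<^sub>R z) * of_real (exp (- (norm z)\<^sup>2 / 2)))" for n x
  have [measurable]: "S n \<in> borel_measurable borel" for n unfolding S_def by measurable
  have bd: "cmod (?F \<xi>) \<le> (LINT x|lborel. cmod (f x))" for \<xi>
    by (rule fourier_integral_bound[OF f])
  have GF: "integrable lborel (\<lambda>\<xi>. cnj (?F \<xi>) * of_real (G n \<xi>))" for n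
  proof (rule Bochner_Integration.integrable_bound[OF integrable_mult_right[OF G[of n], of "LINT x|lborel. cmod (f x)"]])
    show "AE \<xi> in lborel. norm (cnj (?F \<xi>) * of_real (G n \<xi>)) \<le> norm ((LINT x|lborel. cmod (f x)) * G n \<xi>)"
      using G1 bd by (auto simp: norm_mult abs_mult intro!: mult_right_mono order_trans[OF bd])
  qed simp
  have eq: "(LINT \<xi>|lborel. ?F \<xi> * (cnj (?F \<xi>) * of_real (G n \<xi>))) = (LINT x|lborel. f x * cnj (S n x))" for n
    unfolding fourier_integral_multiplication[OF f GF]
    unfolding G_def fourier_integral_gauss_smoothing[OF f e] S_def ..
  have FGF: "integrable lborel (\<lambda>\<xi>. (cmod (?F \<xi>))\<^sup>2 * G n \<xi>)" for n
  proof (rule Bochner_Integration.integrable_bound[OF integrable_mult_right[OF G[of n], of "(LINT x|lborel. cmod (f x))\<^sup>2"]])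
    show "AE \<xi> in lborel. norm ((cmod (?F \<xi>))\<^sup>2 * G n \<xi>) \<le> norm ((LINT x|lborel. cmod (f x))\<^sup>2 * G n \<xi>)"
      using G1 bd by (auto simp: norm_mult abs_mult intro!: mult_right_mono power_mono)
  qed simp
  have Scont: "(\<lambda>n. S n x) \<longlonglongrightarrow> f x" for x
  proof -
    have gi: "(LINT z|lborel. of_real (exp (- (norm (z::plane))\<^sup>2 / 2))) = complex_of_real (2 * pi)"
      using has_bochner_integral_integral_eq[OF has_bochner_integral_gauss[of 0]] by simp
    have "(\<lambda>n. LINT z|lborel. f (x + e n *\<^sub>R z) * of_real (exp (- (norm z)\<^sup>2 / 2)))
        \<longlonglongrightarrow> (LINT z|lborel. f x * of_real (exp (- (norm (z::plane))\<^sup>2 / 2)))"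
    proof (rule integral_dominated_convergence[where w="\<lambda>z. M * exp (- (norm z)\<^sup>2 / 2)"])
      show "integrable lborel (\<lambda>z::plane. M * exp (- (norm z)\<^sup>2 / 2))"
        by (intro integrable_mult_right integrable_gauss)
      have "(\<lambda>n. f (x + e n *\<^sub>R z)) \<longlonglongrightarrow> f x" for z
      proof -
        have "(\<lambda>n. x + e n *\<^sub>R z) \<longlonglongrightarrow> x + 0 *\<^sub>R z"
          by (intro tendsto_intros e0)
        then show ?thesis
          using cont by (intro continuous_on_tendsto_compose[OF cont]) auto
      qed
      then show "AE z in lborel. (\<lambda>n. f (x + e n *\<^sub>R z) * of_real (exp (- (norm z)\<^sup>2 / 2)))
          \<longlonglongrightarrow> f x * of_real (exp (- (norm z)\<^sup>2 / 2))"
        by (intro AE_I2 tendsto_intros)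
    qed (use M in \<open>auto simp: norm_mult intro!: mult_right_mono\<close>)
    then have "(\<lambda>n. S n x) \<longlonglongrightarrow> (1 / (2 * pi)) *\<^sub>R (f x * of_real (2 * pi))"
      unfolding S_def gi integral_mult_right_zero by (intro tendsto_intros)
    then show ?thesis by (simp add: scaleR_conv_of_real)
  qed
  have Sbd: "cmod (S n x) \<le> M" for n x
  proof -
    have "cmod (LINT z|lborel. f (x + e n *\<^sub>R z) * of_real (exp (- (norm z)\<^sup>2 / 2)))
       \<le> (LINT z|lborel. M * exp (- (norm (z::plane))\<^sup>2 / 2))"
    proof (rule Bochner_Integration.integral_norm_bound_integral)
      have le: "norm (f (x + e n *\<^sub>R z) * of_real (exp (- (norm z)\<^sup>2 / 2))) \<le> M * exp (- (norm z)\<^sup>2 / 2)" for z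
        using M by (simp add: norm_mult mult_right_mono)
      then show "norm (f (x + e n *\<^sub>R z) * of_real (exp (- (norm z)\<^sup>2 / 2))) \<le> M * exp (- (norm z)\<^sup>2 / 2)" for z .
      show 1: "integrable lborel (\<lambda>z::plane. M * exp (- (norm z)\<^sup>2 / 2))"
        by (intro integrable_mult_right integrable_gauss)
      show "integrable lborel (\<lambda>z. f (x + e n *\<^sub>R z) * of_real (exp (- (norm z)\<^sup>2 / 2)))"
        by (rule Bochner_Integration.integrable_bound[OF 1])
           (use le in \<open>auto intro!: AE_I2 order_trans[OF _ abs_ge_self]\<close>)
    qed
    also have "\<dots> = M * (2 * pi)"
    proof -
      have "(LINT z|lborel. complex_of_real (exp (- (norm (z::plane))\<^sup>2 / 2))) = complex_of_real (2 * pi)"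
        using has_bochner_integral_integral_eq[OF has_bochner_integral_gauss[of 0]] by simp
      then show ?thesis by (simp only: integral_complex_of_real of_real_eq_iff integral_mult_right_zero)
    qed
    finally show ?thesis unfolding S_def by (simp add: field_simps)
  qed
  have "(\<lambda>n. LINT x|lborel. f x * cnj (S n x)) \<longlonglongrightarrow> (LINT x|lborel. f x * cnj (f x))"
  proof (rule integral_dominated_convergence[where w="\<lambda>x. M * cmod (f x)"])
    show "AE x in lborel. (\<lambda>n. f x * cnj (S n x)) \<longlonglongrightarrow> f x * cnj (f x)"
      by (intro AE_I2 tendsto_intros Scont)
    show "AE x in lborel. norm (f x * cnj (S n x)) \<le> M * cmod (f x)" for n
    proof (intro AE_I2)
      fix x
      show "norm (f x * cnj (S n x)) \<le> M * cmod (f x)"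
        using mult_right_mono[OF Sbd[of n x] norm_ge_zero[of "f x"]] by (simp add: norm_mult mult.commute)
    qed
  qed (use f in auto)
  moreover have "(LINT x|lborel. f x * cnj (S n x)) = of_real (LINT \<xi>|lborel. (cmod (?F \<xi>))\<^sup>2 * G n \<xi>)" for n
    unfolding eq[symmetric] integral_complex_of_real[symmetric]
    by (intro Bochner_Integration.integral_cong) (simp_all only: of_real_mult complex_norm_square mult.assoc)
  moreover have "(LINT x|lborel. f x * cnj (f x)) = of_real ((L2_norm f)\<^sup>2)"
    unfolding L2_norm_power2 integral_complex_of_real[symmetric]
    by (intro Bochner_Integration.integral_cong) (simp_all only: complex_norm_square)
  ultimately have lim: "(\<lambda>n. LINT \<xi>|lborel. (cmod (?F \<xi>))\<^sup>2 * G n \<xi>) \<longlonglongrightarrow> (L2_norm f)\<^sup>2"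
    by (simp only: tendsto_of_real_iff)
  have nn: "(\<integral>\<^sup>+\<xi>. ennreal ((cmod (?F \<xi>))\<^sup>2 * G n \<xi>) \<partial>lborel) = ennreal (LINT \<xi>|lborel. (cmod (?F \<xi>))\<^sup>2 * G n \<xi>)" for n
    using FGF G1 by (intro nn_integral_eq_integral) auto
  \<comment> \<open>Fatou removes the weight; it enters through its square root, since
    \<open>nn_L2\<close> squares the modulus. The converse inequality below uses only
    \<open>G n \<xi> \<le> 1\<close>.\<close>
  have "nn_L2 ?F \<le> ennreal ((L2_norm f)\<^sup>2)"
  proof (rule nn_L2_Fatou[OF _ _ _ lim])
    show "(\<lambda>\<xi>. ?F \<xi> * of_real (sqrt (G n \<xi>))) \<in> borel_measurable lborel" for n by measurable
    have "(\<lambda>n. ?F \<xi> * of_real (sqrt (G n \<xi>))) \<longlonglongrightarrow> ?F \<xi> * of_real (sqrt (exp (- (norm (0 *\<^sub>R \<xi>))\<^sup>2 / 2)))" for \<xi>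
      unfolding G_def by (intro tendsto_intros e0) simp
    then show "AE \<xi> in lborel. (\<lambda>n. ?F \<xi> * of_real (sqrt (G n \<xi>))) \<longlonglongrightarrow> ?F \<xi>" by simp
    have "nn_L2 (\<lambda>\<xi>. ?F \<xi> * of_real (sqrt (G n \<xi>))) = ennreal (LINT \<xi>|lborel. (cmod (?F \<xi>))\<^sup>2 * G n \<xi>)" for n
      unfolding nn_L2_def nn[symmetric] by (simp add: norm_mult power_mult_distrib G1)
    then show "\<forall>\<^sub>F n in sequentially. nn_L2 (\<lambda>\<xi>. ?F \<xi> * of_real (sqrt (G n \<xi>)))
        \<le> ennreal (LINT \<xi>|lborel. (cmod (?F \<xi>))\<^sup>2 * G n \<xi>)" by simp
  qed
  moreover have "ennreal ((L2_norm f)\<^sup>2) \<le> nn_L2 ?F"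
  proof (rule LIMSEQ_le_const2[OF tendsto_ennrealI[OF lim]], intro exI allI impI)
    fix n
    show "ennreal (LINT \<xi>|lborel. (cmod (?F \<xi>))\<^sup>2 * G n \<xi>) \<le> nn_L2 ?F"
      unfolding nn[symmetric] nn_L2_def
      using G1 by (intro nn_integral_mono ennreal_leI) (simp add: mult_left_le)
  qed
  ultimately show "nn_L2 ?F = nn_L2 f"
    unfolding nn_L2_eq[OF L2] by (rule antisym)
qed

section \<open>Plancherel's theorem\<close>

text \<open>Dominated convergence in both norms at once, the majorant w being integrable and square
  integrable.\<close>

lemma L1_L2_approx:
  assumes w: "integrable lborel w" "\<And>x. 0 \<le> w x" "integrable lborel (\<lambda>x. (w x)\<^sup>2)"
    and f[measurable]: "f \<in> borel_measurable borel" and u[measurable]: "\<And>n. u n \<in> borel_measurable borel"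
    and le: "\<And>n x. cmod (u n x) \<le> w x" "\<And>x. cmod (f x) \<le> w x"
    and lim: "AE x in lborel. (\<lambda>n. u n x) \<longlonglongrightarrow> f x"
  shows "integrable lborel f" "f \<in> L2" "\<And>n. integrable lborel (u n)" "\<And>n. u n \<in> L2"
    and "(\<lambda>n. LINT x|lborel. cmod (u n x - f x)) \<longlonglongrightarrow> 0"
    and "(\<lambda>n. L2_norm (\<lambda>x. u n x - f x)) \<longlonglongrightarrow> 0"
proof -
  have i: "integrable lborel g" "g \<in> L2" if [measurable]: "g \<in> borel_measurable borel" and g: "\<And>x. cmod (g x) \<le> w x" for g
  proof -
    show "integrable lborel g"
      by (rule Bochner_Integration.integrable_bound[OF w(1)]) (use g w(2) in \<open>auto\<close>)
    have "integrable lborel (\<lambda>x. (cmod (g x))\<^sup>2)"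
      by (rule Bochner_Integration.integrable_bound[OF w(3)]) (use power_mono[OF g, of _ 2] in auto)
    then show "g \<in> L2" by (simp add: L2_def)
  qed
  show "integrable lborel f" "f \<in> L2" "\<And>n. integrable lborel (u n)" "\<And>n. u n \<in> L2"
    using le by (auto intro!: i)
  have d: "cmod (u n x - f x) \<le> 2 * w x" for n x
    using norm_triangle_ineq4[of "u n x" "f x"] le(1)[of n x] le(2)[of x] by simp
  have lim0: "AE x in lborel. (\<lambda>n. cmod (u n x - f x)) \<longlonglongrightarrow> 0"
    using lim by eventually_elim (simp add: tendsto_norm_zero LIM_zero)
  have "(\<lambda>n. LINT x|lborel. cmod (u n x - f x)) \<longlonglongrightarrow> (LINT x|(lborel :: plane measure). (0::real))"
  proof (rule integral_dominated_convergence[where w="\<lambda>x. 2 * w x"])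
    show "AE x in lborel. norm (cmod (u n x - f x)) \<le> 2 * w x" for n
      using d by simp
  qed (use w lim0 in auto)
  then show "(\<lambda>n. LINT x|lborel. cmod (u n x - f x)) \<longlonglongrightarrow> 0" by simp
  have "(\<lambda>n. LINT x|lborel. (cmod (u n x - f x))\<^sup>2) \<longlonglongrightarrow> (LINT x|(lborel :: plane measure). (0::real))"
  proof (rule integral_dominated_convergence[where w="\<lambda>x. 4 * (w x)\<^sup>2"])
    show "AE x in lborel. (\<lambda>n. (cmod (u n x - f x))\<^sup>2) \<longlonglongrightarrow> 0"
      using lim0
    proof eventually_elim
      case (elim x)
      from tendsto_power[OF this, of 2] show ?case by simp
    qed
    have "(cmod (u n x - f x))\<^sup>2 \<le> 4 * (w x)\<^sup>2" for n x
      using power_mono[OF d[of n x], of 2] by (simp add: power_mult_distrib)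
    then show "AE x in lborel. norm ((cmod (u n x - f x))\<^sup>2) \<le> 4 * (w x)\<^sup>2" for n by simp
  qed (use w in auto)
  from tendsto_real_sqrt[OF this]
  show "(\<lambda>n. L2_norm (\<lambda>x. u n x - f x)) \<longlonglongrightarrow> 0" by (simp add: L2_norm_def)
qed

text \<open>Density of the continuous functions of bounded support, in L1 and L2 simultaneously, as
  an induction rule: P holds for these and passes to joint limits. Bounded functions of bounded
  support are reached first, then general ones by truncation.\<close>

lemma L1_L2_induct [consumes 2, case_names limit continuous]:
  assumes f: "integrable lborel f" "f \<in> L2"
    and limit: "\<And>u f. (\<And>n. integrable lborel (u n)) \<Longrightarrow> (\<And>n::nat. u n \<in> L2) \<Longrightarrow> (\<And>n. P (u n)) \<Longrightarrow>
      integrable lborel f \<Longrightarrow> f \<in> L2 \<Longrightarrow> (\<lambda>n. LINT x|lborel. cmod (u n x - f x)) \<longlonglongrightarrow> 0 \<Longrightarrow>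
      (\<lambda>n. L2_norm (\<lambda>x. u n x - f x)) \<longlonglongrightarrow> 0 \<Longrightarrow> P f"
    and continuous: "\<And>f N. continuous_on UNIV f \<Longrightarrow> (\<And>x. norm x \<ge> N \<Longrightarrow> f x = 0) \<Longrightarrow> P f"
  shows "P f"
proof -
  have bounded_case: "P h" if [measurable]: "h \<in> borel_measurable borel"
    and M: "\<And>x. cmod (h x) \<le> M" and supp: "\<And>x. norm x > N \<Longrightarrow> h x = 0" for h M and N :: real
  proof -
    \<comment> \<open>This provides continuous functions converging to h off a negligible set, but
      with no control of their size or support.\<close>
    have "h measurable_on UNIV"
      by (rule lebesgue_measurable_imp_measurable_on) (auto intro: measurable_completion)
    then obtain K g where K: "negligible K" and g: "\<And>n. continuous_on UNIV (g n)"
      and lim: "\<And>x. x \<notin> K \<Longrightarrow> (\<lambda>n::nat. g n x) \<longlonglongrightarrow> h x"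
      unfolding measurable_on_def by auto
    have "0 \<le> M" using M[of 0] norm_ge_zero order_trans by blast
    \<comment> \<open>Projection onto the disc of radius M bounds the approximants, and the
      continuous cutoff c below gives them bounded support; neither operation changes h.\<close>
    define r where "r z = closest_point (cball 0 M) z" for z :: complex
    have r_cont: "continuous_on UNIV r" unfolding r_def
      using \<open>0 \<le> M\<close> by (intro continuous_on_closest_point) auto
    have r_le: "cmod (r z) \<le> M" for z
      using closest_point_in_set[of "cball 0 M" z] \<open>0 \<le> M\<close> by (simp add: r_def)
    have r_id: "r z = z" if "cmod z \<le> M" for z
      using that by (simp add: r_def closest_point_self)
    define c where "c x = max 0 (min 1 (N + 1 - norm x))" for x :: plane
    have c01: "0 \<le> c x" "c x \<le> 1" for x by (auto simp: c_def)
    define u where "u n x = of_real (c x) * r (g n x)" for n x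
    have u_cont: "continuous_on UNIV (u n)" for n
      unfolding u_def c_def
      by (intro continuous_intros continuous_on_compose2[OF r_cont g]) auto
    have [measurable]: "u n \<in> borel_measurable borel" for n
      using u_cont by (rule borel_measurable_continuous_onI)
    have u_supp: "u n x = 0" if "norm x \<ge> N + 1" for n x
      using that by (simp add: u_def c_def)
    have ind: "integrable lborel (indicat_real (cball (0::plane) (N + 1)))"
      by (intro integrable_real_indicator emeasure_bounded_finite) auto
    let ?w = "\<lambda>x. M * indicat_real (cball (0::plane) (N + 1)) x"
    have "(\<lambda>x. (?w x)\<^sup>2) = (\<lambda>x. M\<^sup>2 * indicat_real (cball (0::plane) (N + 1)) x)"
      by (auto simp: indicator_def)
    then have w: "integrable lborel ?w" "\<And>x. 0 \<le> ?w x" "integrable lborel (\<lambda>x. (?w x)\<^sup>2)"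
      using ind \<open>0 \<le> M\<close> by auto
    have ule: "cmod (u n x) \<le> ?w x" for n x
    proof (cases "norm x \<le> N + 1")
      case True
      have "cmod (u n x) \<le> 1 * M"
        unfolding u_def norm_mult using c01 r_le by (intro mult_mono) auto
      then show ?thesis using True by simp
    qed (use u_supp[of x n] in simp)
    have hle: "cmod (h x) \<le> ?w x" for x
      using M[of x] supp[of x] by (cases "norm x \<le> N") (auto simp: indicator_def)
    have "AE x in lborel. x \<notin> K"
      using AE_not_in[of K lebesgue] K by (simp only: negligible_iff_null_sets AE_completion_iff)
    then have "AE x in lborel. (\<lambda>n. u n x) \<longlonglongrightarrow> h x"
    proof eventually_elim
      case (elim x)
      have "(\<lambda>n. u n x) \<longlonglongrightarrow> of_real (c x) * r (h x)"
        unfolding u_def by (intro tendsto_intros continuous_on_tendsto_compose[OF r_cont lim[OF elim]]) auto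
      moreover have "of_real (c x) * r (h x) = h x"
        using supp[of x] r_id[OF M[of x]] by (cases "norm x \<le> N") (auto simp: c_def)
      ultimately show ?case by simp
    qed
    note A = L1_L2_approx[OF w \<open>h \<in> borel_measurable borel\<close> \<open>\<And>n. u n \<in> borel_measurable borel\<close> ule hle this]
    show ?thesis
      by (rule limit[OF A(3,4) _ A(1,2,5,6)]) (rule continuous[OF u_cont u_supp])
  qed
  have [measurable]: "f \<in> borel_measurable borel" using f by auto
  \<comment> \<open>Cutting off the domain and the values together leads to the bounded case, with
    |f| itself as majorant.\<close>
  define u where "u n x = (if norm x \<le> real n \<and> cmod (f x) \<le> real n then f x else 0)" for n x
  have um[measurable]: "u n \<in> borel_measurable borel" for n unfolding u_def by measurable
  have "(\<lambda>n. u n x) \<longlonglongrightarrow> f x" for x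
  proof (rule tendsto_eventually)
    show "\<forall>\<^sub>F n in sequentially. u n x = f x"
      using eventually_ge_at_top[of "nat \<lceil>max (norm x) (cmod (f x))\<rceil>"]
      by eventually_elim (auto simp: u_def nat_le_iff ceiling_le_iff)
  qed
  then have lim: "AE x in lborel. (\<lambda>n. u n x) \<longlonglongrightarrow> f x" by simp
  have f2: "integrable lborel (\<lambda>x. (cmod (f x))\<^sup>2)" using f(2) by (simp add: L2_def)
  have ule: "cmod (u n x) \<le> cmod (f x)" for n x by (simp add: u_def)
  note A = L1_L2_approx[OF integrable_norm[OF f(1)] norm_ge_zero f2 \<open>f \<in> borel_measurable borel\<close> um ule order_refl lim]
  show ?thesis
  proof (rule limit[OF A(3,4) _ A(1,2,5,6)])
    show "P (u n)" for n
      by (rule bounded_case[where M="real n" and N="real n"]) (auto simp: u_def)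
  qed
qed

text \<open>The induction is used twice. L1 convergence makes the transforms converge pointwise, so
  Fatou gives the inequality. Applied to differences, the inequality makes the transforms converge
  in L2, and then equality passes to the limit.\<close>

lemma plancherel:
  assumes "integrable lborel f" "f \<in> L2"
  shows "nn_L2 (fourier_integral f) = nn_L2 f"
proof -
  have le: "nn_L2 (fourier_integral f) \<le> nn_L2 f" if "integrable lborel f" "f \<in> L2" for f
    using that
  proof (induct rule: L1_L2_induct)
    case (limit u f)
    have "nn_L2 (fourier_integral f) \<le> ennreal ((L2_norm f)\<^sup>2)"
    proof (rule nn_L2_Fatou)
      show "fourier_integral (u n) \<in> borel_measurable lborel" for n
        using limit(1)[of n] by auto
      have "(\<lambda>n. fourier_integral (u n) \<xi>) \<longlonglongrightarrow> fourier_integral f \<xi>" for \<xi>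
      proof (rule LIM_zero_cancel, rule Lim_null_comparison[OF _ limit(6)])
        show "\<forall>\<^sub>F n in sequentially. norm (fourier_integral (u n) \<xi> - fourier_integral f \<xi>)
            \<le> (LINT x|lborel. cmod (u n x - f x))"
          using fourier_integral_bound[OF Bochner_Integration.integrable_diff[OF limit(1,4)]]
          by (simp add: fourier_integral_diff limit)
      qed
      then show "AE \<xi> in lborel. (\<lambda>n. fourier_integral (u n) \<xi>) \<longlonglongrightarrow> fourier_integral f \<xi>" by simp
      show "(\<lambda>n. (L2_norm (u n))\<^sup>2) \<longlonglongrightarrow> (L2_norm f)\<^sup>2"
        by (intro tendsto_power L2_norm_tendsto limit)
      show "\<forall>\<^sub>F n in sequentially. nn_L2 (fourier_integral (u n)) \<le> ennreal ((L2_norm (u n))\<^sup>2)"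
        using limit(3) by (simp add: nn_L2_eq[OF limit(2)])
    qed
    then show ?case by (simp add: nn_L2_eq limit)
  next
    case (continuous f N)
    then show ?case using plancherel_continuous(3)[of f N] by simp
  qed
  have F: "fourier_integral f \<in> L2" "L2_norm (fourier_integral f) \<le> L2_norm f"
    if "integrable lborel f" "f \<in> L2" for f
  proof -
    show "fourier_integral f \<in> L2"
      using le[OF that] that by (auto simp: L2_iff intro: le_less_trans)
    then show "L2_norm (fourier_integral f) \<le> L2_norm f"
      using le[OF that] nn_L2_eq[OF that(2)] by (intro L2_norm_le_iff[THEN iffD2]) auto
  qed
  have "L2_norm (fourier_integral f) = L2_norm f"
    using assms
  proof (induct rule: L1_L2_induct)
    case (limit u f)
    have "(\<lambda>n. L2_norm (fourier_integral (u n))) \<longlonglongrightarrow> L2_norm (fourier_integral f)"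
    proof (rule L2_norm_tendsto)
      show "(\<lambda>n. L2_norm (\<lambda>x. fourier_integral (u n) x - fourier_integral f x)) \<longlonglongrightarrow> 0"
        by (rule Lim_null_comparison[OF _ limit(7)])
           (use F(2)[OF Bochner_Integration.integrable_diff[OF limit(1,4)] L2_diff[OF limit(2,5)]]
             in \<open>simp add: fourier_integral_diff[OF limit(1,4), abs_def]\<close>)
    qed (use F limit in auto)
    moreover have "(\<lambda>n. L2_norm (u n)) \<longlonglongrightarrow> L2_norm f"
      by (intro L2_norm_tendsto limit)
    ultimately show ?case
      unfolding limit(3) by (rule LIMSEQ_unique)
  next
    case (continuous f N)
    note * = plancherel_continuous[OF continuous]
    show ?case using *(3) F(1)[OF *(1,2)] *(2) by (simp add: nn_L2_eq ennreal_inj power2_eq_iff_nonneg)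
  qed
  then show ?thesis using F(1)[OF assms] assms(2) by (simp add: nn_L2_eq)
qed

corollary
  assumes "integrable lborel f" "f \<in> L2"
  shows fourier_integral_L2: "fourier_integral f \<in> L2"
    and L2_norm_fourier_integral: "L2_norm (fourier_integral f) = L2_norm f"
proof -
  show "fourier_integral f \<in> L2"
    using plancherel[OF assms] assms by (auto simp: L2_iff)
  then show "L2_norm (fourier_integral f) = L2_norm f"
    using plancherel[OF assms] assms by (simp add: nn_L2_eq ennreal_inj power2_eq_iff_nonneg)
qed

section \<open>The Fourier transform on L2\<close>

lemma L2_affine:
  assumes "f \<in> L2" "\<bar>c\<bar> = 1"
  shows "(\<lambda>x. f (t + c *\<^sub>R x)) \<in> L2" "L2_norm (\<lambda>x. f (t + c *\<^sub>R x)) = L2_norm f"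
proof -
  have m[measurable]: "f \<in> borel_measurable borel" using assms by (auto simp: L2_def)
  have "c \<noteq> 0" using assms by auto
  then have "nn_L2 (\<lambda>x. f (t + c *\<^sub>R x)) = nn_L2 f"
    unfolding nn_L2_def
    using nn_integral_lborel_affine[of "\<lambda>x. ennreal ((cmod (f x))\<^sup>2)" c t] assms(2) by simp
  moreover from this show "(\<lambda>x. f (t + c *\<^sub>R x)) \<in> L2" using assms(1) by (simp add: L2_iff)
  ultimately show "L2_norm (\<lambda>x. f (t + c *\<^sub>R x)) = L2_norm f"
    using assms(1) by (simp add: nn_L2_eq ennreal_inj power2_eq_iff_nonneg)
qed

abbreviation trunc :: "nat \<Rightarrow> (plane \<Rightarrow> complex) \<Rightarrow> plane \<Rightarrow> complex" where
  "trunc n f \<equiv> (\<lambda>x. indicator (ball 0 (real n)) x * f x)"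

text \<open>The truncations lie in both spaces: the indicator of a ball is in L2, so its product
  with f is integrable.\<close>

lemma trunc:
  assumes "f \<in> L2"
  shows trunc_L2: "trunc n f \<in> L2" and trunc_integrable: "integrable lborel (trunc n f)"
    and trunc_tendsto: "(\<lambda>n. L2_norm (\<lambda>x. trunc n f x - f x)) \<longlonglongrightarrow> 0"
proof -
  have m[measurable]: "f \<in> borel_measurable borel" using assms by (auto simp: L2_def)
  show L2: "trunc n f \<in> L2" for n
    by (rule L2_mono(1)[OF assms]) (auto simp: norm_mult indicator_def)
  have "integrable lborel (indicat_real (ball (0::plane) (real n)))"
    by (intro integrable_real_indicator emeasure_bounded_finite) auto
  then have "(indicator (ball 0 (real n)) :: plane \<Rightarrow> complex) \<in> L2"
  proof -
    have "(indicator (ball 0 (real n)) :: plane \<Rightarrow> complex) = (\<lambda>x. of_real (indicat_real (ball 0 (real n)) x))"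
      by (auto simp: indicator_def)
    moreover have "(\<lambda>x::plane. (indicat_real (ball 0 (real n)) x)\<^sup>2) = indicat_real (ball 0 (real n))"
      by (auto simp: indicator_def)
    ultimately show ?thesis
      using \<open>integrable lborel (indicat_real (ball (0::plane) (real n)))\<close> by (simp add: L2_def)
  qed
  from L2_mult(1)[OF this assms] show "integrable lborel (trunc n f)" .
  have "(\<lambda>n. LINT x|lborel. (cmod (trunc n f x - f x))\<^sup>2) \<longlonglongrightarrow> (LINT x|(lborel :: plane measure). (0::real))"
  proof (rule integral_dominated_convergence[where w="\<lambda>x. (cmod (f x))\<^sup>2"])
    show "AE x in lborel. (\<lambda>n. (cmod (trunc n f x - f x))\<^sup>2) \<longlonglongrightarrow> 0"
    proof (intro AE_I2 tendsto_eventually)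
      fix x :: plane
      show "\<forall>\<^sub>F n in sequentially. (cmod (trunc n f x - f x))\<^sup>2 = 0"
        using eventually_gt_at_top[of "nat \<lceil>norm x\<rceil>"]
      proof eventually_elim
        case (elim n)
        then have "norm x < real n" by linarith
        then show ?case by simp
      qed
    qed
  qed (use assms in \<open>auto simp: L2_def indicator_def\<close>)
  from tendsto_real_sqrt[OF this]
  show "(\<lambda>n. L2_norm (\<lambda>x. trunc n f x - f x)) \<longlonglongrightarrow> 0" by (simp add: L2_norm_def)
qed

lemma fourier_integral_trunc_L2:
  assumes "f \<in> L2" shows "fourier_integral (trunc n f) \<in> L2"
  by (rule fourier_integral_L2[OF trunc_integrable[OF assms] trunc_L2[OF assms]])

text \<open>By Plancherel the transforms of the truncations are in L2, so the extended distance in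
  the definition is a real one and the L2 calculus applies.\<close>

lemma has_L2_fourier_iff:
  assumes f: "f \<in> L2"
  shows "has_L2_fourier f F \<longleftrightarrow>
    F \<in> L2 \<and> (\<lambda>n. L2_norm (\<lambda>k. fourier_integral (trunc n f) k - F k)) \<longlonglongrightarrow> 0"
proof -
  have "((\<lambda>n. \<integral>\<^sup>+k. ennreal ((cmod (F k - fourier_integral (trunc n f) k))\<^sup>2) \<partial>lborel) \<longlonglongrightarrow> 0)
      \<longleftrightarrow> ((\<lambda>n. L2_norm (\<lambda>k. fourier_integral (trunc n f) k - F k)) \<longlonglongrightarrow> 0)" (is "?l \<longleftrightarrow> ?r")
    if F: "F \<in> L2"
  proof -
    have eq: "(\<integral>\<^sup>+k. ennreal ((cmod (F k - fourier_integral (trunc n f) k))\<^sup>2) \<partial>lborel)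
      = ennreal ((L2_norm (\<lambda>k. fourier_integral (trunc n f) k - F k))\<^sup>2)" for n
      using nn_L2_eq[OF L2_diff[OF F fourier_integral_trunc_L2[OF f]]]
      by (simp add: nn_L2_def L2_norm_minus[of F])
    have "?l \<longleftrightarrow> (\<lambda>n. (L2_norm (\<lambda>k. fourier_integral (trunc n f) k - F k))\<^sup>2) \<longlonglongrightarrow> 0"
      unfolding eq ennreal_0[symmetric] by (subst tendsto_ennreal_iff) auto
    also have "\<dots> \<longleftrightarrow> ?r"
    proof
      assume "(\<lambda>n. (L2_norm (\<lambda>k. fourier_integral (trunc n f) k - F k))\<^sup>2) \<longlonglongrightarrow> 0"
      from tendsto_real_sqrt[OF this] show ?r by simp
    next
      assume ?r
      from tendsto_power[OF this, of 2]
      show "(\<lambda>n. (L2_norm (\<lambda>k. fourier_integral (trunc n f) k - F k))\<^sup>2) \<longlonglongrightarrow> 0" by simp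
    qed
    finally show ?thesis .
  qed
  then show ?thesis unfolding has_L2_fourier_def by blast
qed

lemma has_L2_fourierD:
  assumes "has_L2_fourier f F" "f \<in> L2"
  shows "F \<in> L2" "(\<lambda>n. L2_norm (\<lambda>k. fourier_integral (trunc n f) k - F k)) \<longlonglongrightarrow> 0"
    and "L2_norm F = L2_norm f"
proof -
  show F: "F \<in> L2" and lim: "(\<lambda>n. L2_norm (\<lambda>k. fourier_integral (trunc n f) k - F k)) \<longlonglongrightarrow> 0"
    using assms has_L2_fourier_iff by auto
  have "(\<lambda>n. L2_norm (fourier_integral (trunc n f))) \<longlonglongrightarrow> L2_norm F"
    by (rule L2_norm_tendsto[OF fourier_integral_trunc_L2[OF assms(2)] F lim])
  then have "(\<lambda>n. L2_norm (trunc n f)) \<longlonglongrightarrow> L2_norm F"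
    using L2_norm_fourier_integral[OF trunc_integrable trunc_L2] assms(2) by simp
  moreover have "(\<lambda>n. L2_norm (trunc n f)) \<longlonglongrightarrow> L2_norm f"
    by (rule L2_norm_tendsto[OF trunc_L2 _ trunc_tendsto]) (use assms in auto)
  ultimately show "L2_norm F = L2_norm f" by (rule LIMSEQ_unique)
qed

text \<open>Plancherel carries the Cauchy property of the truncations over to their transforms;
  completeness supplies the limit.\<close>

lemma has_L2_fourier_exists:
  assumes f: "f \<in> L2" obtains F where "has_L2_fourier f F"
proof -
  note T = trunc_L2[OF f] trunc_integrable[OF f]
  have eq: "L2_norm (\<lambda>x. fourier_integral (trunc m f) x - fourier_integral (trunc n f) x)
      = L2_norm (\<lambda>x. trunc m f x - trunc n f x)" for m n
    using L2_norm_fourier_integral[OF Bochner_Integration.integrable_diff[OF T(2) T(2)] L2_diff[OF T(1) T(1)], of m n]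
    by (simp add: fourier_integral_diff[OF T(2) T(2), abs_def])
  obtain F where "F \<in> L2" "(\<lambda>n. L2_norm (\<lambda>k. fourier_integral (trunc n f) k - F k)) \<longlonglongrightarrow> 0"
  proof (rule L2_complete[of "\<lambda>n. fourier_integral (trunc n f)"])
    show "fourier_integral (trunc n f) \<in> L2" for n by (rule fourier_integral_trunc_L2[OF f])
    fix e :: real assume "e > 0"
    then obtain N where N: "\<And>n. n \<ge> N \<Longrightarrow> L2_norm (\<lambda>x. trunc n f x - f x) < e / 2"
      using LIMSEQ_D[OF trunc_tendsto[OF f], of "e/2"] by auto
    have "L2_norm (\<lambda>x. trunc m f x - trunc n f x) \<le> e" if "m \<ge> N" "n \<ge> N" for m n
      using L2_norm_triangle_diff[OF T(1) f T(1), of m n] N[OF that(1)] N[OF that(2)]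
        L2_norm_minus[of f "trunc n f"] by linarith
    then show "\<exists>N. \<forall>m\<ge>N. \<forall>n\<ge>N. L2_norm (\<lambda>x. fourier_integral (trunc m f) x - fourier_integral (trunc n f) x) \<le> e"
      unfolding eq by blast
  qed
  then show ?thesis using that has_L2_fourier_iff[OF f] by blast
qed

text \<open>Reconciles the two clauses of \<open>fourier\<close> on L2: for integrable f the Fourier
  integral is itself a limit of the truncated ones, by Plancherel applied to the
  differences.\<close>

lemma has_L2_fourier_fourier:
  assumes f: "f \<in> L2" shows "has_L2_fourier f (fourier f)"
proof (cases "integrable lborel f")
  case True
  note T = trunc_L2[OF f] trunc_integrable[OF f]
  have "L2_norm (\<lambda>x. fourier_integral (trunc n f) x - fourier_integral f x)
      = L2_norm (\<lambda>x. trunc n f x - f x)" for n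
    using L2_norm_fourier_integral[OF Bochner_Integration.integrable_diff[OF T(2) True] L2_diff[OF T(1) f], of n]
    by (simp add: fourier_integral_diff[OF T(2) True, abs_def])
  then show ?thesis
    using True f trunc_tendsto[OF f] fourier_integral_L2[OF True f]
    by (simp add: has_L2_fourier_iff fourier_def)
next
  case False
  then show ?thesis
    unfolding fourier_def using has_L2_fourier_exists[OF f] by (metis someI)
qed

lemma fourier_L2:
  assumes "f \<in> L2" shows "fourier f \<in> L2" "L2_norm (fourier f) = L2_norm f"
  using has_L2_fourierD[OF has_L2_fourier_fourier[OF assms] assms] by auto

lemma has_L2_fourier_diff:
  assumes "has_L2_fourier f F" "has_L2_fourier g G" and f: "f \<in> L2" and g: "g \<in> L2"
  shows "has_L2_fourier (\<lambda>x. f x - g x) (\<lambda>k. F k - G k)"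
proof -
  note F = has_L2_fourierD[OF assms(1) f] and G = has_L2_fourierD[OF assms(2) g]
  have eq: "fourier_integral (trunc n (\<lambda>x. f x - g x)) k
      = fourier_integral (trunc n f) k - fourier_integral (trunc n g) k" for n k
    using fourier_integral_diff[OF trunc_integrable[OF f] trunc_integrable[OF g]]
    by (simp add: right_diff_distrib)
  have "(\<lambda>n. L2_norm (\<lambda>k. fourier_integral (trunc n (\<lambda>x. f x - g x)) k - (F k - G k))) \<longlonglongrightarrow> 0"
  proof (rule Lim_null_comparison)
    show "(\<lambda>n. L2_norm (\<lambda>k. fourier_integral (trunc n f) k - F k)
        + L2_norm (\<lambda>k. G k - fourier_integral (trunc n g) k)) \<longlonglongrightarrow> 0"
      using tendsto_add[OF F(2) G(2)] by (simp add: L2_norm_minus[of G])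
    show "\<forall>\<^sub>F n in sequentially. norm (L2_norm (\<lambda>k. fourier_integral (trunc n (\<lambda>x. f x - g x)) k - (F k - G k)))
       \<le> L2_norm (\<lambda>k. fourier_integral (trunc n f) k - F k) + L2_norm (\<lambda>k. G k - fourier_integral (trunc n g) k)"
    proof (intro always_eventually allI)
      fix n
      have "(\<lambda>k. fourier_integral (trunc n (\<lambda>x. f x - g x)) k - (F k - G k))
          = (\<lambda>k. (fourier_integral (trunc n f) k - F k) + (G k - fourier_integral (trunc n g) k))"
        unfolding eq by (simp add: algebra_simps)
      then show "norm (L2_norm (\<lambda>k. fourier_integral (trunc n (\<lambda>x. f x - g x)) k - (F k - G k)))
       \<le> L2_norm (\<lambda>k. fourier_integral (trunc n f) k - F k) + L2_norm (\<lambda>k. G k - fourier_integral (trunc n g) k)"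
        using L2_norm_triangle[OF L2_diff[OF fourier_integral_trunc_L2[OF f] F(1)] L2_diff[OF G(1) fourier_integral_trunc_L2[OF g]]]
        by simp
    qed
  qed
  then show ?thesis using has_L2_fourier_iff[OF L2_diff[OF f g]] L2_diff[OF F(1) G(1)] by blast
qed

lemma has_L2_fourier_cong:
  assumes "has_L2_fourier f F" "f \<in> L2" "g \<in> L2" "AE x in lborel. f x = g x"
  shows "has_L2_fourier g F"
proof -
  have "fourier_integral (trunc n f) = fourier_integral (trunc n g)" for n
    using assms(4) trunc_integrable[OF assms(2)] trunc_integrable[OF assms(3)]
    by (intro ext fourier_integral_cong_AE) auto
  then show ?thesis using assms(1) unfolding has_L2_fourier_def by simp
qed

text \<open>The zero function, as f - f, has F - G as a transform, and transforms preserve the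
  norm.\<close>

lemma has_L2_fourier_unique_AE:
  assumes "has_L2_fourier f F" "has_L2_fourier f G" "f \<in> L2"
  shows "AE k in lborel. F k = G k"
proof -
  have "has_L2_fourier (\<lambda>x. f x - f x) (\<lambda>k. F k - G k)"
    by (rule has_L2_fourier_diff) (use assms in auto)
  then have "L2_norm (\<lambda>k. F k - G k) = 0"
    using has_L2_fourierD(3) by fastforce
  then show ?thesis
    using has_L2_fourierD(1) assms by (intro L2_norm_diff_eq_0_AE) auto
qed

lemma has_L2_fourier_cnj:
  assumes "has_L2_fourier f F" "f \<in> L2"
  shows "has_L2_fourier (\<lambda>x. cnj (f x)) (\<lambda>k. cnj (F (- k)))"
proof -
  have "trunc n (\<lambda>x. cnj (f x)) = (\<lambda>x. cnj (trunc n f x))" for n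
    by (auto simp: indicator_def)
  then have "fourier_integral (trunc n (\<lambda>x. cnj (f x))) k - cnj (F (- k))
      = cnj (fourier_integral (trunc n f) (- k) - F (- k))" for n k
    by (simp only: fourier_integral_cnj complex_cnj_diff)
  then have "L2_norm (\<lambda>k. fourier_integral (trunc n (\<lambda>x. cnj (f x))) k - cnj (F (- k)))
      = L2_norm (\<lambda>k. fourier_integral (trunc n f) k - F k)" for n
    using L2_cnj(2)[OF L2_affine(1)[OF L2_diff[OF fourier_integral_trunc_L2[OF assms(2), of n] has_L2_fourierD(1)[OF assms]], where c="-1" and t=0]]
      L2_affine(2)[OF L2_diff[OF fourier_integral_trunc_L2[OF assms(2), of n] has_L2_fourierD(1)[OF assms]], where c="-1" and t=0]
    by simp
  then show ?thesis
    using has_L2_fourierD[OF assms] L2_cnj(1)[OF L2_affine(1)[OF has_L2_fourierD(1)[OF assms], of "-1" 0]]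
    by (simp add: has_L2_fourier_iff L2_cnj(1) assms(2))
qed

lemma L2_modulate:
  assumes "f \<in> L2" shows "(\<lambda>x. exp (\<i> * of_real (x \<bullet> a)) * f x) \<in> L2"
  by (rule L2_mono(1)[OF assms]) (use assms in \<open>auto simp: norm_mult L2_def\<close>)

lemma has_L2_fourier_modulate:
  assumes "has_L2_fourier f F" and f: "f \<in> L2"
  shows "has_L2_fourier (\<lambda>x. exp (\<i> * of_real (x \<bullet> a)) * f x) (\<lambda>k. F (k - a))"
proof -
  have "trunc n (\<lambda>x. exp (\<i> * of_real (x \<bullet> a)) * f x) = (\<lambda>x. exp (\<i> * of_real (x \<bullet> a)) * trunc n f x)" for n
    by (auto simp: indicator_def)
  then have "L2_norm (\<lambda>k. fourier_integral (trunc n (\<lambda>x. exp (\<i> * of_real (x \<bullet> a)) * f x)) k - F (k - a))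
      = L2_norm (\<lambda>k. fourier_integral (trunc n f) k - F k)" for n
    using L2_affine(2)[OF L2_diff[OF fourier_integral_trunc_L2[OF f, of n] has_L2_fourierD(1)[OF assms]], where c=1 and t="- a"]
    by (simp add: fourier_integral_modulate)
  then show ?thesis
    using has_L2_fourierD[OF assms] L2_affine(1)[OF has_L2_fourierD(1)[OF assms], of 1 "- a"]
    by (simp add: has_L2_fourier_iff[OF L2_modulate[OF f]])
qed

lemma has_L2_fourier_multiplication:
  assumes "has_L2_fourier f F" "has_L2_fourier g G" and f: "f \<in> L2" and g: "g \<in> L2"
  shows "(LINT k|lborel. F k * g k) = (LINT x|lborel. f x * G x)"
proof (rule LIMSEQ_unique)
  show "(\<lambda>n. LINT k|lborel. fourier_integral (trunc n f) k * trunc n g k) \<longlonglongrightarrow> (LINT k|lborel. F k * g k)"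
    by (intro L2_pairing_tendsto fourier_integral_trunc_L2 trunc_L2 trunc_tendsto
        has_L2_fourierD(1)[OF assms(1)] has_L2_fourierD(2)[OF assms(1)] f g)
  have "(\<lambda>n. LINT x|lborel. trunc n f x * fourier_integral (trunc n g) x) \<longlonglongrightarrow> (LINT x|lborel. f x * G x)"
    by (intro L2_pairing_tendsto fourier_integral_trunc_L2 trunc_L2 trunc_tendsto
        has_L2_fourierD(1)[OF assms(2)] has_L2_fourierD(2)[OF assms(2)] f g)
  then show "(\<lambda>n. LINT k|lborel. fourier_integral (trunc n f) k * trunc n g k) \<longlonglongrightarrow> (LINT x|lborel. f x * G x)"
    unfolding fourier_integral_multiplication[OF trunc_integrable[OF f] trunc_integrable[OF g]] .
qed

lemma inv_fourier_L2:
  assumes "v \<in> L2" shows "inv_fourier v \<in> L2" "L2_norm (inv_fourier v) = L2_norm v"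
  using L2_affine[OF fourier_L2(1)[OF assms], of "-1" 0] fourier_L2(2)[OF assms]
  by (simp_all add: inv_fourier_def[abs_def])

text \<open>Inversion by an equality case. Let w be the transform of
  \<open>u = inv_fourier v\<close>. The multiplication formula makes the inner product of w and v
  equal to the squared norm of u, hence of v. As w has the same norm as v, expanding the squared
  norm of w - v gives 0.\<close>

lemma has_L2_fourier_inv_fourier:
  assumes v: "v \<in> L2" shows "has_L2_fourier (inv_fourier v) v"
proof -
  define u where "u = inv_fourier v"
  have u: "u \<in> L2" "L2_norm u = L2_norm v" using inv_fourier_L2[OF v] by (auto simp: u_def)
  note U = has_L2_fourier_fourier[OF u(1)]
  let ?w = "fourier u"
  have w: "?w \<in> L2" "L2_norm ?w = L2_norm v" using fourier_L2[OF u(1)] u(2) by auto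
  have "(LINT k|lborel. ?w k * cnj (v k)) = (LINT x|lborel. u x * cnj (fourier v (- x)))"
    by (rule has_L2_fourier_multiplication[OF U has_L2_fourier_cnj[OF has_L2_fourier_fourier[OF v] v] u(1) L2_cnj(1)[OF v]])
  also have "\<dots> = (LINT x|lborel. complex_of_real ((cmod (u x))\<^sup>2))"
    by (simp only: u_def inv_fourier_def complex_norm_square)
  also have "\<dots> = of_real ((L2_norm v)\<^sup>2)"
    unfolding integral_complex_of_real u(2)[symmetric] L2_norm_power2 ..
  finally have "Re (LINT k|lborel. ?w k * cnj (v k)) = (L2_norm v)\<^sup>2" by simp
  then have "(L2_norm (\<lambda>k. ?w k - v k))\<^sup>2 = 0"
    using L2_norm_add_power2[OF w(1) L2_cmult(1)[OF v, of "-1"]] w(2) L2_cmult(2)[OF v, of "-1"] by simp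
  then have AE: "AE k in lborel. ?w k = v k"
    by (intro L2_norm_diff_eq_0_AE w v) simp
  have "(\<lambda>n. L2_norm (\<lambda>k. fourier_integral (trunc n u) k - ?w k)) = (\<lambda>n. L2_norm (\<lambda>k. fourier_integral (trunc n u) k - v k))"
    by (intro ext L2_norm_cong_AE L2_diff fourier_integral_trunc_L2 u w v) (use AE in auto)
  then show ?thesis using has_L2_fourierD(2)[OF U u(1)] v has_L2_fourier_iff[OF u(1)] by (simp add: u_def)
qed

lemma fourier_inv_fourier:
  assumes "v \<in> L2" shows "AE k in lborel. fourier (inv_fourier v) k = v k"
  by (rule has_L2_fourier_unique_AE[OF has_L2_fourier_fourier has_L2_fourier_inv_fourier])
     (auto simp: inv_fourier_L2 assms)

text \<open>The multiplication formula for f and the conjugate of G; by inversion the latter has the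
  conjugate of g as a transform.\<close>

lemma parseval:
  assumes "has_L2_fourier f F" "has_L2_fourier g G" and f: "f \<in> L2" and g: "g \<in> L2"
  shows "(LINT k|lborel. F k * cnj (G k)) = (LINT x|lborel. f x * cnj (g x))"
proof -
  let ?v = "\<lambda>x. cnj (g x)"
  have v: "?v \<in> L2" using g by (rule L2_cnj)
  have "AE k in lborel. fourier ?v k = cnj (G (- k))"
    by (rule has_L2_fourier_unique_AE[OF has_L2_fourier_fourier[OF v] has_L2_fourier_cnj[OF assms(2) g] v])
  from AE_lborel_affine[OF this, of "-1" 0]
  have AE: "AE k in lborel. inv_fourier ?v k = cnj (G k)" by (simp add: inv_fourier_def)
  have G: "G \<in> L2" by (rule has_L2_fourierD(1)[OF assms(2) g])
  have "has_L2_fourier (\<lambda>k. cnj (G k)) ?v"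
    by (rule has_L2_fourier_cong[OF has_L2_fourier_inv_fourier[OF v] inv_fourier_L2(1)[OF v] L2_cnj(1)[OF G] AE])
  from has_L2_fourier_multiplication[OF assms(1) this f L2_cnj(1)[OF G]] show ?thesis .
qed

text \<open>The integral at k pairs g with the conjugate of the modulated function
  \<open>?v\<close>, so Parseval yields the convolution. It holds at every k, not only almost
  everywhere, and 1/(2 pi) is the normalisation of the transform.\<close>

lemma fourier_integral_mult:
  assumes f: "f \<in> L2" and g: "g \<in> L2" and G: "has_L2_fourier g G"
  shows "fourier_integral (\<lambda>x. f x * g x) k
    = (1 / (2 * pi)) *\<^sub>R (LINT \<eta>|lborel. fourier f (k - \<eta>) * G \<eta>)"
proof -
  let ?v = "\<lambda>x. exp (\<i> * of_real (x \<bullet> k)) * cnj (f x)"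
  have "has_L2_fourier ?v (\<lambda>\<eta>. cnj (fourier f (- (\<eta> - k))))"
    by (rule has_L2_fourier_modulate[OF has_L2_fourier_cnj[OF has_L2_fourier_fourier[OF f] f] L2_cnj(1)[OF f]])
  from parseval[OF G this g L2_modulate[OF L2_cnj(1)[OF f]]]
  have "(LINT \<eta>|lborel. G \<eta> * fourier f (k - \<eta>)) = (LINT x|lborel. g x * cnj (?v x))" by simp
  also have "(\<lambda>x. g x * cnj (?v x)) = (\<lambda>x. exp (- \<i> * of_real (x \<bullet> k)) * (f x * g x))"
    by (auto simp: exp_cnj mult_ac)
  finally show ?thesis
    unfolding fourier_integral_def by (simp only: mult.commute[of "fourier f _"])
qed

section \<open>Fourier multipliers and the commutator\<close>

lemma bounded_support_L2:
  assumes [measurable]: "h \<in> borel_measurable borel"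
    and "\<And>x. cmod (h x) \<le> B" "\<And>x. norm x > R \<Longrightarrow> h x = 0"
  shows "h \<in> L2"
proof -
  have ind: "integrable lborel (indicat_real (cball (0::plane) R))"
    by (intro integrable_real_indicator emeasure_bounded_finite) auto
  have "integrable lborel (\<lambda>x. (cmod (h x))\<^sup>2)"
  proof (rule Bochner_Integration.integrable_bound[OF integrable_mult_right[OF ind, of "B\<^sup>2"]])
    have "norm ((cmod (h x))\<^sup>2) \<le> norm (B\<^sup>2 * indicat_real (cball 0 R) x)" for x
      using power_mono[OF assms(2)[of x], of 2] assms(3)[of x] by (auto simp: indicator_def)
    then show "AE x in lborel. norm ((cmod (h x))\<^sup>2) \<le> norm (B\<^sup>2 * indicat_real (cball 0 R) x)"
      by simp
  qed simp
  then show ?thesis by (simp add: L2_def)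
qed

lemma L2_bounded_support_integrable:
  assumes h: "h \<in> L2" and "\<And>x. norm x > R \<Longrightarrow> h x = 0"
  shows "integrable lborel h"
proof -
  have [measurable]: "h \<in> borel_measurable borel" using h by (auto simp: L2_def)
  have "(\<lambda>x. of_real (indicat_real (cball 0 R) x)) \<in> L2"
    by (rule bounded_support_L2[where B=1 and R=R]) (auto simp: indicator_def)
  from L2_mult(1)[OF this h]
  show ?thesis
    by (rule Bochner_Integration.integrable_bound) (use assms(2) in \<open>auto simp: indicator_def\<close>)
qed

lemma L2_bounded_mult:
  assumes f: "f \<in> L2" and [measurable]: "h \<in> borel_measurable borel" and "\<And>x. cmod (h x) \<le> B"
  shows "(\<lambda>x. f x * h x) \<in> L2"
proof (rule L2_mono(1)[OF L2_cmult(1)[OF f, of "of_real B"]])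
  show "(\<lambda>x. f x * h x) \<in> borel_measurable lborel" using f by (auto simp: L2_def)
  have "cmod (f x * h x) \<le> cmod (of_real B * f x)" for x
    using mult_right_mono[OF order_trans[OF assms(3)[of x] abs_ge_self] norm_ge_zero[of "f x"]]
    by (simp add: norm_mult mult.commute)
  then show "AE x in lborel. cmod (f x * h x) \<le> cmod (of_real B * f x)" by simp
qed

lemma L2_mult_shift_integrable:
  assumes "f \<in> L2" "g \<in> L2"
  shows "integrable lborel (\<lambda>\<eta>. f (\<xi> - \<eta>) * g \<eta>)"
  using L2_mult(1)[OF L2_affine(1)[OF assms(1), of "-1" \<xi>] assms(2)] by simp

lemma fourier_multiplier_L2:
  assumes "(\<lambda>\<xi>. of_real (\<sigma> \<xi>) * fourier h \<xi>) \<in> L2"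
  shows "fourier_multiplier \<sigma> h \<in> L2"
    and "has_L2_fourier (fourier_multiplier \<sigma> h) (\<lambda>\<xi>. of_real (\<sigma> \<xi>) * fourier h \<xi>)"
    and "AE \<xi> in lborel. fourier (fourier_multiplier \<sigma> h) \<xi> = of_real (\<sigma> \<xi>) * fourier h \<xi>"
  unfolding fourier_multiplier_def
  using inv_fourier_L2(1)[OF assms] has_L2_fourier_inv_fourier[OF assms] fourier_inv_fourier[OF assms] by auto

text \<open>The transform of the inner multiplier equals its symbol times that of h only almost
  everywhere, so the symbols cannot simply be multiplied; w is the representative that occurs. The
  conditions on h concern its transform alone, since h is later both a function of L2 and an
  integrable product.\<close>

lemma fourier_multiplier_comp:
  fixes \<sigma>\<^sub>1 \<sigma>\<^sub>2 :: "plane \<Rightarrow> real"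
  assumes [measurable]: "\<sigma>\<^sub>1 \<in> borel_measurable borel" "\<sigma>\<^sub>2 \<in> borel_measurable borel"
    and 1: "(\<lambda>\<xi>. of_real (\<sigma>\<^sub>1 \<xi>) * fourier h \<xi>) \<in> L2"
    and 2: "(\<lambda>\<xi>. of_real (\<sigma>\<^sub>2 \<xi> * \<sigma>\<^sub>1 \<xi>) * fourier h \<xi>) \<in> L2"
  defines "w \<equiv> \<lambda>\<xi>. of_real (\<sigma>\<^sub>2 \<xi>) * fourier (fourier_multiplier \<sigma>\<^sub>1 h) \<xi>"
  shows "w \<in> L2" "AE \<xi> in lborel. of_real (\<sigma>\<^sub>2 \<xi> * \<sigma>\<^sub>1 \<xi>) * fourier h \<xi> = w \<xi>"
    and "fourier_multiplier \<sigma>\<^sub>2 (fourier_multiplier \<sigma>\<^sub>1 h) = inv_fourier w"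
    and "fourier_multiplier \<sigma>\<^sub>2 (fourier_multiplier \<sigma>\<^sub>1 h) \<in> L2"
    and "has_L2_fourier (fourier_multiplier \<sigma>\<^sub>2 (fourier_multiplier \<sigma>\<^sub>1 h)) w"
proof -
  note M = fourier_multiplier_L2[OF 1]
  show AE: "AE \<xi> in lborel. of_real (\<sigma>\<^sub>2 \<xi> * \<sigma>\<^sub>1 \<xi>) * fourier h \<xi> = w \<xi>"
    using M(3) by eventually_elim (simp add: w_def)
  have [measurable]: "fourier (fourier_multiplier \<sigma>\<^sub>1 h) \<in> borel_measurable borel"
    using fourier_L2(1)[OF M(1)] by (simp add: L2_def)
  have "w \<in> borel_measurable lborel" unfolding w_def by measurable
  from L2_cong_AE[OF 2 this AE] show w: "w \<in> L2" .
  show "fourier_multiplier \<sigma>\<^sub>2 (fourier_multiplier \<sigma>\<^sub>1 h) = inv_fourier w"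
    by (simp add: fourier_multiplier_def[of \<sigma>\<^sub>2] w_def)
  then show "fourier_multiplier \<sigma>\<^sub>2 (fourier_multiplier \<sigma>\<^sub>1 h) \<in> L2"
    and "has_L2_fourier (fourier_multiplier \<sigma>\<^sub>2 (fourier_multiplier \<sigma>\<^sub>1 h)) w"
    using inv_fourier_L2(1)[OF w] has_L2_fourier_inv_fourier[OF w] by auto
qed

text \<open>With T the composed multiplier, T g is bounded because its transform is integrable, so f
  (T g) is in L1 and in L2. The transform of f g is bounded, and a bounded symbol of bounded support
  makes T (f g) an L2 function. Subtracting the two convolution integrals puts the symbol difference
  into the kernel.\<close>

lemma mult_commutator_fourier:
  fixes \<sigma>\<^sub>1 \<sigma>\<^sub>2 :: "plane \<Rightarrow> real"
  assumes [measurable]: "\<sigma>\<^sub>1 \<in> borel_measurable borel" "\<sigma>\<^sub>2 \<in> borel_measurable borel"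
    and B1: "\<And>\<xi>. \<bar>\<sigma>\<^sub>1 \<xi>\<bar> \<le> B\<^sub>1" and B2: "\<And>\<xi>. \<bar>\<sigma>\<^sub>2 \<xi> * \<sigma>\<^sub>1 \<xi>\<bar> \<le> B\<^sub>2"
    and supp: "\<And>\<xi>. norm \<xi> > R \<Longrightarrow> \<sigma>\<^sub>1 \<xi> = 0"
    and f: "f \<in> L2" and g: "g \<in> L2"
  defines "D \<equiv> mult_commutator f (fourier_multiplier \<sigma>\<^sub>2 \<circ> fourier_multiplier \<sigma>\<^sub>1) g"
  shows "D \<in> L2"
    and "AE \<xi> in lborel. fourier D \<xi> = (1 / (2 * pi)) *\<^sub>R (LINT \<eta>|lborel.
       fourier f (\<xi> - \<eta>) * of_real (\<sigma>\<^sub>2 \<eta> * \<sigma>\<^sub>1 \<eta> - \<sigma>\<^sub>2 \<xi> * \<sigma>\<^sub>1 \<xi>) * fourier g \<eta>)"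
proof -
  define m where "m \<xi> = \<sigma>\<^sub>2 \<xi> * \<sigma>\<^sub>1 \<xi>" for \<xi>
  have [measurable]: "m \<in> borel_measurable borel" unfolding m_def by measurable
  have mb: "\<bar>m \<xi>\<bar> \<le> B\<^sub>2" for \<xi> using B2 by (simp add: m_def)
  define T where "T = fourier_multiplier \<sigma>\<^sub>2 \<circ> fourier_multiplier \<sigma>\<^sub>1"
  note F = fourier_L2[OF f] and G = fourier_L2[OF g]
  have [measurable]: "f \<in> borel_measurable borel" "g \<in> borel_measurable borel"
    "fourier f \<in> borel_measurable borel" "fourier g \<in> borel_measurable borel"
    using f g F G by (auto simp: L2_def)
  have mG: "(\<lambda>\<xi>. of_real (m \<xi>) * fourier g \<xi>) \<in> L2"
    using L2_bounded_mult[OF G(1), of "\<lambda>\<xi>. of_real (m \<xi>)" "B\<^sub>2"] mb by (simp add: mult.commute)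
  have sG: "(\<lambda>\<xi>. of_real (\<sigma>\<^sub>1 \<xi>) * fourier g \<xi>) \<in> L2"
    using L2_bounded_mult[OF G(1), of "\<lambda>\<xi>. of_real (\<sigma>\<^sub>1 \<xi>)" "B\<^sub>1"] B1 by (simp add: mult.commute)
  define v where "v \<xi> = of_real (\<sigma>\<^sub>2 \<xi>) * fourier (fourier_multiplier \<sigma>\<^sub>1 g) \<xi>" for \<xi>
  have v: "v \<in> L2" "AE \<xi> in lborel. of_real (m \<xi>) * fourier g \<xi> = v \<xi>" "T g = inv_fourier v"
      "T g \<in> L2" "has_L2_fourier (T g) v"
    using fourier_multiplier_comp[OF assms(1,2) sG] mG unfolding v_def m_def T_def by auto
  have [measurable]: "v \<in> borel_measurable borel" using v by (auto simp: L2_def)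
  have mG1: "integrable lborel (\<lambda>\<xi>. of_real (m \<xi>) * fourier g \<xi>)"
    by (rule L2_bounded_support_integrable[OF mG, of R]) (auto simp: m_def supp)
  then have "integrable lborel v"
    by (rule integrable_cong_AE_imp) (use v(2) in auto)
  \<comment> \<open>Since v is integrable, \<open>fourier v\<close> is a genuine Fourier integral,
    bounded at every point.\<close>
  then have Tg_bound: "cmod (T g x) \<le> (LINT \<xi>|lborel. cmod (v \<xi>))" for x
    unfolding v(3) inv_fourier_def fourier_def by (simp add: fourier_integral_bound)
  have [measurable]: "T g \<in> borel_measurable borel" using v(4) by (simp add: L2_def)
  have fTg: "(\<lambda>x. f x * T g x) \<in> L2"
    by (rule L2_bounded_mult[OF f _ Tg_bound]) simp
  have fTg1: "integrable lborel (\<lambda>x. f x * T g x)" by (rule L2_mult(1)[OF f v(4)])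
  define h where "h x = f x * g x" for x
  have h: "integrable lborel h" unfolding h_def by (rule L2_mult(1)[OF f g])
  define H where "H = fourier_integral h"
  have H: "fourier h = H" using h by (simp add: fourier_def H_def)
  have [measurable]: "H \<in> borel_measurable borel" unfolding H_def using h by auto
  have Hb: "cmod (H \<xi>) \<le> (LINT x|lborel. cmod (h x))" for \<xi>
    unfolding H_def by (rule fourier_integral_bound[OF h])
  have sH: "(\<lambda>\<xi>. of_real (\<sigma>\<^sub>1 \<xi>) * H \<xi>) \<in> L2"
    by (rule bounded_support_L2[where R=R and B="B\<^sub>1 * (LINT x|lborel. cmod (h x))"])
       (use B1 in \<open>auto simp: norm_mult supp intro!: mult_mono Hb order_trans[OF abs_ge_zero B1]\<close>)
  have mH: "(\<lambda>\<xi>. of_real (m \<xi>) * H \<xi>) \<in> L2"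
    by (rule bounded_support_L2[where R=R and B="B\<^sub>2 * (LINT x|lborel. cmod (h x))"])
       (use mb supp in \<open>auto simp: norm_mult intro!: mult_mono Hb order_trans[OF abs_ge_zero mb]\<close>, simp add: m_def)
  define u where "u \<xi> = of_real (\<sigma>\<^sub>2 \<xi>) * fourier (fourier_multiplier \<sigma>\<^sub>1 h) \<xi>" for \<xi>
  have u: "AE \<xi> in lborel. of_real (m \<xi>) * H \<xi> = u \<xi>" "T h \<in> L2" "has_L2_fourier (T h) u"
    using fourier_multiplier_comp[OF assms(1,2), of h] sH mH unfolding u_def m_def T_def H by auto
  have D: "D = (\<lambda>x. f x * T g x - T h x)"
    unfolding D_def mult_commutator_def T_def h_def[abs_def] ..
  show DL2: "D \<in> L2" unfolding D by (rule L2_diff[OF fTg u(2)])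
  \<comment> \<open>As f (T g) is integrable too, its transform is taken to be the Fourier integral,
    to which the convolution formula applies.\<close>
  have "has_L2_fourier D (\<lambda>\<xi>. fourier_integral (\<lambda>x. f x * T g x) \<xi> - u \<xi>)"
    unfolding D using has_L2_fourier_diff[OF has_L2_fourier_fourier[OF fTg] u(3) fTg u(2)] fTg1
    by (simp add: fourier_def)
  from has_L2_fourier_unique_AE[OF has_L2_fourier_fourier[OF DL2] this DL2] u(1)
  show "AE \<xi> in lborel. fourier D \<xi> = (1 / (2 * pi)) *\<^sub>R (LINT \<eta>|lborel.
       fourier f (\<xi> - \<eta>) * of_real (\<sigma>\<^sub>2 \<eta> * \<sigma>\<^sub>1 \<eta> - \<sigma>\<^sub>2 \<xi> * \<sigma>\<^sub>1 \<xi>) * fourier g \<eta>)"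
  proof eventually_elim
    case (elim \<xi>)
    have 1: "(LINT \<eta>|lborel. fourier f (\<xi> - \<eta>) * v \<eta>)
        = (LINT \<eta>|lborel. fourier f (\<xi> - \<eta>) * (of_real (m \<eta>) * fourier g \<eta>))"
      by (rule integral_cong_AE) (use v(2) in auto)
    have "fourier D \<xi> = fourier_integral (\<lambda>x. f x * T g x) \<xi> - of_real (m \<xi>) * H \<xi>"
      using elim by simp
    also have "\<dots> = (1 / (2 * pi)) *\<^sub>R ((LINT \<eta>|lborel. fourier f (\<xi> - \<eta>) * (of_real (m \<eta>) * fourier g \<eta>))
         - of_real (m \<xi>) * (LINT \<eta>|lborel. fourier f (\<xi> - \<eta>) * fourier g \<eta>))"
      unfolding H_def h_def fourier_integral_mult[OF f v(4,5)]
        fourier_integral_mult[OF f g has_L2_fourier_fourier[OF g]] 1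
      by (simp add: scaleR_diff_right)
    also have "(LINT \<eta>|lborel. fourier f (\<xi> - \<eta>) * (of_real (m \<eta>) * fourier g \<eta>))
         - of_real (m \<xi>) * (LINT \<eta>|lborel. fourier f (\<xi> - \<eta>) * fourier g \<eta>)
       = (LINT \<eta>|lborel. fourier f (\<xi> - \<eta>) * (of_real (m \<eta>) * fourier g \<eta>)
           - of_real (m \<xi>) * (fourier f (\<xi> - \<eta>) * fourier g \<eta>))"
      by (subst Bochner_Integration.integral_diff)
         (auto intro!: L2_mult_shift_integrable F G mG integrable_mult_right)
    also have "\<dots> = (LINT \<eta>|lborel. fourier f (\<xi> - \<eta>) * of_real (\<sigma>\<^sub>2 \<eta> * \<sigma>\<^sub>1 \<eta> - \<sigma>\<^sub>2 \<xi> * \<sigma>\<^sub>1 \<xi>) * fourier g \<eta>)"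
      by (intro Bochner_Integration.integral_cong) (simp_all add: m_def algebra_simps)
    finally show ?case .
  qed
qed

lemma gevrey_symbol_measurable [measurable]: "gevrey_symbol lam \<kappa> \<alpha> s \<in> borel_measurable borel"
  unfolding gevrey_symbol_def by measurable

lemma gevrey_Hdot_L2:
  assumes f: "f \<in> gevrey_Hdot lam \<kappa> \<alpha> s m" and "0 \<le> m" "0 \<le> \<alpha>" "0 < lam"
  shows "(\<lambda>\<xi>. of_real (gevrey_symbol lam \<kappa> \<alpha> s \<xi>) * fourier f \<xi>) \<in> L2"
proof -
  have fL2: "f \<in> L2" and int: "integrable lborel
     (\<lambda>\<xi>. norm \<xi> powr (2 * m) * (cmod (of_real (gevrey_symbol lam \<kappa> \<alpha> s \<xi>) * fourier f \<xi>))\<^sup>2)"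
    using f by (auto simp: gevrey_Hdot_def)
  let ?v = "\<lambda>\<xi>. of_real (gevrey_symbol lam \<kappa> \<alpha> s \<xi>) * fourier f \<xi>"
  define K where "K = exp (lam * s powr (\<alpha> / \<kappa>))"
  have F: "integrable lborel (\<lambda>\<xi>. K\<^sup>2 * (cmod (fourier f \<xi>))\<^sup>2)"
    and [measurable]: "fourier f \<in> borel_measurable borel"
    using fourier_L2(1)[OF fL2] by (auto simp: L2_def)
  have "integrable lborel (\<lambda>\<xi>. (cmod (?v \<xi>))\<^sup>2)"
  proof (rule Bochner_Integration.integrable_bound[OF Bochner_Integration.integrable_add[OF F int]])
    have "(cmod (?v \<xi>))\<^sup>2 \<le> K\<^sup>2 * (cmod (fourier f \<xi>))\<^sup>2 + norm \<xi> powr (2 * m) * (cmod (?v \<xi>))\<^sup>2" for \<xi>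
    proof (cases "norm \<xi> \<le> 1")
      case True
      then have "norm \<xi> powr \<alpha> \<le> 1" using assms by (simp add: powr_le1)
      then have "gevrey_symbol lam \<kappa> \<alpha> s \<xi> \<le> K"
        unfolding gevrey_symbol_def K_def using assms by (simp add: mult_left_le)
      then have "cmod (?v \<xi>) \<le> K * cmod (fourier f \<xi>)"
        by (simp add: norm_mult mult_right_mono gevrey_symbol_def)
      from power_mono[OF this, of 2] show ?thesis
        by (simp add: power_mult_distrib add_increasing2)
    next
      case False
      then have "1 \<le> norm \<xi> powr (2 * m)" using assms by (simp add: ge_one_powr_ge_zero)
      then have "1 * (cmod (?v \<xi>))\<^sup>2 \<le> norm \<xi> powr (2 * m) * (cmod (?v \<xi>))\<^sup>2"
        by (rule mult_right_mono) simp
      then show ?thesis by (simp add: add_increasing)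
    qed
    then show "AE \<xi> in lborel. norm ((cmod (?v \<xi>))\<^sup>2)
        \<le> norm (K\<^sup>2 * (cmod (fourier f \<xi>))\<^sup>2 + norm \<xi> powr (2 * m) * (cmod (?v \<xi>))\<^sup>2)"
      by (intro AE_I2) (simp add: order_trans[OF _ abs_ge_self])
  qed simp
  then show ?thesis by (simp add: L2_def)
qed

text \<open>Turns the norms of the theorem into weighted integrals of |f^|, so that all later
  estimates concern nonnegative functions on the Fourier side.\<close>

lemma Hdot_norm_gevrey:
  assumes f: "f \<in> gevrey_Hdot lam \<kappa> \<alpha> s m" and "0 \<le> m" "0 \<le> \<alpha>" "0 < lam"
  shows "(\<integral>\<^sup>+\<xi>. ennreal ((norm \<xi> powr m * gevrey_symbol lam \<kappa> \<alpha> s \<xi> * cmod (fourier f \<xi>))\<^sup>2) \<partial>lborel)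
    = ennreal ((Hdot_norm m (gevrey lam \<kappa> \<alpha> s f))\<^sup>2)"
proof -
  let ?v = "\<lambda>\<xi>. of_real (gevrey_symbol lam \<kappa> \<alpha> s \<xi>) * fourier f \<xi>"
  note M = fourier_multiplier_L2[OF gevrey_Hdot_L2[OF assms]]
  have [measurable]: "fourier (fourier_multiplier (gevrey_symbol lam \<kappa> \<alpha> s) f) \<in> borel_measurable borel"
    using fourier_L2(1)[OF M(1)] by (simp add: L2_def)
  have [measurable]: "fourier f \<in> borel_measurable borel"
    using f fourier_L2(1)[of f] by (auto simp: L2_def gevrey_Hdot_def)
  have "(Hdot_norm m (gevrey lam \<kappa> \<alpha> s f))\<^sup>2
      = (LINT \<xi>|lborel. norm \<xi> powr (2 * m) * (cmod (fourier (gevrey lam \<kappa> \<alpha> s f) \<xi>))\<^sup>2)"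
    unfolding Hdot_norm_def by (intro real_sqrt_pow2 Bochner_Integration.integral_nonneg) simp
  also have "\<dots> = (LINT \<xi>|lborel. norm \<xi> powr (2 * m) * (cmod (?v \<xi>))\<^sup>2)"
    using M(3) unfolding gevrey_def by (intro integral_cong_AE) auto
  finally have eq: "(Hdot_norm m (gevrey lam \<kappa> \<alpha> s f))\<^sup>2 = \<dots>" .
  have "(norm \<xi> powr m * gevrey_symbol lam \<kappa> \<alpha> s \<xi> * cmod (fourier f \<xi>))\<^sup>2
      = norm \<xi> powr (2 * m) * (cmod (?v \<xi>))\<^sup>2" for \<xi>
  proof -
    have "(norm \<xi> powr m)\<^sup>2 = norm \<xi> powr (2 * m)"
      by (simp add: power2_eq_square powr_add[symmetric])
    then show ?thesis by (simp add: norm_mult power_mult_distrib)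
  qed
  then show ?thesis
    unfolding eq using f by (subst nn_integral_eq_integral[symmetric]) (auto simp: gevrey_Hdot_def)
qed

lemma lp_phi_measurable:
  assumes "lp_cutoff \<psi>" shows "lp_phi \<psi> \<in> borel_measurable borel"
proof -
  have "continuously_differentiable 0 \<psi>"
    using assms unfolding lp_cutoff_def smooth_def by blast
  then have [measurable]: "\<psi> \<in> borel_measurable borel"
    by (simp add: borel_measurable_continuous_onI)
  show ?thesis unfolding lp_phi_def[abs_def] by measurable
qed

section \<open>Kernel bounds\<close>

text \<open>The fractions a/(a + b) and b/(a + b) add up to 1 and lie where x <= x^\<alpha>.\<close>

lemma powr_add_le:
  fixes a b :: real
  assumes "0 \<le> a" "0 \<le> b" "0 \<le> \<alpha>" "\<alpha> \<le> 1"
  shows "(a + b) powr \<alpha> \<le> a powr \<alpha> + b powr \<alpha>"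
proof (cases "a = 0 \<or> b = 0")
  case False
  then have pos: "a > 0" "b > 0" using assms by auto
  have le: "x \<le> x powr \<alpha>" if "0 < x" "x \<le> 1" for x :: real
    using powr_mono'[of \<alpha> 1 x] that assms by simp
  have "(a + b) powr \<alpha> = (a + b) powr \<alpha> * (a / (a + b) + b / (a + b))"
    using pos by (simp add: add_divide_distrib[symmetric])
  also have "\<dots> \<le> (a + b) powr \<alpha> * ((a / (a + b)) powr \<alpha> + (b / (a + b)) powr \<alpha>)"
    using pos by (intro mult_left_mono add_mono le) auto
  also have "\<dots> = a powr \<alpha> + b powr \<alpha>"
    using pos by (simp add: powr_divide distrib_left)
  finally show ?thesis .
qed (use assms in auto)

text \<open>With x = p/q >= 1 this is x^\<alpha> - 1 <= x - 1, rescaled by q^\<alpha>.\<close>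

lemma powr_diff_le:
  fixes p q :: real
  assumes "0 < q" "q \<le> p" "0 \<le> \<alpha>" "\<alpha> \<le> 1"
  shows "p powr \<alpha> - q powr \<alpha> \<le> q powr (\<alpha> - 1) * (p - q)"
proof -
  have "(p / q) powr \<alpha> \<le> (p / q) powr 1"
    using assms by (intro powr_mono) auto
  then have "q powr \<alpha> * ((p / q) powr \<alpha> - 1) \<le> q powr \<alpha> * (p / q - 1)"
    using assms by (intro mult_left_mono) auto
  moreover have "q powr \<alpha> * (p / q) powr \<alpha> = p powr \<alpha>"
    using assms by (simp add: powr_divide)
  moreover have "q powr \<alpha> * (p / q - 1) = q powr (\<alpha> - 1) * (p - q)"
    using assms by (simp add: powr_diff field_simps)
  ultimately show ?thesis by (simp add: right_diff_distrib)
qed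

text \<open>Three ranges. For y <= 1 the factor y^(-p) is at least 1. For y > 1 and 2|t| <= y, half
  of the decay of exp (-y) remains and beats y^(-p). For y > 1 and 2|t| > y the left side is at most
  1 <= y^(1-p), which is below 2|t| y^(-p).\<close>

lemma abs_one_minus_exp_le:
  fixes t y p :: real
  assumes "\<bar>t\<bar> \<le> y" "0 < y" "0 < p" "p < 1"
  shows "\<bar>1 - exp t\<bar> * exp (- y) \<le> 2 * \<bar>t\<bar> * y powr (- p)"
proof -
  have 1: "\<bar>1 - exp t\<bar> \<le> \<bar>t\<bar> * exp \<bar>t\<bar>"
  proof (cases "t \<ge> 0")
    case True
    have "1 - t \<le> exp (- t)" using exp_ge_add_one_self[of "- t"] by simp
    then have "exp t * (1 - t) \<le> exp t * exp (- t)" by (intro mult_left_mono) auto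
    then have "exp t - 1 \<le> t * exp t" by (simp add: exp_minus algebra_simps)
    then show ?thesis using True by (simp add: abs_if)
  next
    case False
    have "1 - exp t \<le> - t" using exp_ge_add_one_self[of t] by linarith
    also have "\<dots> \<le> - t * exp (- t)" using False by (simp add: mult_le_cancel_left1)
    finally show ?thesis using False by (simp add: abs_if)
  qed
  have 2: "\<bar>1 - exp t\<bar> * exp (- y) \<le> \<bar>t\<bar> * exp (\<bar>t\<bar> - y)"
    using mult_right_mono[OF 1, of "exp (- y)"] by (simp add: exp_diff exp_minus divide_inverse mult.assoc)
  show ?thesis
  proof (cases "y \<le> 1")
    case True
    have "\<bar>t\<bar> * exp (\<bar>t\<bar> - y) \<le> \<bar>t\<bar> * (2 * y powr (- p))"
    proof (rule mult_left_mono)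
      have "exp (\<bar>t\<bar> - y) \<le> 1" using assms by simp
      also have "1 \<le> y powr (- p)"
        using powr_mono'[of "- p" 0 y] True assms by simp
      finally show "exp (\<bar>t\<bar> - y) \<le> 2 * y powr (- p)" using powr_ge_zero[of y "- p"] by linarith
    qed simp
    with 2 show ?thesis by simp
  next
    case y: False
    show ?thesis
    proof (cases "2 * \<bar>t\<bar> \<le> y")
      case True
      have "\<bar>t\<bar> * exp (\<bar>t\<bar> - y) \<le> \<bar>t\<bar> * (2 * y powr (- p))"
      proof (rule mult_left_mono)
        have "y powr p \<le> y powr 1" using y assms by (intro powr_mono) auto
        also have "\<dots> = y" using assms by simp
        also have "\<dots> \<le> 2 * exp (y / 2)" using exp_ge_add_one_self[of "y / 2"] by linarith
        finally have "exp (- y / 2) \<le> 2 * y powr (- p)"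
          using assms by (simp add: exp_minus powr_minus field_simps)
        moreover have "exp (\<bar>t\<bar> - y) \<le> exp (- y / 2)" using True by simp
        ultimately show "exp (\<bar>t\<bar> - y) \<le> 2 * y powr (- p)" by linarith
      qed simp
      with 2 show ?thesis by simp
    next
      case False
      have "\<bar>1 - exp t\<bar> \<le> exp \<bar>t\<bar>"
      proof (cases "t \<ge> 0")
        case False
        then have "exp t \<le> 1" "1 \<le> exp \<bar>t\<bar>" by auto
        then show ?thesis using exp_gt_zero[of t] by linarith
      qed simp
      also have "\<dots> \<le> exp y" using assms by simp
      finally have "\<bar>1 - exp t\<bar> * exp (- y) \<le> 1" by (simp add: exp_minus field_simps)
      also have "1 \<le> y powr (1 - p)" using y assms by (intro ge_one_powr_ge_zero) auto
      also have "\<dots> = y * y powr (- p)" using assms by (simp add: powr_diff powr_minus field_simps)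
      also have "\<dots> \<le> 2 * \<bar>t\<bar> * y powr (- p)" using False by (intro mult_right_mono) auto
      finally show ?thesis .
    qed
  qed
qed

text \<open>Here z, \<open>d\<^sub>1\<close>, \<open>d\<^sub>2\<close> stand for \<zeta>,
  \<delta>_1, \<delta>_2. The radius 4 suits the near region, where \<xi> and \<eta> have size at
  most 4 R and the cutoff is evaluated at \<xi>/R and \<eta>/R.\<close>

locale commutator_kernel =
  fixes \<phi> :: "plane \<Rightarrow> real" and L \<alpha> z d\<^sub>1 d\<^sub>2 :: real
  assumes phi_measurable [measurable]: "\<phi> \<in> borel_measurable borel"
    and phi01: "\<And>x. 0 \<le> \<phi> x" "\<And>x. \<phi> x \<le> 1"
    and phi_supp: "\<And>x. norm x < 1/2 \<Longrightarrow> \<phi> x = 0" "\<And>x. norm x > 2 \<Longrightarrow> \<phi> x = 0"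
    and phi_lip: "\<And>x y. norm x \<le> 4 \<Longrightarrow> norm y \<le> 4 \<Longrightarrow> \<bar>\<phi> x - \<phi> y\<bar> \<le> L * norm (x - y)"
    and L: "0 \<le> L" and \<alpha>: "0 < \<alpha>" "\<alpha> \<le> 1" and z: "0 < z" "z < \<alpha>"
    and \<delta>: "0 < d\<^sub>1" "0 < d\<^sub>2" "d\<^sub>1 + z < 1" "d\<^sub>2 < 1"
begin

definition E :: "real \<Rightarrow> plane \<Rightarrow> real" where "E \<tau> x = exp (\<tau> * norm x powr \<alpha>)"

definition m :: "real \<Rightarrow> real \<Rightarrow> plane \<Rightarrow> real" where "m \<tau> R x = E \<tau> x * \<phi> (x /\<^sub>R R)"

lemma E_pos: "0 < E \<tau> x" by (simp add: E_def)

lemma E_submult: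
  assumes "0 \<le> \<tau>" shows "E \<tau> \<xi> \<le> E \<tau> (\<xi> - \<eta>) * E \<tau> \<eta>"
proof -
  have "norm \<xi> powr \<alpha> \<le> (norm (\<xi> - \<eta>) + norm \<eta>) powr \<alpha>"
    using norm_triangle_sub[of \<xi> \<eta>] \<alpha> by (intro powr_mono2) (auto simp: add.commute)
  also have "\<dots> \<le> norm (\<xi> - \<eta>) powr \<alpha> + norm \<eta> powr \<alpha>"
    using \<alpha> by (intro powr_add_le) auto
  finally show ?thesis
    using assms by (simp add: E_def exp_add[symmetric] distrib_left[symmetric] mult_left_mono)
qed

lemma E_ge_1: "0 \<le> \<tau> \<Longrightarrow> 1 \<le> E \<tau> x" by (simp add: E_def)

lemma m_bounds:
  assumes "0 \<le> \<tau>" shows "0 \<le> m \<tau> R x" "m \<tau> R x \<le> E \<tau> x"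
  using phi01[of "x /\<^sub>R R"] E_pos[of \<tau> x] by (auto simp: m_def mult_left_le)

text \<open>Both values of \<open>m\<close> are nonnegative and bounded by the right-hand side, one
  through E >= 1, the other through submultiplicativity; hence so is their difference.\<close>

lemma kernel_trivial:
  assumes "0 \<le> \<tau>" shows "\<bar>m \<tau> R \<eta> - m \<tau> R \<xi>\<bar> \<le> E \<tau> (\<xi> - \<eta>) * E \<tau> \<eta>"
proof -
  have "E \<tau> \<eta> \<le> E \<tau> (\<xi> - \<eta>) * E \<tau> \<eta>"
    using E_ge_1[OF assms, of "\<xi> - \<eta>"] E_pos[of \<tau> \<eta>] by (simp add: mult_le_cancel_right1)
  then show ?thesis
    using m_bounds[OF assms, of R \<eta>] m_bounds[OF assms, of R \<xi>] E_submult[OF assms, of \<xi> \<eta>] by linarith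
qed

lemma kernel_low_high:
  assumes \<tau>: "0 < \<tau>" and R: "0 < R" and h: "\<xi> \<noteq> \<eta>" "norm (\<xi> - \<eta>) \<le> R / 4"
    and ne: "m \<tau> R \<eta> - m \<tau> R \<xi> \<noteq> 0"
  shows "R / 4 \<le> norm \<eta>" "norm \<eta> \<le> 4 * R"
    and "\<bar>m \<tau> R \<eta> - m \<tau> R \<xi>\<bar> \<le> E \<tau> (\<xi> - \<eta>) * E \<tau> \<eta> *
      (L / R * norm (\<xi> - \<eta>) + 8 * \<tau> powr (1 - z / \<alpha>) * R powr (\<alpha> - 1) * norm (\<xi> - \<eta>) powr (1 - z))"
proof -
  define n where "n = norm (\<xi> - \<eta>)"
  have n: "0 < n" "n \<le> R / 4" using h by (auto simp: n_def)
  have "\<phi> (\<eta> /\<^sub>R R) \<noteq> 0 \<or> \<phi> (\<xi> /\<^sub>R R) \<noteq> 0" using ne by (auto simp: m_def)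
  then have "(R / 2 \<le> norm \<eta> \<and> norm \<eta> \<le> 2 * R) \<or> (R / 2 \<le> norm \<xi> \<and> norm \<xi> \<le> 2 * R)"
    using phi_supp[of "\<eta> /\<^sub>R R"] phi_supp[of "\<xi> /\<^sub>R R"] R by (force simp: field_simps not_less[symmetric])
  moreover have d: "\<bar>norm \<xi> - norm \<eta>\<bar> \<le> n"
    unfolding n_def by (rule norm_triangle_ineq3)
  ultimately have b: "R / 4 \<le> norm \<eta>" "R / 4 \<le> norm \<xi>" "norm \<eta> \<le> 4 * R" "norm \<xi> \<le> 4 * R"
    using n R by linarith+
  show "R / 4 \<le> norm \<eta>" "norm \<eta> \<le> 4 * R" using b by auto
  define t where "t = \<tau> * norm \<xi> powr \<alpha> - \<tau> * norm \<eta> powr \<alpha>"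
  define y where "y = \<tau> * n powr \<alpha>"
  have y: "0 < y" using \<tau> n by (simp add: y_def)
  \<comment> \<open>t is bounded twice: by y, from subadditivity, so that the exponential lemma
    applies; and, in \<open>tX\<close>, by a multiple of \<open>norm (\<xi> - \<eta>)\<close>, since
    both points have size R, which gives the gain.\<close>
  have ty: "\<bar>t\<bar> \<le> y"
  proof -
    have "norm u powr \<alpha> \<le> norm v powr \<alpha> + n powr \<alpha>" if "norm u \<le> norm v + n" for u v :: plane
      using powr_mono2[of \<alpha> "norm u" "norm v + n"] powr_add_le[of "norm v" n \<alpha>] \<alpha> n that by simp
    from this[of \<xi> \<eta>] this[of \<eta> \<xi>] have "\<bar>norm \<xi> powr \<alpha> - norm \<eta> powr \<alpha>\<bar> \<le> n powr \<alpha>"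
      using d by linarith
    from mult_left_mono[OF this, of \<tau>] show ?thesis
      using \<tau> by (simp add: t_def y_def right_diff_distrib[symmetric] abs_mult)
  qed
  have tX: "\<bar>t\<bar> \<le> 4 * \<tau> * R powr (\<alpha> - 1) * n"
  proof -
    have *: "norm u powr \<alpha> - norm v powr \<alpha> \<le> 4 * R powr (\<alpha> - 1) * n"
      if "norm u \<le> norm v + n" "R / 4 \<le> norm v" "norm v \<le> norm u" for u v :: plane
    proof -
      have "norm u powr \<alpha> - norm v powr \<alpha> \<le> norm v powr (\<alpha> - 1) * (norm u - norm v)"
        using that R \<alpha> by (intro powr_diff_le) auto
      also have "\<dots> \<le> (R / 4) powr (\<alpha> - 1) * n"
        using that R \<alpha> by (intro mult_mono powr_mono2') auto
      also have "(R / 4) powr (\<alpha> - 1) = R powr (\<alpha> - 1) * 4 powr (1 - \<alpha>)"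
        using R by (simp add: powr_divide powr_diff field_simps)
      also have "\<dots> \<le> R powr (\<alpha> - 1) * 4"
        using powr_mono[of "1 - \<alpha>" 1 "4::real"] \<alpha> by (intro mult_left_mono) auto
      finally show ?thesis using n by (simp add: mult_ac)
    qed
    have "\<bar>norm \<xi> powr \<alpha> - norm \<eta> powr \<alpha>\<bar> \<le> 4 * R powr (\<alpha> - 1) * n"
    proof (cases "norm \<eta> \<le> norm \<xi>")
      case True
      then have "norm \<eta> powr \<alpha> \<le> norm \<xi> powr \<alpha>" using \<alpha> by (intro powr_mono2) auto
      then show ?thesis using *[of \<xi> \<eta>] True b d by simp
    next
      case False
      then have "norm \<xi> powr \<alpha> \<le> norm \<eta> powr \<alpha>" using \<alpha> by (intro powr_mono2) auto
      then show ?thesis using *[of \<eta> \<xi>] False b d by simp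
    qed
    from mult_left_mono[OF this, of \<tau>] show ?thesis
      using \<tau> by (simp add: t_def right_diff_distrib[symmetric] abs_mult mult_ac)
  qed
  have Et: "E \<tau> \<xi> = E \<tau> \<eta> * exp t" by (simp add: E_def t_def exp_diff)
  have Eh: "E \<tau> (\<xi> - \<eta>) = exp y" by (simp add: E_def y_def n_def)
  \<comment> \<open>With p = z/\<alpha> the factor y^(-p) is \<tau>^(-z/\<alpha>) n^(-z); together
    with \<tau> n from \<open>tX\<close> this produces the powers claimed, and 8 = 2 * 4.\<close>
  have "\<bar>1 - exp t\<bar> * exp (- y) \<le> 2 * \<bar>t\<bar> * y powr (- (z / \<alpha>))"
    using ty y z \<alpha> by (intro abs_one_minus_exp_le) auto
  also have "\<dots> \<le> 2 * (4 * \<tau> * R powr (\<alpha> - 1) * n) * y powr (- (z / \<alpha>))"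
  proof (rule mult_right_mono)
    show "2 * \<bar>t\<bar> \<le> 2 * (4 * \<tau> * R powr (\<alpha> - 1) * n)" using tX by linarith
  qed simp
  also have "y powr (- (z / \<alpha>)) = \<tau> powr (- (z / \<alpha>)) * n powr (- z)"
    using \<tau> n \<alpha> by (simp add: y_def powr_mult powr_powr)
  also have "2 * (4 * \<tau> * R powr (\<alpha> - 1) * n) * (\<tau> powr (- (z / \<alpha>)) * n powr (- z))
     = 8 * \<tau> powr (1 - z / \<alpha>) * R powr (\<alpha> - 1) * n powr (1 - z)"
    using \<tau> n by (simp add: powr_diff powr_minus field_simps)
  finally have e: "\<bar>1 - exp t\<bar> \<le> exp y * (8 * \<tau> powr (1 - z / \<alpha>) * R powr (\<alpha> - 1) * n powr (1 - z))"
    by (simp add: exp_minus field_simps)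
  have lip: "\<bar>\<phi> (\<eta> /\<^sub>R R) - \<phi> (\<xi> /\<^sub>R R)\<bar> \<le> L / R * n"
  proof -
    have "\<bar>\<phi> (\<eta> /\<^sub>R R) - \<phi> (\<xi> /\<^sub>R R)\<bar> \<le> L * norm (\<eta> /\<^sub>R R - \<xi> /\<^sub>R R)"
      using b R by (intro phi_lip) (auto simp: field_simps)
    also have "norm (\<eta> /\<^sub>R R - \<xi> /\<^sub>R R) = n / R"
      using R by (simp add: n_def scaleR_diff_right[symmetric] norm_minus_commute divide_inverse mult.commute)
    finally show ?thesis by simp
  qed
  have "m \<tau> R \<eta> - m \<tau> R \<xi> = E \<tau> \<eta> * (\<phi> (\<eta> /\<^sub>R R) - \<phi> (\<xi> /\<^sub>R R)) + \<phi> (\<xi> /\<^sub>R R) * (E \<tau> \<eta> * (1 - exp t))"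
    by (simp add: m_def Et algebra_simps)
  also have "\<bar>\<dots>\<bar> \<le> E \<tau> \<eta> * \<bar>\<phi> (\<eta> /\<^sub>R R) - \<phi> (\<xi> /\<^sub>R R)\<bar> + \<bar>\<phi> (\<xi> /\<^sub>R R)\<bar> * (E \<tau> \<eta> * \<bar>1 - exp t\<bar>)"
    by (rule order_trans[OF abs_triangle_ineq]) (simp add: abs_mult abs_of_pos[OF E_pos])
  also have "\<dots> \<le> E \<tau> \<eta> * (exp y * (L / R * n)) + 1 * (E \<tau> \<eta> * (exp y * (8 * \<tau> powr (1 - z / \<alpha>) * R powr (\<alpha> - 1) * n powr (1 - z))))"
  proof (intro add_mono mult_mono)
    have "1 * (L / R * n) \<le> exp y * (L / R * n)"
      using y L R n by (intro mult_right_mono) auto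
    with lip show "\<bar>\<phi> (\<eta> /\<^sub>R R) - \<phi> (\<xi> /\<^sub>R R)\<bar> \<le> exp y * (L / R * n)" by linarith
  qed (use e E_pos[of \<tau> \<eta>] phi01 in \<open>auto simp: less_imp_le\<close>)
  finally show "\<bar>m \<tau> R \<eta> - m \<tau> R \<xi>\<bar> \<le> E \<tau> (\<xi> - \<eta>) * E \<tau> \<eta> *
      (L / R * norm (\<xi> - \<eta>) + 8 * \<tau> powr (1 - z / \<alpha>) * R powr (\<alpha> - 1) * norm (\<xi> - \<eta>) powr (1 - z))"
    unfolding Eh n_def[symmetric] by (simp add: algebra_simps)
qed

end

section \<open>Convolution and power weights\<close>

lemma ennreal_add3_power2_le:
  fixes a b c :: ennreal
  shows "(a + b + c)\<^sup>2 \<le> 9 * (a\<^sup>2 + b\<^sup>2 + c\<^sup>2)"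
proof -
  define M where "M = max a (max b c)"
  have "a + b + c \<le> M + M + M" unfolding M_def by (intro add_mono) (auto simp: le_max_iff_disj)
  also have "\<dots> = 3 * M" 
  proof -
    have "(3::ennreal) = 1 + 1 + 1" by simp
    then show ?thesis by (simp only: distrib_right mult_1)
  qed
  finally have "(a + b + c)\<^sup>2 \<le> (3 * M)\<^sup>2" by (rule power_mono) simp
  also have "\<dots> = 9 * M\<^sup>2" by (simp add: power_mult_distrib)
  also have "M\<^sup>2 \<le> a\<^sup>2 + b\<^sup>2 + c\<^sup>2"
    by (auto simp: M_def max_def add_increasing add_increasing2)
  finally show ?thesis by (simp add: mult_left_mono)
qed

lemma nn_integral_reflect_shift:
  fixes f :: "plane \<Rightarrow> ennreal"
  assumes [measurable]: "f \<in> borel_measurable borel"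
  shows "(\<integral>\<^sup>+x. f (\<xi> - x) \<partial>lborel) = (\<integral>\<^sup>+x. f x \<partial>lborel)"
    and "(\<integral>\<^sup>+x. f (x - \<xi>) \<partial>lborel) = (\<integral>\<^sup>+x. f x \<partial>lborel)"
  using nn_integral_lborel_affine[of f "-1" \<xi>] nn_integral_lborel_affine[of f 1 "- \<xi>"] by simp_all

text \<open>Cauchy-Schwarz with one factor sqrt a alone and the other times b; Tonelli and
  translation invariance do the rest.\<close>

lemma Young_L1_L2:
  fixes a b :: "plane \<Rightarrow> real"
  assumes [measurable]: "a \<in> borel_measurable borel" "b \<in> borel_measurable borel"
    and nn: "\<And>x. 0 \<le> a x" "\<And>x. 0 \<le> b x"
  shows "(\<integral>\<^sup>+\<xi>. (\<integral>\<^sup>+\<eta>. ennreal (a (\<xi> - \<eta>) * b \<eta>) \<partial>lborel)\<^sup>2 \<partial>lborel)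
    \<le> (\<integral>\<^sup>+x. ennreal (a x) \<partial>lborel)\<^sup>2 * (\<integral>\<^sup>+x. ennreal ((b x)\<^sup>2) \<partial>lborel)"
proof -
  let ?A = "\<integral>\<^sup>+x. ennreal (a x) \<partial>lborel"
  have "(\<integral>\<^sup>+\<eta>. ennreal (a (\<xi> - \<eta>) * b \<eta>) \<partial>lborel)\<^sup>2
      \<le> ?A * (\<integral>\<^sup>+\<eta>. ennreal (a (\<xi> - \<eta>)) * ennreal ((b \<eta>)\<^sup>2) \<partial>lborel)" for \<xi>
  proof -
    have "(\<integral>\<^sup>+\<eta>. ennreal (a (\<xi> - \<eta>) * b \<eta>) \<partial>lborel)\<^sup>2
      = (\<integral>\<^sup>+\<eta>. ennreal (sqrt (a (\<xi> - \<eta>)) * (sqrt (a (\<xi> - \<eta>)) * b \<eta>)) \<partial>lborel)\<^sup>2"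
      by (simp add: nn mult.assoc[symmetric])
    also have "\<dots> \<le> (\<integral>\<^sup>+\<eta>. ennreal ((sqrt (a (\<xi> - \<eta>)))\<^sup>2) \<partial>lborel)
        * (\<integral>\<^sup>+\<eta>. ennreal ((sqrt (a (\<xi> - \<eta>)) * b \<eta>)\<^sup>2) \<partial>lborel)"
      by (rule nn_integral_Cauchy_Schwarz) (auto simp: nn)
    also have "(\<integral>\<^sup>+\<eta>. ennreal ((sqrt (a (\<xi> - \<eta>)))\<^sup>2) \<partial>lborel) = ?A"
      using nn_integral_reflect_shift(1)[of "\<lambda>x. ennreal (a x)" \<xi>] by (simp add: nn)
    finally show ?thesis by (simp add: power_mult_distrib nn ennreal_mult)
  qed
  then have "(\<integral>\<^sup>+\<xi>. (\<integral>\<^sup>+\<eta>. ennreal (a (\<xi> - \<eta>) * b \<eta>) \<partial>lborel)\<^sup>2 \<partial>lborel)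
      \<le> (\<integral>\<^sup>+\<xi>. ?A * (\<integral>\<^sup>+\<eta>. ennreal (a (\<xi> - \<eta>)) * ennreal ((b \<eta>)\<^sup>2) \<partial>lborel) \<partial>lborel)"
    by (intro nn_integral_mono)
  also have "\<dots> = ?A * (\<integral>\<^sup>+\<xi>. \<integral>\<^sup>+\<eta>. ennreal (a (\<xi> - \<eta>)) * ennreal ((b \<eta>)\<^sup>2) \<partial>lborel \<partial>lborel)"
    by (rule nn_integral_cmult) measurable
  also have "(\<integral>\<^sup>+\<xi>. \<integral>\<^sup>+\<eta>. ennreal (a (\<xi> - \<eta>)) * ennreal ((b \<eta>)\<^sup>2) \<partial>lborel \<partial>lborel)
      = (\<integral>\<^sup>+\<eta>. \<integral>\<^sup>+\<xi>. ennreal (a (\<xi> - \<eta>)) * ennreal ((b \<eta>)\<^sup>2) \<partial>lborel \<partial>lborel)"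
    by (rule lborel_pair.Fubini'[symmetric]) measurable
  also have "\<dots> = (\<integral>\<^sup>+\<eta>. ?A * ennreal ((b \<eta>)\<^sup>2) \<partial>lborel)"
    using nn_integral_reflect_shift(2)[of "\<lambda>x. ennreal (a x)"]
    by (intro nn_integral_cong) (simp add: nn_integral_multc)
  also have "\<dots> = ?A * (\<integral>\<^sup>+x. ennreal ((b x)\<^sup>2) \<partial>lborel)"
    by (rule nn_integral_cmult) measurable
  finally show ?thesis by (simp add: power2_eq_square mult.assoc)
qed

lemma Young_L2_L1:
  fixes a b :: "plane \<Rightarrow> real"
  assumes [measurable]: "a \<in> borel_measurable borel" "b \<in> borel_measurable borel"
    and nn: "\<And>x. 0 \<le> a x" "\<And>x. 0 \<le> b x"
  shows "(\<integral>\<^sup>+\<xi>. (\<integral>\<^sup>+\<eta>. ennreal (a (\<xi> - \<eta>) * b \<eta>) \<partial>lborel)\<^sup>2 \<partial>lborel)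
    \<le> (\<integral>\<^sup>+x. ennreal ((a x)\<^sup>2) \<partial>lborel) * (\<integral>\<^sup>+x. ennreal (b x) \<partial>lborel)\<^sup>2"
proof -
  have "(\<integral>\<^sup>+\<eta>. ennreal (a (\<xi> - \<eta>) * b \<eta>) \<partial>lborel) = (\<integral>\<^sup>+\<eta>. ennreal (b (\<xi> - \<eta>) * a \<eta>) \<partial>lborel)" for \<xi>
    using nn_integral_reflect_shift(1)[of "\<lambda>\<eta>. ennreal (b (\<xi> - \<eta>) * a \<eta>)" \<xi>] by (simp add: mult.commute)
  then show ?thesis
    using Young_L1_L2[OF assms(2,1) nn(2,1)] by (simp add: mult.commute)
qed

lemma nn_integral_conv_Cauchy_Schwarz:
  fixes a b :: "plane \<Rightarrow> real"
  assumes [measurable]: "a \<in> borel_measurable borel" "b \<in> borel_measurable borel"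
    and nn: "\<And>x. 0 \<le> a x" "\<And>x. 0 \<le> b x"
  shows "(\<integral>\<^sup>+\<eta>. ennreal (a (\<xi> - \<eta>) * b \<eta>) \<partial>lborel)\<^sup>2
    \<le> (\<integral>\<^sup>+x. ennreal ((a x)\<^sup>2) \<partial>lborel) * (\<integral>\<^sup>+x. ennreal ((b x)\<^sup>2) \<partial>lborel)"
  using nn_integral_Cauchy_Schwarz[of "\<lambda>\<eta>. a (\<xi> - \<eta>)" lborel b]
    nn_integral_reflect_shift(1)[of "\<lambda>x. ennreal ((a x)\<^sup>2)" \<xi>] by (simp add: nn)

text \<open>The value at 0 is a null event here; it is set to be infinite for the two-dimensional
  product below.\<close>

lemma nn_integral_powr_Icc:
  fixes a R :: real
  assumes "0 < a" "a < 1" "0 < R"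
  shows "(\<integral>\<^sup>+t. (if \<bar>t\<bar> \<le> R then if t = 0 then \<infinity> else ennreal (\<bar>t\<bar> powr (- a)) else 0) \<partial>lborel)
    \<le> ennreal (2 / (1 - a) * R powr (1 - a))"
proof -
  define q where "q t = ennreal (t powr (- a)) * indicator {0..R} t" for t :: real
  have [measurable]: "q \<in> borel_measurable borel" unfolding q_def by measurable
  have "((\<lambda>t. t powr (- a)) has_integral (R powr (- a + 1) / (- a + 1))) {0..R}"
    using assms by (intro has_integral_powr_from_0) auto
  then have "(\<integral>\<^sup>+t. q t \<partial>lborel) = ennreal (R powr (1 - a) / (1 - a))"
    unfolding q_def by (subst nn_integral_has_integral_lebesgue') auto
  moreover have "(\<integral>\<^sup>+t. q (- t) \<partial>lborel) = (\<integral>\<^sup>+t. q t \<partial>lborel)"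
    using nn_integral_lborel_affine[of q "-1" 0] by simp
  ultimately have "(\<integral>\<^sup>+t. q t + q (- t) \<partial>lborel) = ennreal (2 / (1 - a) * R powr (1 - a))"
    using assms by (subst nn_integral_add) (auto simp: ennreal_plus[symmetric] simp del: ennreal_plus)
  moreover have "(\<integral>\<^sup>+t. (if \<bar>t\<bar> \<le> R then if t = 0 then \<infinity> else ennreal (\<bar>t\<bar> powr (- a)) else 0) \<partial>lborel)
     \<le> (\<integral>\<^sup>+t. q t + q (- t) \<partial>lborel)"
  proof (rule nn_integral_mono_AE)
    have "AE t in lborel. t \<noteq> (0::real)" by (rule AE_lborel_singleton)
    then show "AE t in lborel. (if \<bar>t\<bar> \<le> R then if t = 0 then \<infinity> else ennreal (\<bar>t\<bar> powr (- a)) else 0) \<le> q t + q (- t)"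
    proof eventually_elim
      case (elim t)
      then show ?case by (cases "t > 0") (auto simp: q_def indicator_def)
    qed
  qed
  ultimately show ?thesis by simp
qed

text \<open>
  Since \<open>|x|\<^sup>2 \<ge> |x\<^sub>1| |x\<^sub>2|\<close>, the radial weight is dominated by a product of one-dimensional weights;
  the value \<open>\<infinity>\<close> at \<open>0\<close> avoids the junk value \<open>0 powr (- a) = 0\<close> on the axes.
\<close>

lemma nn_integral_norm_powr_cball:
  fixes a R :: real
  assumes a: "0 < a" "a < 1" and R: "0 < R"
  shows "(\<integral>\<^sup>+x. ennreal (if norm (x::plane) \<le> R then (norm x powr (- a))\<^sup>2 else 0) \<partial>lborel)
    \<le> ennreal ((2 / (1 - a))\<^sup>2 * R powr (2 - 2 * a))"
proof -
  define q :: "real \<Rightarrow> ennreal"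
    where "q t = (if \<bar>t\<bar> \<le> R then if t = 0 then \<infinity> else ennreal (\<bar>t\<bar> powr (- a)) else 0)" for t
  have [measurable]: "q \<in> borel_measurable borel" unfolding q_def by measurable
  have prod_eq: "(\<Prod>b\<in>Basis. q (x \<bullet> b)) = q (x $ 1) * q (x $ 2)" for x :: plane
  proof -
    have B: "(Basis :: plane set) = {axis 1 1, axis 2 1}"
      by (auto simp: Basis_vec_def UNIV_2)
    have "axis 1 (1::real) \<noteq> (axis 2 1 :: plane)" by (simp add: axis_eq_axis)
    then show ?thesis unfolding B by (simp add: inner_axis)
  qed
  have le: "ennreal (if norm x \<le> R then (norm x powr (- a))\<^sup>2 else 0) \<le> q (x $ 1) * q (x $ 2)" for x :: plane
  proof (cases "norm x \<le> R")
    case True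
    have c: "\<bar>x $ 1\<bar> \<le> norm x" "\<bar>x $ 2\<bar> \<le> norm x" by (auto intro: component_le_norm_cart)
    show ?thesis
    \<comment> \<open>On an axis one factor is infinite and the other nonzero, so the product is
      infinite and the bound trivial.\<close>
    proof (cases "x $ 1 = 0 \<or> x $ 2 = 0")
      case T: True
      have "q t \<noteq> 0" if "\<bar>t\<bar> \<le> R" for t using that by (auto simp: q_def)
      moreover have "q 0 = \<infinity>" using R by (simp add: q_def)
      ultimately have "q (x $ 1) * q (x $ 2) = \<infinity>"
        using T c True by (auto simp: ennreal_mult_eq_top_iff)
      then show ?thesis by simp
    next
      case False
      then have pos: "0 < \<bar>x $ 1\<bar>" "0 < \<bar>x $ 2\<bar>" by auto
      then have "0 < norm x" using c by linarith
      have "(norm x powr (- a))\<^sup>2 = norm x powr (- a) * norm x powr (- a)" by (rule power2_eq_square)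
      also have "\<dots> \<le> \<bar>x $ 1\<bar> powr (- a) * \<bar>x $ 2\<bar> powr (- a)"
        using c pos a by (intro mult_mono powr_mono2') auto
      finally show ?thesis
        using True c False by (auto simp: q_def ennreal_mult[symmetric] intro!: ennreal_leI)
    qed
  qed simp
  have "(\<integral>\<^sup>+x. ennreal (if norm (x::plane) \<le> R then (norm x powr (- a))\<^sup>2 else 0) \<partial>lborel)
      \<le> (\<integral>\<^sup>+x. (\<Prod>b\<in>Basis. q ((x::plane) \<bullet> b)) \<partial>lborel)"
    unfolding prod_eq by (intro nn_integral_mono le)
  also have "\<dots> = (\<Prod>b\<in>(Basis :: plane set). \<integral>\<^sup>+t. q t \<partial>lborel)"
    by (rule nn_integral_lborel_prod) auto
  also have "\<dots> = (\<integral>\<^sup>+t. q t \<partial>lborel)\<^sup>2" by simp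
  also have "\<dots> \<le> (ennreal (2 / (1 - a) * R powr (1 - a)))\<^sup>2"
    unfolding q_def by (intro power_mono nn_integral_powr_Icc assms) simp
  also have "\<dots> = ennreal ((2 / (1 - a))\<^sup>2 * R powr (2 - 2 * a))"
  proof -
    have "(R powr (1 - a))\<^sup>2 = R powr (2 - 2 * a)"
      by (simp add: power2_eq_square powr_add[symmetric])
    then show ?thesis using a by (subst ennreal_power) (auto simp: power_mult_distrib power_divide)
  qed
  finally show ?thesis .
qed

lemma emeasure_cball_plane_le:
  assumes "0 \<le> r" shows "emeasure lborel (cball (0::plane) r) \<le> ennreal (4 * r\<^sup>2)"
proof -
  have "emeasure lborel (cball (0::plane) r) = ennreal (pi * r\<^sup>2)"
    using assms by (simp add: emeasure_cball unit_ball_vol_2)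
  also have "\<dots> \<le> ennreal (4 * r\<^sup>2)"
    using pi_less_4 by (intro ennreal_leI mult_right_mono) auto
  finally show ?thesis .
qed

section \<open>Dyadic estimates\<close>

definition sq_int :: "(plane \<Rightarrow> real) \<Rightarrow> ennreal" where
  "sq_int u = (\<integral>\<^sup>+x. ennreal ((u x)\<^sup>2) \<partial>lborel)"

text \<open>The factor R / norm x is what makes these integrals summable over R = 2^j: an unweighted
  tail would count each x once for every j with 2^j <= 4 |x|, that is, infinitely often.\<close>

definition tail_sq_int :: "real \<Rightarrow> (plane \<Rightarrow> real) \<Rightarrow> ennreal" where
  "tail_sq_int R u = (\<integral>\<^sup>+x. ennreal (if R / 4 \<le> norm x then (R / norm x * u x)\<^sup>2 else 0) \<partial>lborel)"

lemma sq_int_le_tail_sq_int: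
  assumes [measurable]: "u \<in> borel_measurable borel" and u: "\<And>x. 0 \<le> u x"
    and "0 \<le> c" and v: "\<And>x. norm x < R / 4 \<Longrightarrow> v x = 0"
      "\<And>x. R / 4 \<le> norm x \<Longrightarrow> 0 \<le> v x \<and> v x \<le> c * (R / norm x * u x)"
  shows "sq_int v \<le> ennreal (c\<^sup>2) * tail_sq_int R u"
proof -
  have "sq_int v \<le> (\<integral>\<^sup>+x. ennreal (c\<^sup>2) * ennreal (if R / 4 \<le> norm x then (R / norm x * u x)\<^sup>2 else 0) \<partial>lborel)"
    unfolding sq_int_def
  proof (rule nn_integral_mono)
    fix x :: plane
    show "ennreal ((v x)\<^sup>2) \<le> ennreal (c\<^sup>2) * ennreal (if R / 4 \<le> norm x then (R / norm x * u x)\<^sup>2 else 0)"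
    proof (cases "R / 4 \<le> norm x")
      case True
      then have "(v x)\<^sup>2 \<le> (c * (R / norm x * u x))\<^sup>2"
        using v(2)[OF True] by (intro power_mono) auto
      then have "(v x)\<^sup>2 \<le> c\<^sup>2 * (R / norm x * u x)\<^sup>2" by (simp only: power_mult_distrib)
      then show ?thesis using True by (simp add: ennreal_mult'[symmetric])
    qed (use v(1)[of x] in simp)
  qed
  also have "\<dots> = ennreal (c\<^sup>2) * tail_sq_int R u"
    unfolding tail_sq_int_def by (rule nn_integral_cmult) measurable
  finally show ?thesis .
qed

lemma powr_minus_one_add:
  fixes r a :: real
  assumes "0 < r" shows "r powr (- (1 + a)) = r powr (- a) / r"
proof -
  have "- (1 + a) = - a - 1" by simp
  then show ?thesis using assms by (simp only: powr_diff) simp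
qed

context commutator_kernel
begin

lemma d\<^sub>1_less_1: "d\<^sub>1 < 1" using \<delta> z by simp

lemma weight_le:
  fixes r R a :: real
  assumes "0 < R" "R / 4 \<le> r" "0 < a" "a < 1"
  shows "r powr (- a) \<le> 4 * R powr (- a)"
proof -
  have "r powr (- a) \<le> (R / 4) powr (- a)" using assms by (intro powr_mono2') auto
  also have "\<dots> = 4 powr a * R powr (- a)" using assms by (simp add: powr_divide powr_minus field_simps)
  also have "\<dots> \<le> 4 * R powr (- a)"
    using powr_mono[of a 1 "4::real"] assms by (intro mult_right_mono) auto
  finally show ?thesis .
qed

text \<open>\<open>K a * R powr (2 - 2 * a)\<close> bounds the integral of |x|^(-2a) over the disc
  of radius R, for 0 < a < 1.\<close>

definition K :: "real \<Rightarrow> real" where "K a = (2 / (1 - a))\<^sup>2"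

lemma K_nonneg: "0 \<le> K a" by (simp add: K_def)

text \<open>Young for L2 with L1: the u-part is at high frequency and is charged to its tail; the
  v-part is integrable by Cauchy-Schwarz, as |x|^(-d_2) is square integrable on the disc. The
  constant is 4^2 times 4^(2 - 2 d_2) <= 16.\<close>

lemma high_low_estimate:
  assumes [measurable]: "u \<in> borel_measurable borel" "v \<in> borel_measurable borel"
    and u: "\<And>x. 0 \<le> u x" and v: "\<And>x. 0 \<le> v x" and R: "0 < R"
  shows "(\<integral>\<^sup>+\<xi>. (\<integral>\<^sup>+\<eta>. ennreal ((if R / 4 < norm (\<xi> - \<eta>) then u (\<xi> - \<eta>) * norm (\<xi> - \<eta>) powr (- (1 + d\<^sub>1)) else 0)
       * (if norm \<eta> \<le> 4 * R then v \<eta> * norm \<eta> powr (- d\<^sub>2) else 0)) \<partial>lborel)\<^sup>2 \<partial>lborel)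
    \<le> ennreal (256 * K d\<^sub>2 * R powr (- 2 * (d\<^sub>1 + d\<^sub>2))) * (tail_sq_int R u * sq_int v)"
proof -
  define A where "A x = (if R / 4 < norm x then u x * norm x powr (- (1 + d\<^sub>1)) else 0)" for x
  define B where "B x = (if norm x \<le> 4 * R then v x * norm x powr (- d\<^sub>2) else 0)" for x
  have [measurable]: "A \<in> borel_measurable borel" "B \<in> borel_measurable borel"
    unfolding A_def B_def by measurable
  have nn: "0 \<le> A x" "0 \<le> B x" for x using u v by (auto simp: A_def B_def)
  have A: "sq_int A \<le> ennreal ((4 * R powr (- (1 + d\<^sub>1)))\<^sup>2) * tail_sq_int R u"
  proof (rule sq_int_le_tail_sq_int)
    fix x :: plane assume x: "R / 4 \<le> norm x"
    then have "norm x > 0" using R by linarith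
    \<comment> \<open>One power of norm x is kept for the tail weight R / norm x; the other d_1 are
      estimated at the edge R/4.\<close>
    have "norm x powr (- (1 + d\<^sub>1)) = norm x powr (- d\<^sub>1) / norm x"
      by (rule powr_minus_one_add) fact
    also have "\<dots> \<le> 4 * R powr (- d\<^sub>1) / norm x"
      using weight_le[OF R x \<delta>(1) d\<^sub>1_less_1] by (intro divide_right_mono) auto
    also have "\<dots> = 4 * R powr (- (1 + d\<^sub>1)) * (R / norm x)"
      using R powr_minus_one_add[OF R, of d\<^sub>1] by simp
    finally have "norm x powr (- (1 + d\<^sub>1)) * u x \<le> 4 * R powr (- (1 + d\<^sub>1)) * (R / norm x) * u x"
      by (rule mult_right_mono) (rule u)
    moreover have "0 \<le> 4 * R powr (- (1 + d\<^sub>1)) * (R / norm x * u x)"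
      using R u[of x] by simp
    ultimately show "0 \<le> A x \<and> A x \<le> 4 * R powr (- (1 + d\<^sub>1)) * (R / norm x * u x)"
      using nn(1)[of x] by (simp add: A_def mult_ac)
  qed (auto simp: A_def u)
  have B: "(\<integral>\<^sup>+x. ennreal (B x) \<partial>lborel)\<^sup>2 \<le> sq_int v * ennreal (K d\<^sub>2 * (4 * R) powr (2 - 2 * d\<^sub>2))"
  proof -
    let ?k = "\<lambda>x::plane. if norm x \<le> 4 * R then norm x powr (- d\<^sub>2) else 0"
    have "B = (\<lambda>x. v x * ?k x)" by (auto simp: B_def)
    then have "(\<integral>\<^sup>+x. ennreal (B x) \<partial>lborel)\<^sup>2 \<le> sq_int v * (\<integral>\<^sup>+x. ennreal ((?k x)\<^sup>2) \<partial>lborel)"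
      unfolding sq_int_def by (simp only:) (rule nn_integral_Cauchy_Schwarz, auto simp: v)
    also have "(\<lambda>x. (?k x)\<^sup>2) = (\<lambda>x. if norm x \<le> 4 * R then (norm x powr (- d\<^sub>2))\<^sup>2 else 0)" by auto
    also have "(\<integral>\<^sup>+x. ennreal (if norm (x::plane) \<le> 4 * R then (norm x powr (- d\<^sub>2))\<^sup>2 else 0) \<partial>lborel)
        \<le> ennreal (K d\<^sub>2 * (4 * R) powr (2 - 2 * d\<^sub>2))"
      unfolding K_def using \<delta> R by (intro nn_integral_norm_powr_cball) auto
    finally show ?thesis by (simp add: mult_left_mono)
  qed
  have "(\<integral>\<^sup>+\<xi>. (\<integral>\<^sup>+\<eta>. ennreal (A (\<xi> - \<eta>) * B \<eta>) \<partial>lborel)\<^sup>2 \<partial>lborel)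
      \<le> sq_int A * (\<integral>\<^sup>+x. ennreal (B x) \<partial>lborel)\<^sup>2"
    unfolding sq_int_def by (rule Young_L2_L1) (auto simp: nn)
  also have "\<dots> \<le> (ennreal ((4 * R powr (- (1 + d\<^sub>1)))\<^sup>2) * tail_sq_int R u)
      * (sq_int v * ennreal (K d\<^sub>2 * (4 * R) powr (2 - 2 * d\<^sub>2)))"
    by (intro mult_mono A B) auto
  also have "\<dots> = ennreal ((4 * R powr (- (1 + d\<^sub>1)))\<^sup>2 * (K d\<^sub>2 * (4 * R) powr (2 - 2 * d\<^sub>2))) * (tail_sq_int R u * sq_int v)"
    using K_nonneg by (simp add: ennreal_mult mult_ac)
  also have "\<dots> \<le> ennreal (256 * K d\<^sub>2 * R powr (- 2 * (d\<^sub>1 + d\<^sub>2))) * (tail_sq_int R u * sq_int v)"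
  proof (intro mult_right_mono ennreal_leI)
    have 4: "4 powr (2 - 2 * d\<^sub>2) \<le> 16"
      using powr_mono[of "2 - 2 * d\<^sub>2" 2 "4::real"] \<delta> by simp
    have "(R powr (- (1 + d\<^sub>1)))\<^sup>2 * R powr (2 - 2 * d\<^sub>2) = R powr (- 2 * (d\<^sub>1 + d\<^sub>2))"
      unfolding power2_eq_square powr_add[symmetric]
      by (intro arg_cong2[where f="(powr)"] refl) (simp add: algebra_simps)
    then have "(4 * R powr (- (1 + d\<^sub>1)))\<^sup>2 * (K d\<^sub>2 * (4 * R) powr (2 - 2 * d\<^sub>2))
       = 4 powr (2 - 2 * d\<^sub>2) * (16 * K d\<^sub>2 * R powr (- 2 * (d\<^sub>1 + d\<^sub>2)))"
      using R by (simp only: power_mult_distrib powr_mult) (simp add: mult_ac)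
    also have "\<dots> \<le> 16 * (16 * K d\<^sub>2 * R powr (- 2 * (d\<^sub>1 + d\<^sub>2)))"
      using 4 K_nonneg by (intro mult_right_mono) auto
    finally show "(4 * R powr (- (1 + d\<^sub>1)))\<^sup>2 * (K d\<^sub>2 * (4 * R) powr (2 - 2 * d\<^sub>2))
        \<le> 256 * K d\<^sub>2 * R powr (- 2 * (d\<^sub>1 + d\<^sub>2))" by simp
  qed simp
  finally show ?thesis unfolding A_def B_def .
qed

text \<open>All derivatives have been moved to v, leaving u without decay; so the convolution is
  bounded uniformly in \<xi> by Cauchy-Schwarz, and the disc of radius 2 R contributes at most 16
  R^2. The factor 2^(1 + d_1) <= 4 comes from |\<eta>| <= 2 |\<xi> - \<eta>| in
  \<open>kernel_split\<close>.\<close>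

lemma high_high_estimate:
  assumes [measurable]: "u \<in> borel_measurable borel" "v \<in> borel_measurable borel"
    and u: "\<And>x. 0 \<le> u x" and v: "\<And>x. 0 \<le> v x" and R: "0 < R"
  shows "(\<integral>\<^sup>+\<xi>. (indicator (cball 0 (2 * R)) \<xi> * (\<integral>\<^sup>+\<eta>. ennreal (u (\<xi> - \<eta>)
       * (if 4 * R < norm \<eta> then v \<eta> * (2 powr (1 + d\<^sub>1) * norm \<eta> powr (- (1 + d\<^sub>1 + d\<^sub>2))) else 0)) \<partial>lborel))\<^sup>2 \<partial>lborel)
    \<le> ennreal (256 * R powr (- 2 * (d\<^sub>1 + d\<^sub>2))) * (sq_int u * tail_sq_int R v)"
proof -
  define B where "B x = (if 4 * R < norm x then v x * (2 powr (1 + d\<^sub>1) * norm x powr (- (1 + d\<^sub>1 + d\<^sub>2))) else 0)" for x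
  have [measurable]: "B \<in> borel_measurable borel" unfolding B_def by measurable
  have nn: "0 \<le> B x" for x using v by (auto simp: B_def)
  have B: "sq_int B \<le> ennreal ((4 * R powr (- (1 + d\<^sub>1 + d\<^sub>2)))\<^sup>2) * tail_sq_int R v"
  proof (rule sq_int_le_tail_sq_int)
    fix x :: plane
    have "B x \<le> 4 * R powr (- (1 + d\<^sub>1 + d\<^sub>2)) * (R / norm x * v x)"
    proof (cases "4 * R < norm x")
      case True
      then have "norm x > 0" "R \<le> norm x" using R by linarith+
      have "2 powr (1 + d\<^sub>1) \<le> (4::real)"
        using powr_mono[of "1 + d\<^sub>1" 2 "2::real"] d\<^sub>1_less_1 by simp
      moreover have "norm x powr (- (1 + d\<^sub>1 + d\<^sub>2)) = norm x powr (- (d\<^sub>1 + d\<^sub>2)) / norm x"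
        using powr_minus_one_add[OF \<open>norm x > 0\<close>, of "d\<^sub>1 + d\<^sub>2"] by (simp only: add.assoc)
      ultimately have "2 powr (1 + d\<^sub>1) * norm x powr (- (1 + d\<^sub>1 + d\<^sub>2)) \<le> 4 * (norm x powr (- (d\<^sub>1 + d\<^sub>2)) / norm x)"
        by (simp only:) (intro mult_right_mono, auto)
      also have "4 * (norm x powr (- (d\<^sub>1 + d\<^sub>2)) / norm x) \<le> 4 * (R powr (- (d\<^sub>1 + d\<^sub>2)) / norm x)"
        using R \<open>R \<le> norm x\<close> \<delta> by (intro mult_left_mono divide_right_mono powr_mono2') auto
      also have "\<dots> = 4 * R powr (- (1 + d\<^sub>1 + d\<^sub>2)) * (R / norm x)"
        using R powr_minus_one_add[OF R, of "d\<^sub>1 + d\<^sub>2"] by (simp add: add.assoc)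
      finally have "2 powr (1 + d\<^sub>1) * norm x powr (- (1 + d\<^sub>1 + d\<^sub>2)) * v x
          \<le> 4 * R powr (- (1 + d\<^sub>1 + d\<^sub>2)) * (R / norm x) * v x"
        by (rule mult_right_mono) (rule v)
      then show ?thesis using True by (simp add: B_def mult_ac)
    qed (use R v[of x] in \<open>simp add: B_def\<close>)
    then show "0 \<le> B x \<and> B x \<le> 4 * R powr (- (1 + d\<^sub>1 + d\<^sub>2)) * (R / norm x * v x)"
      using nn by simp
  qed (use R in \<open>auto simp: B_def v\<close>)
  have "(\<integral>\<^sup>+\<xi>. (indicator (cball 0 (2 * R)) \<xi> * (\<integral>\<^sup>+\<eta>. ennreal (u (\<xi> - \<eta>) * B \<eta>) \<partial>lborel))\<^sup>2 \<partial>lborel)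
      \<le> (\<integral>\<^sup>+\<xi>. (sq_int u * sq_int B) * indicator (cball 0 (2 * R)) (\<xi>::plane) \<partial>lborel)"
    using nn_integral_conv_Cauchy_Schwarz[of u B] u nn unfolding sq_int_def
    by (intro nn_integral_mono) (auto simp: indicator_def)
  also have "\<dots> = sq_int u * sq_int B * emeasure lborel (cball (0::plane) (2 * R))"
    by (rule nn_integral_cmult_indicator) simp
  also have "\<dots> \<le> sq_int u * (ennreal ((4 * R powr (- (1 + d\<^sub>1 + d\<^sub>2)))\<^sup>2) * tail_sq_int R v) * ennreal (4 * (2 * R)\<^sup>2)"
    using R by (intro mult_mono B emeasure_cball_plane_le) auto
  also have "\<dots> = ennreal ((4 * R powr (- (1 + d\<^sub>1 + d\<^sub>2)))\<^sup>2 * (4 * (2 * R)\<^sup>2)) * (sq_int u * tail_sq_int R v)"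
    by (subst ennreal_mult) (auto simp: mult_ac)
  also have "(4 * R powr (- (1 + d\<^sub>1 + d\<^sub>2)))\<^sup>2 * (4 * (2 * R)\<^sup>2) = 256 * R powr (- 2 * (d\<^sub>1 + d\<^sub>2))"
  proof -
    have "R powr (- (1 + d\<^sub>1 + d\<^sub>2)) * R powr (- (1 + d\<^sub>1 + d\<^sub>2)) * (R powr 1 * R powr 1) = R powr (- 2 * (d\<^sub>1 + d\<^sub>2))"
      unfolding powr_add[symmetric] by (simp add: algebra_simps)
    then show ?thesis using R by (simp add: power2_eq_square)
  qed
  finally show ?thesis unfolding B_def .
qed

text \<open>Young for L1 with L2: u times the kernel weight k is integrable by Cauchy-Schwarz, as
  d_1 < 1 and z + d_1 < 1 make k square integrable; v is confined to an annulus of size R. The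
  parameter b will be 8 \<tau>^(1 - z/\<alpha>), and 512 = 2 * 16^2.\<close>

lemma low_high_estimate:
  assumes [measurable]: "u \<in> borel_measurable borel" "v \<in> borel_measurable borel"
    and u: "\<And>x. 0 \<le> u x" and v: "\<And>x. 0 \<le> v x" and R: "0 < R" and b: "0 \<le> b"
  shows "(\<integral>\<^sup>+\<xi>. (\<integral>\<^sup>+\<eta>. ennreal ((if norm (\<xi> - \<eta>) \<le> R / 4 then u (\<xi> - \<eta>) *
          (L / R * norm (\<xi> - \<eta>) powr (- d\<^sub>1) + b * R powr (\<alpha> - 1) * norm (\<xi> - \<eta>) powr (- (z + d\<^sub>1))) else 0)
       * (if R / 4 \<le> norm \<eta> \<and> norm \<eta> \<le> 4 * R then v \<eta> * norm \<eta> powr (- d\<^sub>2) else 0)) \<partial>lborel)\<^sup>2 \<partial>lborel)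
    \<le> ennreal (512 * (L\<^sup>2 * K d\<^sub>1 * R powr (- 2 * (d\<^sub>1 + d\<^sub>2))
        + b\<^sup>2 * K (z + d\<^sub>1) * R powr (- 2 * (d\<^sub>1 + d\<^sub>2 + z - \<alpha>)))) * (sq_int u * tail_sq_int R v)"
proof -
  let ?k1 = "\<lambda>x::plane. if norm x \<le> R then (norm x powr (- d\<^sub>1))\<^sup>2 else 0"
  let ?k2 = "\<lambda>x::plane. if norm x \<le> R then (norm x powr (- (z + d\<^sub>1)))\<^sup>2 else 0"
  define c where "c = b * R powr (\<alpha> - 1)"
  define k where "k x = (if norm x \<le> R / 4 then L / R * norm x powr (- d\<^sub>1) + c * norm x powr (- (z + d\<^sub>1)) else 0)" for x :: plane
  define A where "A x = (if norm x \<le> R / 4 then u x * (L / R * norm x powr (- d\<^sub>1) + c * norm x powr (- (z + d\<^sub>1))) else 0)" for x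
  define B where "B x = (if R / 4 \<le> norm x \<and> norm x \<le> 4 * R then v x * norm x powr (- d\<^sub>2) else 0)" for x
  have [measurable]: "A \<in> borel_measurable borel" "B \<in> borel_measurable borel" "k \<in> borel_measurable borel"
    unfolding A_def B_def k_def by measurable
  have "0 \<le> c" using b by (simp add: c_def)
  then have k0: "0 \<le> k x" for x using L R by (auto simp: k_def)
  have Ak: "A = (\<lambda>x. u x * k x)" by (auto simp: A_def k_def)
  have nn: "0 \<le> A x" "0 \<le> B x" for x using u v k0 by (auto simp: Ak B_def)
  have B: "sq_int B \<le> ennreal ((16 * R powr (- d\<^sub>2))\<^sup>2) * tail_sq_int R v"
  proof (rule sq_int_le_tail_sq_int)
    fix x :: plane assume x: "R / 4 \<le> norm x"
    have "B x \<le> 16 * R powr (- d\<^sub>2) * (R / norm x * v x)"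
    proof (cases "norm x \<le> 4 * R")
      case True
      have "norm x > 0" using x R by linarith
      \<comment> \<open>On the annulus R / norm x is at least 1/4, so the tail weight can be
        inserted at the cost of a factor 4.\<close>
      have "norm x powr (- d\<^sub>2) * 1 \<le> (4 * R powr (- d\<^sub>2)) * (4 * (R / norm x))"
        using weight_le[OF R x] \<delta> True \<open>norm x > 0\<close> by (intro mult_mono) (auto simp: field_simps)
      then have "norm x powr (- d\<^sub>2) * v x \<le> 16 * R powr (- d\<^sub>2) * (R / norm x) * v x"
        using v[of x] by (intro mult_right_mono) auto
      then show ?thesis using True x by (simp add: B_def mult_ac)
    qed (use R v[of x] in \<open>simp add: B_def\<close>)
    then show "0 \<le> B x \<and> B x \<le> 16 * R powr (- d\<^sub>2) * (R / norm x * v x)" using nn by simp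
  qed (auto simp: B_def v)
  have ksq: "sq_int k \<le> ennreal (2 * ((L / R)\<^sup>2 * (K d\<^sub>1 * R powr (2 - 2 * d\<^sub>1))
      + c\<^sup>2 * (K (z + d\<^sub>1) * R powr (2 - 2 * (z + d\<^sub>1)))))" (is "_ \<le> ?Q")
  proof -
    have "sq_int k \<le> (\<integral>\<^sup>+x. ennreal (2 * (L / R)\<^sup>2) * ennreal (?k1 x) + ennreal (2 * c\<^sup>2) * ennreal (?k2 x) \<partial>lborel)"
      unfolding sq_int_def
    proof (rule nn_integral_mono)
      fix x :: plane
      have "(p + q)\<^sup>2 \<le> 2 * p\<^sup>2 + 2 * q\<^sup>2" for p q :: real
        using sum_squares_bound[of p q] by (simp add: power2_sum)
      from this[of "L / R * norm x powr (- d\<^sub>1)" "c * norm x powr (- (z + d\<^sub>1))"]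
      have le: "(L / R * norm x powr (- d\<^sub>1) + c * norm x powr (- (z + d\<^sub>1)))\<^sup>2
          \<le> 2 * (L / R)\<^sup>2 * (norm x powr (- d\<^sub>1))\<^sup>2 + 2 * c\<^sup>2 * (norm x powr (- (z + d\<^sub>1)))\<^sup>2"
        by (simp only: power_mult_distrib mult.assoc)
      have "(k x)\<^sup>2 \<le> 2 * (L / R)\<^sup>2 * ?k1 x + 2 * c\<^sup>2 * ?k2 x"
      proof (cases "norm x \<le> R / 4")
        case True
        then have "norm x \<le> R" using R by linarith
        with True le show ?thesis unfolding k_def by (simp only: if_True)
      qed (simp add: k_def)
      then show "ennreal ((k x)\<^sup>2) \<le> ennreal (2 * (L / R)\<^sup>2) * ennreal (?k1 x) + ennreal (2 * c\<^sup>2) * ennreal (?k2 x)"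
        by (subst (1 2) ennreal_mult[symmetric]) (auto simp: ennreal_plus[symmetric] simp del: ennreal_plus intro!: ennreal_leI)
    qed
    also have "\<dots> = ennreal (2 * (L / R)\<^sup>2) * (\<integral>\<^sup>+x. ennreal (?k1 x) \<partial>lborel) + ennreal (2 * c\<^sup>2) * (\<integral>\<^sup>+x. ennreal (?k2 x) \<partial>lborel)"
      by (subst nn_integral_add) (auto simp: nn_integral_cmult)
    also have "\<dots> \<le> ennreal (2 * (L / R)\<^sup>2) * ennreal (K d\<^sub>1 * R powr (2 - 2 * d\<^sub>1))
        + ennreal (2 * c\<^sup>2) * ennreal (K (z + d\<^sub>1) * R powr (2 - 2 * (z + d\<^sub>1)))"
      unfolding K_def using \<delta> z d\<^sub>1_less_1 R by (intro add_mono mult_left_mono nn_integral_norm_powr_cball) auto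
    also have "\<dots> = ?Q"
      using K_nonneg by (subst (1 2) ennreal_mult[symmetric])
        (auto simp: ennreal_plus[symmetric] distrib_left mult.assoc simp del: ennreal_plus)
    finally show ?thesis .
  qed
  have A: "(\<integral>\<^sup>+x. ennreal (A x) \<partial>lborel)\<^sup>2 \<le> sq_int u * sq_int k"
    unfolding Ak sq_int_def by (rule nn_integral_Cauchy_Schwarz) (auto simp: u k0)
  have "(\<integral>\<^sup>+\<xi>. (\<integral>\<^sup>+\<eta>. ennreal (A (\<xi> - \<eta>) * B \<eta>) \<partial>lborel)\<^sup>2 \<partial>lborel)
      \<le> (\<integral>\<^sup>+x. ennreal (A x) \<partial>lborel)\<^sup>2 * sq_int B"
    unfolding sq_int_def by (rule Young_L1_L2) (auto simp: nn)
  also have "\<dots> \<le> (sq_int u * ?Q) * (ennreal ((16 * R powr (- d\<^sub>2))\<^sup>2) * tail_sq_int R v)"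
    by (intro mult_mono B order_trans[OF A] mult_left_mono ksq) auto
  also have "\<dots> = ennreal (2 * ((L / R)\<^sup>2 * (K d\<^sub>1 * R powr (2 - 2 * d\<^sub>1))
      + c\<^sup>2 * (K (z + d\<^sub>1) * R powr (2 - 2 * (z + d\<^sub>1)))) * (16 * R powr (- d\<^sub>2))\<^sup>2) * (sq_int u * tail_sq_int R v)"
    using K_nonneg by (subst ennreal_mult[of "_ * _" "_\<^sup>2"]) (auto simp: mult_ac)
  also have "2 * ((L / R)\<^sup>2 * (K d\<^sub>1 * R powr (2 - 2 * d\<^sub>1))
      + c\<^sup>2 * (K (z + d\<^sub>1) * R powr (2 - 2 * (z + d\<^sub>1)))) * (16 * R powr (- d\<^sub>2))\<^sup>2
     = 512 * (L\<^sup>2 * K d\<^sub>1 * R powr (- 2 * (d\<^sub>1 + d\<^sub>2))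
        + b\<^sup>2 * K (z + d\<^sub>1) * R powr (- 2 * (d\<^sub>1 + d\<^sub>2 + z - \<alpha>)))"
  proof -
    have 1: "R powr (2 - 2 * d\<^sub>1) * (R powr (- d\<^sub>2))\<^sup>2 = R\<^sup>2 * R powr (- 2 * (d\<^sub>1 + d\<^sub>2))"
    proof -
      have "R\<^sup>2 = R powr 2" using R by simp
      then show ?thesis unfolding power2_eq_square[of "_ powr _"] by (simp only: powr_add[symmetric]) (simp add: algebra_simps)
    qed
    have 2: "(R powr (\<alpha> - 1))\<^sup>2 * R powr (2 - 2 * (z + d\<^sub>1)) * (R powr (- d\<^sub>2))\<^sup>2 = R powr (- 2 * (d\<^sub>1 + d\<^sub>2 + z - \<alpha>))"
      unfolding power2_eq_square by (simp only: powr_add[symmetric]) (simp add: algebra_simps)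
    have "2 * ((L / R)\<^sup>2 * (K d\<^sub>1 * R powr (2 - 2 * d\<^sub>1))
      + c\<^sup>2 * (K (z + d\<^sub>1) * R powr (2 - 2 * (z + d\<^sub>1)))) * (16 * R powr (- d\<^sub>2))\<^sup>2
      = 512 * ((L / R)\<^sup>2 * K d\<^sub>1 * (R powr (2 - 2 * d\<^sub>1) * (R powr (- d\<^sub>2))\<^sup>2)
        + b\<^sup>2 * K (z + d\<^sub>1) * ((R powr (\<alpha> - 1))\<^sup>2 * R powr (2 - 2 * (z + d\<^sub>1)) * (R powr (- d\<^sub>2))\<^sup>2))"
      by (simp add: c_def power_mult_distrib algebra_simps)
    also have "\<dots> = 512 * (L\<^sup>2 * K d\<^sub>1 * R powr (- 2 * (d\<^sub>1 + d\<^sub>2))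
        + b\<^sup>2 * K (z + d\<^sub>1) * R powr (- 2 * (d\<^sub>1 + d\<^sub>2 + z - \<alpha>)))"
      unfolding 1 2 using R by (simp add: power_divide)
    finally show ?thesis .
  qed
  finally show ?thesis unfolding A_def B_def c_def .
qed

end

section \<open>Splitting of the kernel and the estimate at one scale\<close>

context commutator_kernel
begin

text \<open>For F = |f^| the square integral of this function is the squared homogeneous Sobolev
  norm of order a of the Gevrey-weighted f.\<close>

definition wt :: "real \<Rightarrow> real \<Rightarrow> (plane \<Rightarrow> real) \<Rightarrow> plane \<Rightarrow> real" where
  "wt a \<tau> F x = norm x powr a * E \<tau> x * F x"

lemma E_measurable [measurable]: "E \<tau> \<in> borel_measurable borel"
  unfolding E_def[abs_def] by measurable

lemma m_measurable [measurable]: "m \<tau> R \<in> borel_measurable borel"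
  unfolding m_def[abs_def] by measurable

lemma wt_measurable [measurable (raw)]: "F \<in> borel_measurable borel \<Longrightarrow> wt a \<tau> F \<in> borel_measurable borel"
  unfolding wt_def[abs_def] by measurable

lemma wt_nonneg: "0 \<le> F x \<Longrightarrow> 0 \<le> wt a \<tau> F x"
  using E_pos[of \<tau> x] by (simp add: wt_def)

lemma wt_cancel: "x \<noteq> 0 \<Longrightarrow> wt a \<tau> F x * norm x powr b = norm x powr (a + b) * (E \<tau> x * F x)"
  by (simp add: wt_def powr_add)

text \<open>The three summands belong to the cases |\<xi> - \<eta>| > R/4 with |\<eta>| <= 4 R,
  |\<xi> - \<eta>| > R/4 with |\<eta>| > 4 R, and |\<xi> - \<eta>| <= R/4. In the second the cutoff
  vanishes at \<eta>, so the kernel is nonzero only for \<xi> in the disc of radius 2 R.\<close>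

lemma kernel_split:
  assumes \<tau>: "0 < \<tau>" and R: "0 < R" and F: "\<And>x. 0 \<le> F x" and G: "\<And>x. 0 \<le> G x"
    and ne: "\<xi> \<noteq> \<eta>" "\<eta> \<noteq> 0"
  defines "u \<equiv> wt (1 + d\<^sub>1) \<tau> F" and "v \<equiv> wt d\<^sub>2 \<tau> G"
  shows "F (\<xi> - \<eta>) * \<bar>m \<tau> R \<eta> - m \<tau> R \<xi>\<bar> * G \<eta> \<le>
     (if R / 4 < norm (\<xi> - \<eta>) then u (\<xi> - \<eta>) * norm (\<xi> - \<eta>) powr (- (1 + d\<^sub>1)) else 0)
       * (if norm \<eta> \<le> 4 * R then v \<eta> * norm \<eta> powr (- d\<^sub>2) else 0)
   + indicat_real (cball 0 (2 * R)) \<xi> * (u (\<xi> - \<eta>)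
       * (if 4 * R < norm \<eta> then v \<eta> * (2 powr (1 + d\<^sub>1) * norm \<eta> powr (- (1 + d\<^sub>1 + d\<^sub>2))) else 0))
   + (if norm (\<xi> - \<eta>) \<le> R / 4 then u (\<xi> - \<eta>) * (L / R * norm (\<xi> - \<eta>) powr (- d\<^sub>1)
          + 8 * \<tau> powr (1 - z / \<alpha>) * R powr (\<alpha> - 1) * norm (\<xi> - \<eta>) powr (- (z + d\<^sub>1))) else 0)
       * (if R / 4 \<le> norm \<eta> \<and> norm \<eta> \<le> 4 * R then v \<eta> * norm \<eta> powr (- d\<^sub>2) else 0)"
    (is "?lhs \<le> ?A * ?B + ?I * (?u * ?B2) + ?A3 * ?B3")
proof -
  define h where "h = \<xi> - \<eta>"
  have h: "h \<noteq> 0" "0 < norm h" using ne by (auto simp: h_def)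
  have \<eta>: "0 < norm \<eta>" using ne by simp
  have u: "0 \<le> u x" and v: "0 \<le> v x" for x
    using F G by (auto simp: u_def v_def wt_nonneg)
  have pos: "0 \<le> ?A" "0 \<le> ?B" "0 \<le> ?I" "0 \<le> ?u" "0 \<le> ?B2" "0 \<le> ?A3" "0 \<le> ?B3"
    using u v L R \<tau> by auto
  note prods = mult_nonneg_nonneg[OF pos(1,2)] mult_nonneg_nonneg[OF pos(3) mult_nonneg_nonneg[OF pos(4,5)]]
    mult_nonneg_nonneg[OF pos(6,7)]
  have sums: "x \<le> a \<Longrightarrow> 0 \<le> b \<Longrightarrow> 0 \<le> c \<Longrightarrow> x \<le> a + b + c"
    "x \<le> b \<Longrightarrow> 0 \<le> a \<Longrightarrow> 0 \<le> c \<Longrightarrow> x \<le> a + b + c"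
    "x \<le> c \<Longrightarrow> 0 \<le> a \<Longrightarrow> 0 \<le> b \<Longrightarrow> x \<le> a + b + c" for x a b c :: real
    by linarith+
  define e where "e = E \<tau> h * F h * (E \<tau> \<eta> * G \<eta>)"
  have e: "0 \<le> e" using F G E_pos[of \<tau> h] E_pos[of \<tau> \<eta>] by (simp add: e_def)
  have triv: "?lhs \<le> e"
  proof -
    have "F h * \<bar>m \<tau> R \<eta> - m \<tau> R \<xi>\<bar> * G \<eta> \<le> F h * (E \<tau> h * E \<tau> \<eta>) * G \<eta>"
      using kernel_trivial[of \<tau> R \<eta> \<xi>] \<tau> F G by (intro mult_right_mono mult_left_mono) (auto simp: h_def)
    then show ?thesis by (simp add: e_def h_def mult_ac)
  qed
  have vB: "v \<eta> * norm \<eta> powr (- d\<^sub>2) = E \<tau> \<eta> * G \<eta>"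
    unfolding v_def using wt_cancel[OF ne(2), of d\<^sub>2 \<tau> G "- d\<^sub>2"] \<eta> by simp
  consider (a) "R / 4 < norm h" "norm \<eta> \<le> 4 * R" | (b) "R / 4 < norm h" "4 * R < norm \<eta>"
    | (c) "norm h \<le> R / 4" by linarith
  then show ?thesis
  proof cases
    case a
    have "?A = E \<tau> h * F h"
      using a h wt_cancel[OF h(1), of "1 + d\<^sub>1" \<tau> F "- (1 + d\<^sub>1)"] unfolding h_def[symmetric] u_def by simp
    then have "?A * ?B = e" using a vB by (simp add: e_def)
    then have "?lhs \<le> ?A * ?B" using triv by (simp only:)
    then show ?thesis by (rule sums(1)) (rule prods)+
  next
    case b
    have phi\<eta>: "\<phi> (\<eta> /\<^sub>R R) = 0" using b R by (intro phi_supp) (simp add: field_simps)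
    show ?thesis
    proof (cases "norm \<xi> \<le> 2 * R")
      case True
      \<comment> \<open>|\<eta>| <= |\<xi>| + |h| and |\<xi>| <= 2 R < |\<eta>|/2.\<close>
      have "norm \<eta> \<le> 2 * norm h"
        using norm_triangle_ineq2[of \<eta> \<xi>] True b R unfolding h_def by (simp add: norm_minus_commute)
      then have "norm \<eta> powr (1 + d\<^sub>1) \<le> (2 * norm h) powr (1 + d\<^sub>1)"
        using \<delta> by (intro powr_mono2) auto
      then have 1: "1 \<le> (2 powr (1 + d\<^sub>1) * norm h powr (1 + d\<^sub>1)) * norm \<eta> powr (- (1 + d\<^sub>1))"
        unfolding powr_minus_divide using \<eta> h by (simp add: powr_mult field_simps)
      have "v \<eta> * norm \<eta> powr (- (1 + d\<^sub>1 + d\<^sub>2)) = norm \<eta> powr (- (1 + d\<^sub>1)) * (E \<tau> \<eta> * G \<eta>)"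
        unfolding v_def wt_cancel[OF ne(2)] by simp
      then have "?u * ?B2 = (2 powr (1 + d\<^sub>1) * norm h powr (1 + d\<^sub>1)) * norm \<eta> powr (- (1 + d\<^sub>1)) * e"
        using b by (simp add: e_def u_def wt_def h_def[symmetric] mult_ac)
      then have "1 * e \<le> ?u * ?B2" using mult_right_mono[OF 1 e] by simp
      moreover have "?I = 1" using True by simp
      ultimately have "?lhs \<le> ?I * (?u * ?B2)" using triv by (simp only: mult_1)
      then show ?thesis by (rule sums(2)) (rule prods)+
    next
      case False
      then have "\<phi> (\<xi> /\<^sub>R R) = 0" using R by (intro phi_supp) (simp add: field_simps)
      then have "?lhs = 0" using phi\<eta> by (simp add: m_def)
      then have "?lhs \<le> ?A * ?B" using prods(1) by (simp only:)
      then show ?thesis by (rule sums(1)) (rule prods)+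
    qed
  next
    case c
    show ?thesis
    proof (cases "m \<tau> R \<eta> - m \<tau> R \<xi> = 0")
      case True
      then have "?lhs = 0" by simp
      then have "?lhs \<le> ?A * ?B" using prods(1) by (simp only:)
      then show ?thesis by (rule sums(1)) (rule prods)+
    next
      case False
      note k = kernel_low_high[OF \<tau> R ne(1) c[unfolded h_def] False]
      let ?b = "8 * \<tau> powr (1 - z / \<alpha>) * R powr (\<alpha> - 1)"
      have 1: "norm h powr (1 + d\<^sub>1) * norm h powr (- d\<^sub>1) = norm h"
        using h by (simp add: powr_add[symmetric])
      have 2: "norm h powr (1 + d\<^sub>1) * norm h powr (- (z + d\<^sub>1)) = norm h powr (1 - z)"
        by (simp add: powr_add[symmetric])
      have "?A3 = E \<tau> h * F h * (L / R * (norm h powr (1 + d\<^sub>1) * norm h powr (- d\<^sub>1))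
           + ?b * (norm h powr (1 + d\<^sub>1) * norm h powr (- (z + d\<^sub>1))))"
        using c by (simp add: h_def[symmetric] u_def wt_def algebra_simps)
      then have A3: "?A3 = E \<tau> h * F h * (L / R * norm h + ?b * norm h powr (1 - z))"
        unfolding 1 2 .
      have B3: "?B3 = E \<tau> \<eta> * G \<eta>" using k(1,2) vB by simp
      have "?lhs \<le> F h * (E \<tau> h * E \<tau> \<eta> * (L / R * norm h + ?b * norm h powr (1 - z))) * G \<eta>"
        using k(3) F G unfolding h_def by (intro mult_right_mono mult_left_mono) auto
      also have "\<dots> = ?A3 * ?B3" unfolding A3 B3 by (simp add: mult_ac)
      finally show ?thesis by (rule sums(3)) (rule prods)+
    qed
  qed
qed

text \<open>The 9 comes from squaring a sum of three terms; inside are the constants of the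
  high-low, high-high and low-high estimates, with 32768 = 512 * 8^2.\<close>

definition C\<^sub>0 :: real where
  "C\<^sub>0 = 9 * (256 * K d\<^sub>2 + 256 + 512 * L\<^sup>2 * K d\<^sub>1 + 32768 * K (z + d\<^sub>1))"

lemma C\<^sub>0_nonneg: "0 \<le> C\<^sub>0" by (simp add: C\<^sub>0_def K_nonneg)

lemma commutator_estimate:
  assumes \<tau>: "0 < \<tau>" and R: "0 < R" and [measurable]: "F \<in> borel_measurable borel" "G \<in> borel_measurable borel"
    and F: "\<And>x. 0 \<le> F x" and G: "\<And>x. 0 \<le> G x"
  defines "u \<equiv> wt (1 + d\<^sub>1) \<tau> F" and "v \<equiv> wt d\<^sub>2 \<tau> G"
  shows "(\<integral>\<^sup>+\<xi>. (\<integral>\<^sup>+\<eta>. ennreal (F (\<xi> - \<eta>) * \<bar>m \<tau> R \<eta> - m \<tau> R \<xi>\<bar> * G \<eta>) \<partial>lborel)\<^sup>2 \<partial>lborel)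
    \<le> ennreal (C\<^sub>0 * (R powr (- 2 * (d\<^sub>1 + d\<^sub>2)) + (\<tau> powr (1 - z / \<alpha>))\<^sup>2 * R powr (- 2 * (d\<^sub>1 + d\<^sub>2 + z - \<alpha>))))
       * (tail_sq_int R u * sq_int v + sq_int u * tail_sq_int R v)"
proof -
  have u: "0 \<le> u x" and v: "0 \<le> v x" for x
    using F G by (auto simp: u_def v_def wt_nonneg)
  have [measurable]: "u \<in> borel_measurable borel" "v \<in> borel_measurable borel"
    unfolding u_def v_def by measurable
  let ?b = "8 * \<tau> powr (1 - z / \<alpha>)"
  define A1 where "A1 x = (if R / 4 < norm x then u x * norm x powr (- (1 + d\<^sub>1)) else 0)" for x
  define B1 where "B1 x = (if norm x \<le> 4 * R then v x * norm x powr (- d\<^sub>2) else 0)" for x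
  define B2 where "B2 x = (if 4 * R < norm x then v x * (2 powr (1 + d\<^sub>1) * norm x powr (- (1 + d\<^sub>1 + d\<^sub>2))) else 0)" for x
  define A3 where "A3 x = (if norm x \<le> R / 4 then u x * (L / R * norm x powr (- d\<^sub>1)
      + ?b * R powr (\<alpha> - 1) * norm x powr (- (z + d\<^sub>1))) else 0)" for x
  define B3 where "B3 x = (if R / 4 \<le> norm x \<and> norm x \<le> 4 * R then v x * norm x powr (- d\<^sub>2) else 0)" for x
  have [measurable]: "A1 \<in> borel_measurable borel" "B1 \<in> borel_measurable borel" "B2 \<in> borel_measurable borel"
    "A3 \<in> borel_measurable borel" "B3 \<in> borel_measurable borel"
    unfolding A1_def B1_def B2_def A3_def B3_def by measurable
  have nn: "0 \<le> A1 x" "0 \<le> B1 x" "0 \<le> B2 x" "0 \<le> A3 x" "0 \<le> B3 x" for x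
    using u v L R \<tau> by (auto simp: A1_def B1_def B2_def A3_def B3_def)
  define I1 where "I1 \<xi> = (\<integral>\<^sup>+\<eta>. ennreal (A1 (\<xi> - \<eta>) * B1 \<eta>) \<partial>lborel)" for \<xi>
  define I2 where "I2 \<xi> = indicator (cball 0 (2 * R)) \<xi> * (\<integral>\<^sup>+\<eta>. ennreal (u (\<xi> - \<eta>) * B2 \<eta>) \<partial>lborel)" for \<xi>
  define I3 where "I3 \<xi> = (\<integral>\<^sup>+\<eta>. ennreal (A3 (\<xi> - \<eta>) * B3 \<eta>) \<partial>lborel)" for \<xi>
  have [measurable]: "I1 \<in> borel_measurable borel" unfolding I1_def by measurable
  have [measurable]: "I3 \<in> borel_measurable borel" unfolding I3_def by measurable
  have "(\<lambda>\<xi>. \<integral>\<^sup>+\<eta>. ennreal (u (\<xi> - \<eta>) * B2 \<eta>) \<partial>lborel) \<in> borel_measurable borel" by measurable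
  then have [measurable]: "I2 \<in> borel_measurable borel"
    unfolding I2_def by (intro borel_measurable_times_ennreal borel_measurable_indicator) auto
  have le: "(\<integral>\<^sup>+\<eta>. ennreal (F (\<xi> - \<eta>) * \<bar>m \<tau> R \<eta> - m \<tau> R \<xi>\<bar> * G \<eta>) \<partial>lborel) \<le> I1 \<xi> + I2 \<xi> + I3 \<xi>" for \<xi>
  proof -
    have "(\<integral>\<^sup>+\<eta>. ennreal (F (\<xi> - \<eta>) * \<bar>m \<tau> R \<eta> - m \<tau> R \<xi>\<bar> * G \<eta>) \<partial>lborel)
      \<le> (\<integral>\<^sup>+\<eta>. ennreal (A1 (\<xi> - \<eta>) * B1 \<eta>) + indicator (cball 0 (2 * R)) \<xi> * ennreal (u (\<xi> - \<eta>) * B2 \<eta>)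
          + ennreal (A3 (\<xi> - \<eta>) * B3 \<eta>) \<partial>lborel)"
    \<comment> \<open>\<open>kernel_split\<close> excludes \<eta> = \<xi> and \<eta> = 0, where 0
      powr a = 0 would destroy the cancellation of the weights; for fixed \<xi> these are two
      points.\<close>
    proof (rule nn_integral_mono_AE)
      have "AE \<eta> in lborel. \<eta> \<noteq> \<xi>" "AE \<eta> in lborel. \<eta> \<noteq> (0::plane)" by (rule AE_lborel_singleton)+
      then show "AE \<eta> in lborel. ennreal (F (\<xi> - \<eta>) * \<bar>m \<tau> R \<eta> - m \<tau> R \<xi>\<bar> * G \<eta>)
        \<le> ennreal (A1 (\<xi> - \<eta>) * B1 \<eta>) + indicator (cball 0 (2 * R)) \<xi> * ennreal (u (\<xi> - \<eta>) * B2 \<eta>)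
          + ennreal (A3 (\<xi> - \<eta>) * B3 \<eta>)"
      proof eventually_elim
        case (elim \<eta>)
        have "F (\<xi> - \<eta>) * \<bar>m \<tau> R \<eta> - m \<tau> R \<xi>\<bar> * G \<eta> \<le> A1 (\<xi> - \<eta>) * B1 \<eta>
            + indicat_real (cball 0 (2 * R)) \<xi> * (u (\<xi> - \<eta>) * B2 \<eta>) + A3 (\<xi> - \<eta>) * B3 \<eta>"
          using kernel_split[OF \<tau> R F G elim(1)[symmetric] elim(2)]
          unfolding A1_def B1_def B2_def A3_def B3_def u_def v_def .
        then have "ennreal (F (\<xi> - \<eta>) * \<bar>m \<tau> R \<eta> - m \<tau> R \<xi>\<bar> * G \<eta>) \<le> ennreal (A1 (\<xi> - \<eta>) * B1 \<eta>
            + indicat_real (cball 0 (2 * R)) \<xi> * (u (\<xi> - \<eta>) * B2 \<eta>) + A3 (\<xi> - \<eta>) * B3 \<eta>)"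
          by (rule ennreal_leI)
        also have "\<dots> = ennreal (A1 (\<xi> - \<eta>) * B1 \<eta>) + indicator (cball 0 (2 * R)) \<xi> * ennreal (u (\<xi> - \<eta>) * B2 \<eta>)
          + ennreal (A3 (\<xi> - \<eta>) * B3 \<eta>)"
          using nn u by (auto simp: indicator_def)
        finally show ?case .
      qed
    qed
    also have "\<dots> = I1 \<xi> + I2 \<xi> + I3 \<xi>"
      unfolding I1_def I2_def I3_def by (simp add: nn_integral_add nn_integral_cmult)
    finally show ?thesis .
  qed
  let ?P = "R powr (- 2 * (d\<^sub>1 + d\<^sub>2))"
  let ?Q = "(\<tau> powr (1 - z / \<alpha>))\<^sup>2 * R powr (- 2 * (d\<^sub>1 + d\<^sub>2 + z - \<alpha>))"
  let ?X = "tail_sq_int R u * sq_int v" and ?Y = "sq_int u * tail_sq_int R v"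
  have "(\<integral>\<^sup>+\<xi>. (\<integral>\<^sup>+\<eta>. ennreal (F (\<xi> - \<eta>) * \<bar>m \<tau> R \<eta> - m \<tau> R \<xi>\<bar> * G \<eta>) \<partial>lborel)\<^sup>2 \<partial>lborel)
      \<le> (\<integral>\<^sup>+\<xi>. 9 * ((I1 \<xi>)\<^sup>2 + (I2 \<xi>)\<^sup>2 + (I3 \<xi>)\<^sup>2) \<partial>lborel)"
    by (intro nn_integral_mono order_trans[OF power_mono[OF le] ennreal_add3_power2_le]) simp
  also have "\<dots> = 9 * ((\<integral>\<^sup>+\<xi>. (I1 \<xi>)\<^sup>2 \<partial>lborel) + (\<integral>\<^sup>+\<xi>. (I2 \<xi>)\<^sup>2 \<partial>lborel) + (\<integral>\<^sup>+\<xi>. (I3 \<xi>)\<^sup>2 \<partial>lborel))"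
    by (simp add: nn_integral_add nn_integral_cmult)
  also have "\<dots> \<le> 9 * (ennreal (256 * K d\<^sub>2 * ?P) * ?X + ennreal (256 * ?P) * ?Y
      + ennreal (512 * (L\<^sup>2 * K d\<^sub>1 * ?P + ?b\<^sup>2 * K (z + d\<^sub>1) * R powr (- 2 * (d\<^sub>1 + d\<^sub>2 + z - \<alpha>)))) * ?Y)"
    unfolding I1_def I2_def I3_def A1_def B1_def B2_def A3_def B3_def
    using u v R by (intro mult_left_mono add_mono high_low_estimate high_high_estimate low_high_estimate) auto
  \<comment> \<open>All coefficients are raised to multiples of \<open>?P + ?Q\<close> and all
    products to \<open>?X + ?Y\<close>, so that the three bounds combine.\<close>
  also have "\<dots> \<le> 9 * (ennreal (256 * K d\<^sub>2 * (?P + ?Q)) * (?X + ?Y) + ennreal (256 * (?P + ?Q)) * (?X + ?Y)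
      + ennreal ((512 * L\<^sup>2 * K d\<^sub>1 + 32768 * K (z + d\<^sub>1)) * (?P + ?Q)) * (?X + ?Y))"
  proof -
    have "512 * (L\<^sup>2 * K d\<^sub>1 * ?P + ?b\<^sup>2 * K (z + d\<^sub>1) * R powr (- 2 * (d\<^sub>1 + d\<^sub>2 + z - \<alpha>)))
        = (512 * L\<^sup>2 * K d\<^sub>1) * ?P + (32768 * K (z + d\<^sub>1)) * ?Q"
      by (simp add: power_mult_distrib algebra_simps)
    also have "\<dots> \<le> (512 * L\<^sup>2 * K d\<^sub>1) * (?P + ?Q) + (32768 * K (z + d\<^sub>1)) * (?P + ?Q)"
      using K_nonneg by (intro add_mono mult_left_mono) auto
    finally have 3: "512 * (L\<^sup>2 * K d\<^sub>1 * ?P + ?b\<^sup>2 * K (z + d\<^sub>1) * R powr (- 2 * (d\<^sub>1 + d\<^sub>2 + z - \<alpha>)))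
        \<le> (512 * L\<^sup>2 * K d\<^sub>1 + 32768 * K (z + d\<^sub>1)) * (?P + ?Q)"
      by (simp add: distrib_right)
    have "256 * K d\<^sub>2 * ?P \<le> 256 * K d\<^sub>2 * (?P + ?Q)" "256 * ?P \<le> 256 * (?P + ?Q)"
      using K_nonneg by (auto intro!: mult_left_mono)
    note this[THEN ennreal_leI] 3[THEN ennreal_leI]
    then show ?thesis by (intro mult_left_mono add_mono mult_mono) auto
  qed
  also have "\<dots> = ennreal (C\<^sub>0 * (?P + ?Q)) * (?X + ?Y)"
  proof -
    have nine: "9 * (ennreal a * T + ennreal b * T + ennreal c * T) = ennreal (9 * (a + b + c)) * T"
      if "0 \<le> a" "0 \<le> b" "0 \<le> c" for a b c T
    proof -
      have "ennreal (9 * (a + b + c)) = 9 * (ennreal a + ennreal b + ennreal c)"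
        using that by (simp add: ennreal_mult)
      then show ?thesis by (simp only: distrib_right mult.assoc)
    qed
    have "C\<^sub>0 * (?P + ?Q) = 9 * (256 * K d\<^sub>2 * (?P + ?Q) + 256 * (?P + ?Q)
        + (512 * L\<^sup>2 * K d\<^sub>1 + 32768 * K (z + d\<^sub>1)) * (?P + ?Q))"
      unfolding C\<^sub>0_def by (simp only: distrib_right mult.assoc add.assoc)
    then show ?thesis using K_nonneg by (simp only:) (rule nine, auto)
  qed
  finally show ?thesis .
qed

end

section \<open>Summation over the dyadic scales\<close>

lemma sum_powi_power2_le:
  assumes "finite J" "\<And>j. j \<in> J \<Longrightarrow> j \<le> k"
  shows "(\<Sum>j\<in>J. (2 powi j :: real)\<^sup>2) \<le> 4 / 3 * (2 powi k)\<^sup>2"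
  using assms
proof (induction J arbitrary: k rule: finite_linorder_max_induct)
  case (insert b A)
  \<comment> \<open>A geometric series of ratio 1/4: the largest index contributes 4^b, the others
    lie below b - 1, and 1 + (4/3)/4 = 4/3.\<close>
  have b: "(2 powi b :: real) = 2 * 2 powi (b - 1)"
    by (simp add: power_int_diff)
  have "(\<Sum>j\<in>insert b A. (2 powi j :: real)\<^sup>2) = (2 powi b)\<^sup>2 + (\<Sum>j\<in>A. (2 powi j)\<^sup>2)"
    using insert by (subst sum.insert) auto
  also have "\<dots> \<le> (2 powi b)\<^sup>2 + 4 / 3 * (2 powi (b - 1))\<^sup>2"
    using insert.hyps by (intro add_left_mono insert.IH) force
  also have "\<dots> = 4 / 3 * (2 powi b)\<^sup>2"
    unfolding b by (simp add: power_mult_distrib)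
  also have "\<dots> \<le> 4 / 3 * (2 powi k)\<^sup>2"
    using insert.prems[of b] by (intro mult_left_mono power_mono power_int_increasing) auto
  finally show ?case .
qed simp

text \<open>At a fixed x only j with 2^j <= 4 |x| contribute, and their 4^j add up to at most (4/3)
  16 |x|^2; the weight divides by |x|^2, and 64/3 is rounded up to 22.\<close>

lemma sum_tail_sq_int_le:
  assumes [measurable]: "u \<in> borel_measurable borel" and J: "finite J"
  shows "(\<Sum>j\<in>J. tail_sq_int (2 powi j) u) \<le> ennreal 22 * sq_int u"
proof -
  let ?w = "\<lambda>j x. if (2 powi j) / 4 \<le> norm x then ((2 powi j) / norm x * u x)\<^sup>2 else 0"
  have le: "(\<Sum>j\<in>J. ?w j x) \<le> 22 * (u x)\<^sup>2" for x
  proof (cases "{j \<in> J. (2::real) powi j \<le> 4 * norm x} = {}")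
    case True
    then have "(\<Sum>j\<in>J. ?w j x) = 0" by (intro sum.neutral) (auto simp: field_simps)
    then show ?thesis by simp
  next
    case False
    define J' where "J' = {j \<in> J. (2::real) powi j \<le> 4 * norm x}"
    have J': "finite J'" "J' \<noteq> {}" using J False by (auto simp: J'_def)
    then have "(2::real) powi (Max J') \<le> 4 * norm x" using Max_in[OF J'] by (auto simp: J'_def)
    moreover have "0 < (2::real) powi (Max J')" by simp
    ultimately have x: "0 < norm x" by linarith
    have "(\<Sum>j\<in>J. ?w j x) = (\<Sum>j\<in>J'. ((2 powi j) / norm x * u x)\<^sup>2)"
      unfolding J'_def using J by (subst sum.inter_filter) (auto intro!: sum.cong simp: field_simps)
    also have "\<dots> = (\<Sum>j\<in>J'. (2 powi j)\<^sup>2) * (u x / norm x)\<^sup>2"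
      unfolding sum_distrib_right by (intro sum.cong) (auto simp: power_mult_distrib power_divide)
    also have "\<dots> \<le> (4 / 3 * (2 powi (Max J'))\<^sup>2) * (u x / norm x)\<^sup>2"
      using J' by (intro mult_right_mono sum_powi_power2_le) auto
    also have "\<dots> \<le> (4 / 3 * (4 * norm x)\<^sup>2) * (u x / norm x)\<^sup>2"
      using \<open>(2::real) powi (Max J') \<le> 4 * norm x\<close> by (intro mult_right_mono mult_left_mono power_mono) auto
    also have "\<dots> = 64 / 3 * (u x)\<^sup>2" using x by (simp add: power_mult_distrib power_divide)
    also have "\<dots> \<le> 22 * (u x)\<^sup>2" by (intro mult_right_mono) auto
    finally show ?thesis .
  qed
  have "(\<Sum>j\<in>J. tail_sq_int (2 powi j) u) = (\<integral>\<^sup>+x. (\<Sum>j\<in>J. ennreal (?w j x)) \<partial>lborel)"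
    unfolding tail_sq_int_def by (subst nn_integral_sum) auto
  also have "\<dots> \<le> (\<integral>\<^sup>+x. ennreal 22 * ennreal ((u x)\<^sup>2) \<partial>lborel)"
  proof (rule nn_integral_mono)
    fix x
    have "(\<Sum>j\<in>J. ennreal (?w j x)) = ennreal (\<Sum>j\<in>J. ?w j x)" by (rule sum_ennreal) simp
    also have "\<dots> \<le> ennreal (22 * (u x)\<^sup>2)" by (rule ennreal_leI[OF le])
    finally show "(\<Sum>j\<in>J. ennreal (?w j x)) \<le> ennreal 22 * ennreal ((u x)\<^sup>2)" by (simp add: ennreal_mult)
  qed
  also have "\<dots> = ennreal 22 * sq_int u"
    unfolding sq_int_def by (rule nn_integral_cmult) measurable
  finally show ?thesis .
qed

section \<open>Regularity and support of the cutoff\<close>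

lemma continuously_differentiable_1_lipschitz:
  assumes "continuously_differentiable 1 f"
  obtains L where "0 \<le> L" "\<And>x y. norm x \<le> r \<Longrightarrow> norm y \<le> r \<Longrightarrow> \<bar>f x - f y\<bar> \<le> L * norm (x - y)"
proof -
  let ?D = "\<lambda>x. frechet_derivative f (at x)"
  have diff: "f differentiable (at x)" and cont: "continuous_on UNIV (\<lambda>x. ?D x v)" for x v
    using assms by (auto simp: One_nat_def)
  have D: "(f has_derivative ?D x) (at x)" for x
    using diff by (simp add: frechet_derivative_works)
  have "\<exists>B. \<forall>x\<in>cball 0 r. \<bar>?D x v\<bar> \<le> B" for v
  proof -
    have "compact ((\<lambda>x. ?D x v) ` cball 0 r)"
      by (intro compact_continuous_image continuous_on_subset[OF cont]) auto
    then show ?thesis by (auto dest!: compact_imp_bounded simp: bounded_iff)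
  qed
  then obtain B where B: "\<And>v x. x \<in> cball 0 r \<Longrightarrow> \<bar>?D x v\<bar> \<le> B v" by metis
  \<comment> \<open>Continuity is known for each directional derivative separately; bounds in the
    basis directions suffice for the operator norm. If the ball is empty, \<open>B b\<close> may be
    negative, hence the absolute values.\<close>
  define L where "L = (\<Sum>b\<in>Basis. \<bar>B b\<bar>)"
  have "onorm (?D x) \<le> L" if x: "x \<in> cball 0 r" for x
  proof (rule onorm_le)
    fix v :: plane
    interpret bounded_linear "?D x" using D by (rule has_derivative_bounded_linear)
    have "?D x v = (\<Sum>b\<in>Basis. (v \<bullet> b) * ?D x b)"
      by (subst euclidean_representation[of v, symmetric]) (simp add: sum scaleR)
    also have "norm \<dots> \<le> (\<Sum>b\<in>Basis. norm v * \<bar>B b\<bar>)"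
    proof (rule sum_norm_le)
      fix b :: plane assume b: "b \<in> Basis"
      have "\<bar>v \<bullet> b\<bar> * \<bar>?D x b\<bar> \<le> norm v * \<bar>B b\<bar>"
        using B[OF x, of b] Basis_le_norm[OF b, of v] by (intro mult_mono) auto
      then show "norm ((v \<bullet> b) * ?D x b) \<le> norm v * \<bar>B b\<bar>" by (simp add: abs_mult)
    qed
    also have "\<dots> = L * norm v" by (simp add: L_def sum_distrib_left[symmetric] mult.commute)
    finally show "norm (?D x v) \<le> L * norm v" .
  qed
  then have "norm (f x - f y) \<le> L * norm (x - y)" if "norm x \<le> r" "norm y \<le> r" for x y
    using that by (intro differentiable_bound[where S="cball 0 r" and f'="?D"] has_derivative_at_withinI[OF D]) auto
  moreover have "0 \<le> L" unfolding L_def by (intro sum_nonneg) auto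
  ultimately show ?thesis using that[of L] by simp
qed

text \<open>Halving keeps points in the ball, so one Lipschitz constant of \<psi> serves both terms
  of \<open>lp_phi\<close>; hence 2 L.\<close>

lemma lp_phi_lipschitz:
  assumes "lp_cutoff \<psi>"
  obtains L where "0 \<le> L" "\<And>x y. norm x \<le> r \<Longrightarrow> norm y \<le> r \<Longrightarrow> \<bar>lp_phi \<psi> x - lp_phi \<psi> y\<bar> \<le> L * norm (x - y)"
proof -
  have "continuously_differentiable 1 \<psi>"
    using assms unfolding lp_cutoff_def smooth_def by blast
  then obtain L where L: "0 \<le> L" "\<And>x y. norm x \<le> r \<Longrightarrow> norm y \<le> r \<Longrightarrow> \<bar>\<psi> x - \<psi> y\<bar> \<le> L * norm (x - y)"
    by (rule continuously_differentiable_1_lipschitz[where r=r]) blast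
  have "\<bar>lp_phi \<psi> x - lp_phi \<psi> y\<bar> \<le> 2 * L * norm (x - y)" if "norm x \<le> r" "norm y \<le> r" for x y
  proof -
    have half: "norm (v /\<^sub>R 2) \<le> r" if "norm v \<le> r" for v :: plane
    proof -
      have "norm (v /\<^sub>R 2) \<le> norm v" by simp
      then show ?thesis using that by (rule order_trans)
    qed
    have "\<bar>\<psi> (x /\<^sub>R 2) - \<psi> (y /\<^sub>R 2)\<bar> \<le> L * norm (x /\<^sub>R 2 - y /\<^sub>R 2)"
      by (intro L half that)
    also have "\<dots> = L * (norm (x - y) / 2)" by (simp add: scaleR_diff_right[symmetric])
    also have "\<dots> \<le> L * norm (x - y)" using L(1) by (intro mult_left_mono) auto
    finally show ?thesis using L(2)[OF that] unfolding lp_phi_def by linarith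
  qed
  then show ?thesis using L(1) that[of "2 * L"] by simp
qed

lemma lp_phi_support:
  assumes "lp_cutoff \<psi>"
  shows "norm x < 1/2 \<Longrightarrow> lp_phi \<psi> x = 0" "norm x > 2 \<Longrightarrow> lp_phi \<psi> x = 0"
  using assms by (auto simp: lp_phi_def lp_cutoff_def)

lemma lp_phi_bounds:
  assumes "lp_cutoff \<psi>" shows "0 \<le> lp_phi \<psi> x" "lp_phi \<psi> x \<le> 1"
  using lp_phi_range[OF assms] by (auto simp: image_subset_iff)

section \<open>Assembly of the commutator estimate\<close>

lemma nn_L2_le_of_integral:
  fixes k :: "plane \<Rightarrow> plane \<Rightarrow> complex"
  assumes "AE \<xi> in lborel. F \<xi> = (1 / (2 * pi)) *\<^sub>R (LINT \<eta>|lborel. k \<xi> \<eta>)"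
  shows "nn_L2 F \<le> (\<integral>\<^sup>+\<xi>. (\<integral>\<^sup>+\<eta>. ennreal (cmod (k \<xi> \<eta>)) \<partial>lborel)\<^sup>2 \<partial>lborel)"
  unfolding nn_L2_def
proof (rule nn_integral_mono_AE)
  show "AE \<xi> in lborel. ennreal ((cmod (F \<xi>))\<^sup>2) \<le> (\<integral>\<^sup>+\<eta>. ennreal (cmod (k \<xi> \<eta>)) \<partial>lborel)\<^sup>2"
    using assms
  proof eventually_elim
    case (elim \<xi>)
    have "1 / (2 * pi) * cmod (LINT \<eta>|lborel. k \<xi> \<eta>) \<le> 1 * cmod (LINT \<eta>|lborel. k \<xi> \<eta>)"
      using pi_gt3 by (intro mult_right_mono) auto
    then have "ennreal (cmod (F \<xi>)) \<le> ennreal (cmod (LINT \<eta>|lborel. k \<xi> \<eta>))"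
      unfolding elim by (intro ennreal_leI) simp
    \<comment> \<open>Where the kernel is not integrable in \<eta>, the integral is 0 by convention
      and the bound is trivial.\<close>
    also have "\<dots> \<le> (\<integral>\<^sup>+\<eta>. ennreal (cmod (k \<xi> \<eta>)) \<partial>lborel)"
      by (cases "integrable lborel (k \<xi>)")
         (auto simp: integral_norm_bound_ennreal not_integrable_integral_eq)
    finally have "(ennreal (cmod (F \<xi>)))\<^sup>2 \<le> (\<integral>\<^sup>+\<eta>. ennreal (cmod (k \<xi> \<eta>)) \<partial>lborel)\<^sup>2"
      by (rule power_mono) simp
    then show ?case by (simp add: ennreal_power)
  qed
qed

lemma summable_on_infsum_le:
  fixes a :: "int \<Rightarrow> real"
  assumes "\<And>j. 0 \<le> a j" "\<And>J. finite J \<Longrightarrow> sum a J \<le> B"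
  shows "a summable_on UNIV" "(\<Sum>\<^sub>\<infinity>j. a j) \<le> B"
proof -
  show "a summable_on UNIV"
    by (rule nonneg_bdd_above_summable_on) (use assms in \<open>auto intro!: bdd_aboveI\<close>)
  then show "(\<Sum>\<^sub>\<infinity>j. a j) \<le> B"
    by (rule infsum_le_finite_sums) (use assms in auto)
qed

theorem theorem2p1:
  fixes lam \<kappa> \<alpha> \<delta>\<^sub>1 \<delta>\<^sub>2 \<zeta> :: real and \<psi> :: "plane \<Rightarrow> real"
  assumes "lp_cutoff \<psi>"
    and "lam > 0" and "\<kappa> > 0" and "0 \<le> \<alpha>" and "\<alpha> \<le> 1"
    and "min \<zeta> (min \<delta>\<^sub>1 \<delta>\<^sub>2) > 0" and "\<delta>\<^sub>1 + \<zeta> < 1" and "\<delta>\<^sub>2 < 1" and "\<zeta> < \<alpha>"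
  shows "\<exists>C::real. \<forall>s>0. \<forall>f \<in> gevrey_Hdot lam \<kappa> \<alpha> s (1 + \<delta>\<^sub>1). \<forall>g \<in> gevrey_Hdot lam \<kappa> \<alpha> s \<delta>\<^sub>2.
    \<exists>c :: int \<Rightarrow> real.
      (\<forall>j. c j \<ge> 0) \<and> (\<lambda>j. (c j)\<^sup>2) summable_on UNIV \<and> (\<Sum>\<^sub>\<infinity>j. (c j)\<^sup>2) \<le> 1 \<and>
      (\<forall>j. mult_commutator f (gevrey lam \<kappa> \<alpha> s \<circ> lp_block \<psi> j) g \<in> L2 \<and>
           L2_norm (mult_commutator f (gevrey lam \<kappa> \<alpha> s \<circ> lp_block \<psi> j) g)
             \<le> C * c j * Hdot_norm (1 + \<delta>\<^sub>1) (gevrey lam \<kappa> \<alpha> s f)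
                 * Hdot_norm \<delta>\<^sub>2 (gevrey lam \<kappa> \<alpha> s g)
                 * (s powr ((\<alpha> - \<zeta>) / \<kappa>) * 2 powr (- (\<delta>\<^sub>1 + \<delta>\<^sub>2 + \<zeta> - \<alpha>) * real_of_int j)
                    + 2 powr (- (\<delta>\<^sub>1 + \<delta>\<^sub>2) * real_of_int j)))"
proof -
  have \<zeta>: "0 < \<zeta>" and \<delta>: "0 < \<delta>\<^sub>1" "0 < \<delta>\<^sub>2" and \<alpha>: "0 < \<alpha>" using assms by auto
  obtain L where L: "0 \<le> L" "\<And>x y. norm x \<le> 4 \<Longrightarrow> norm y \<le> 4 \<Longrightarrow> \<bar>lp_phi \<psi> x - lp_phi \<psi> y\<bar> \<le> L * norm (x - y)"
    using lp_phi_lipschitz[OF assms(1), of 4] by blast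
  interpret commutator_kernel "lp_phi \<psi>" L \<alpha> \<zeta> \<delta>\<^sub>1 \<delta>\<^sub>2
    by unfold_locales
       (use L \<zeta> \<delta> \<alpha> assms lp_phi_measurable lp_phi_bounds lp_phi_support in auto)
  \<comment> \<open>The power of \<tau> in the estimate leaves \<lambda>^(1 - \<zeta>/\<alpha>) in
    front of the term with s; the maximum with 1 covers the other term as well. The 44 in C undoes
    the normalisation of d below.\<close>
  define c\<^sub>0 where "c\<^sub>0 = max 1 (lam powr (1 - \<zeta> / \<alpha>))"
  define C where "C = sqrt (44 * C\<^sub>0) * c\<^sub>0"
  show ?thesis
  proof (intro exI[of _ C] allI impI ballI)
    fix s :: real and f g
    assume s: "0 < s" and f: "f \<in> gevrey_Hdot lam \<kappa> \<alpha> s (1 + \<delta>\<^sub>1)" and g: "g \<in> gevrey_Hdot lam \<kappa> \<alpha> s \<delta>\<^sub>2"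
    have fL2: "f \<in> L2" and gL2: "g \<in> L2" using f g by (auto simp: gevrey_Hdot_def)
    define \<tau> where "\<tau> = lam * s powr (\<alpha> / \<kappa>)"
    have \<tau>: "0 < \<tau>" using assms s by (simp add: \<tau>_def)
    have E: "gevrey_symbol lam \<kappa> \<alpha> s = E \<tau>" by (auto simp: gevrey_symbol_def E_def \<tau>_def)
    define F where "F \<xi> = cmod (fourier f \<xi>)" for \<xi>
    define G where "G \<xi> = cmod (fourier g \<xi>)" for \<xi>
    have [measurable]: "fourier f \<in> borel_measurable borel" "fourier g \<in> borel_measurable borel"
      using fourier_L2(1)[OF fL2] fourier_L2(1)[OF gL2] by (auto simp: L2_def)
    have [measurable]: "F \<in> borel_measurable borel" "G \<in> borel_measurable borel"
      unfolding F_def G_def by measurable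
    define u where "u = wt (1 + \<delta>\<^sub>1) \<tau> F"
    define v where "v = wt \<delta>\<^sub>2 \<tau> G"
    have [measurable]: "u \<in> borel_measurable borel" "v \<in> borel_measurable borel"
      unfolding u_def v_def by measurable
    define X where "X = Hdot_norm (1 + \<delta>\<^sub>1) (gevrey lam \<kappa> \<alpha> s f)"
    define Y where "Y = Hdot_norm \<delta>\<^sub>2 (gevrey lam \<kappa> \<alpha> s g)"
    have XY: "0 \<le> X" "0 \<le> Y" by (auto simp: X_def Y_def Hdot_norm_def)
    have X: "sq_int u = ennreal (X\<^sup>2)" and Y: "sq_int v = ennreal (Y\<^sup>2)"
      using Hdot_norm_gevrey[OF f] Hdot_norm_gevrey[OF g] \<delta> \<alpha> assms(2)
      unfolding sq_int_def u_def v_def wt_def F_def G_def X_def Y_def E by auto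
    define a where "a j = enn2real (tail_sq_int (2 powi j) u)" for j
    define b where "b j = enn2real (tail_sq_int (2 powi j) v)" for j
    \<comment> \<open>A single tail is a one-element sum in the dyadic bound, hence finite; this
      permits real sequences a and b.\<close>
    have tail_fin: "tail_sq_int (2 powi j) w = ennreal (enn2real (tail_sq_int (2 powi j) w))"
      if [measurable]: "w \<in> borel_measurable borel" and w: "sq_int w = ennreal (Z\<^sup>2)" for w Z and j :: int
    proof -
      have "tail_sq_int (2 powi j) w \<le> ennreal 22 * sq_int w"
        using sum_tail_sq_int_le[of w "{j}"] by simp
      also have "\<dots> < \<infinity>" unfolding w by (simp add: ennreal_mult_less_top)
      finally show ?thesis by simp
    qed
    have a: "tail_sq_int (2 powi j) u = ennreal (a j)" and b: "tail_sq_int (2 powi j) v = ennreal (b j)" for j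
      using tail_fin[OF _ X] tail_fin[OF _ Y] by (simp_all add: a_def b_def)
    have ab0: "0 \<le> a j" "0 \<le> b j" for j by (auto simp: a_def b_def)
    have sum_le: "sum h J \<le> 22 * Z\<^sup>2" if [measurable]: "w \<in> borel_measurable borel" and w: "sq_int w = ennreal (Z\<^sup>2)"
      and h: "\<And>j. tail_sq_int (2 powi j) w = ennreal (h j)" "\<And>j. 0 \<le> h j" and "finite J" for w Z h and J :: "int set"
    proof -
      have "ennreal (sum h J) = (\<Sum>j\<in>J. tail_sq_int (2 powi j) w)" using h by (simp add: sum_ennreal)
      also have "\<dots> \<le> ennreal 22 * sq_int w" by (rule sum_tail_sq_int_le) fact+
      also have "\<dots> = ennreal (22 * Z\<^sup>2)" unfolding w by (simp add: ennreal_mult)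
      finally show ?thesis by (subst (asm) ennreal_le_iff) auto
    qed
    have asum: "sum a J \<le> 22 * X\<^sup>2" and bsum: "sum b J \<le> 22 * Y\<^sup>2" if "finite J" for J
      using sum_le[OF _ X a ab0(1) that] sum_le[OF _ Y b ab0(2) that] by auto
    \<comment> \<open>The squares of the c j. The sums of a and b are at most 22 X^2 and 22 Y^2, so
      dividing by 44 makes the total at most 1.\<close>
    define d where "d j = (if X * Y = 0 then 0 else (a j / X\<^sup>2 + b j / Y\<^sup>2) / 44)" for j
    have d0: "0 \<le> d j" for j using ab0 by (simp add: d_def)
    have dsum: "sum d J \<le> 1" if "finite J" for J
    proof (cases "X * Y = 0")
      case False
      then have "sum d J = (sum a J / X\<^sup>2 + sum b J / Y\<^sup>2) / 44"
        by (simp add: d_def sum.distrib flip: sum_divide_distrib)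
      also have "\<dots> \<le> (22 + 22) / 44"
        using asum[OF that] bsum[OF that] False by (intro divide_right_mono add_mono) (auto simp: divide_le_eq)
      finally show ?thesis by simp
    qed (simp add: d_def)
    \<comment> \<open>This holds also in the degenerate case: X = 0 forces a j = 0 and Y = 0 forces
      b j = 0, so both sides vanish and the commutator with them.\<close>
    have mix: "a j * Y\<^sup>2 + X\<^sup>2 * b j = 44 * d j * X\<^sup>2 * Y\<^sup>2" for j
    proof (cases "X * Y = 0")
      case True
      have "a j \<le> 22 * X\<^sup>2" "b j \<le> 22 * Y\<^sup>2" using asum[of "{j}"] bsum[of "{j}"] by auto
      then have "X = 0 \<Longrightarrow> a j = 0" "Y = 0 \<Longrightarrow> b j = 0" using ab0[of j] by auto
      then show ?thesis using True by auto
    next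
      case False
      then show ?thesis by (simp add: d_def field_simps)
    qed
    define c where "c j = sqrt (d j)" for j
    have c2: "(c j)\<^sup>2 = d j" for j using d0 by (simp add: c_def)
    show "\<exists>c. (\<forall>j. c j \<ge> 0) \<and> (\<lambda>j. (c j)\<^sup>2) summable_on UNIV \<and> (\<Sum>\<^sub>\<infinity>j. (c j)\<^sup>2) \<le> 1 \<and>
      (\<forall>j. mult_commutator f (gevrey lam \<kappa> \<alpha> s \<circ> lp_block \<psi> j) g \<in> L2 \<and>
           L2_norm (mult_commutator f (gevrey lam \<kappa> \<alpha> s \<circ> lp_block \<psi> j) g)
             \<le> C * c j * Hdot_norm (1 + \<delta>\<^sub>1) (gevrey lam \<kappa> \<alpha> s f)
                 * Hdot_norm \<delta>\<^sub>2 (gevrey lam \<kappa> \<alpha> s g)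
                 * (s powr ((\<alpha> - \<zeta>) / \<kappa>) * 2 powr (- (\<delta>\<^sub>1 + \<delta>\<^sub>2 + \<zeta> - \<alpha>) * real_of_int j)
                    + 2 powr (- (\<delta>\<^sub>1 + \<delta>\<^sub>2) * real_of_int j)))"
    proof (intro exI[of _ c] conjI allI)
      show "0 \<le> c j" for j using d0 by (simp add: c_def)
      show "(\<lambda>j. (c j)\<^sup>2) summable_on UNIV" "(\<Sum>\<^sub>\<infinity>j. (c j)\<^sup>2) \<le> 1"
        unfolding c2 using summable_on_infsum_le[of d 1] d0 dsum by auto
      fix j :: int
      define R :: real where "R = 2 powi j"
      have R: "0 < R" by (simp add: R_def)
      let ?\<sigma> = "\<lambda>\<xi>. lp_phi \<psi> (\<xi> /\<^sub>R R)"
      let ?D = "mult_commutator f (fourier_multiplier (E \<tau>) \<circ> fourier_multiplier ?\<sigma>) g"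
      have D_eq: "mult_commutator f (gevrey lam \<kappa> \<alpha> s \<circ> lp_block \<psi> j) g = ?D"
        unfolding gevrey_def lp_block_def E R_def ..
      have [measurable]: "lp_phi \<psi> \<in> borel_measurable borel" by (rule phi_measurable)
      have supp: "?\<sigma> \<xi> = 0" if "norm \<xi> > 2 * R" for \<xi>
        using that R by (intro phi_supp(2)) (simp add: field_simps)
      \<comment> \<open>This bound depends on j and \<tau>; it only serves to place the commutator
        in L2 and to obtain its transform.\<close>
      have bound: "\<bar>E \<tau> \<xi> * ?\<sigma> \<xi>\<bar> \<le> exp (\<tau> * (2 * R) powr \<alpha>)" for \<xi>
      proof (cases "norm \<xi> \<le> 2 * R")
        case True
        then have "E \<tau> \<xi> \<le> exp (\<tau> * (2 * R) powr \<alpha>)"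
          using \<tau> \<alpha> by (simp add: E_def powr_mono2 mult_left_mono)
        then have "E \<tau> \<xi> * ?\<sigma> \<xi> \<le> exp (\<tau> * (2 * R) powr \<alpha>) * 1"
          using phi01 E_pos[of \<tau> \<xi>] by (intro mult_mono) auto
        then show ?thesis using phi01 E_pos[of \<tau> \<xi>] by (simp add: abs_mult)
      qed (simp add: supp)
      have D: "?D \<in> L2" "AE \<xi> in lborel. fourier ?D \<xi> = (1 / (2 * pi)) *\<^sub>R (LINT \<eta>|lborel.
         fourier f (\<xi> - \<eta>) * of_real (E \<tau> \<eta> * ?\<sigma> \<eta> - E \<tau> \<xi> * ?\<sigma> \<xi>) * fourier g \<eta>)"
        by (rule mult_commutator_fourier[where B\<^sub>1=1 and B\<^sub>2="exp (\<tau> * (2 * R) powr \<alpha>)" and R="2 * R"];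
            use phi01 supp bound fL2 gL2 in auto)+
      show "mult_commutator f (gevrey lam \<kappa> \<alpha> s \<circ> lp_block \<psi> j) g \<in> L2" unfolding D_eq by (rule D)
      let ?P = "R powr (- 2 * (\<delta>\<^sub>1 + \<delta>\<^sub>2))"
      let ?Q = "(\<tau> powr (1 - \<zeta> / \<alpha>))\<^sup>2 * R powr (- 2 * (\<delta>\<^sub>1 + \<delta>\<^sub>2 + \<zeta> - \<alpha>))"
      have "ennreal ((L2_norm ?D)\<^sup>2) = nn_L2 (fourier ?D)"
        using nn_L2_eq[OF fourier_L2(1)[OF D(1)]] fourier_L2(2)[OF D(1)] by simp
      also have "\<dots> \<le> (\<integral>\<^sup>+\<xi>. (\<integral>\<^sup>+\<eta>. ennreal (cmod (fourier f (\<xi> - \<eta>)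
          * of_real (E \<tau> \<eta> * ?\<sigma> \<eta> - E \<tau> \<xi> * ?\<sigma> \<xi>) * fourier g \<eta>)) \<partial>lborel)\<^sup>2 \<partial>lborel)"
        by (rule nn_L2_le_of_integral[OF D(2)])
      also have "\<dots> = (\<integral>\<^sup>+\<xi>. (\<integral>\<^sup>+\<eta>. ennreal (F (\<xi> - \<eta>) * \<bar>m \<tau> R \<eta> - m \<tau> R \<xi>\<bar> * G \<eta>) \<partial>lborel)\<^sup>2 \<partial>lborel)"
        by (simp only: norm_mult norm_of_real F_def G_def m_def)
      also have "\<dots> \<le> ennreal (C\<^sub>0 * (?P + ?Q)) * (tail_sq_int R u * sq_int v + sq_int u * tail_sq_int R v)"
        unfolding u_def v_def by (rule commutator_estimate[OF \<tau> R]) (auto simp: F_def G_def)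
      also have "\<dots> = ennreal (C\<^sub>0 * (?P + ?Q) * (a j * Y\<^sup>2 + X\<^sup>2 * b j))"
      proof -
        have "tail_sq_int R u * sq_int v + sq_int u * tail_sq_int R v = ennreal (a j * Y\<^sup>2 + X\<^sup>2 * b j)"
          unfolding X Y R_def a b using ab0 by (simp add: ennreal_mult)
        moreover have "0 \<le> C\<^sub>0 * (?P + ?Q)" "0 \<le> a j * Y\<^sup>2 + X\<^sup>2 * b j"
          using C\<^sub>0_nonneg ab0 by auto
        ultimately show ?thesis by (simp only: ennreal_mult)
      qed
      finally have le: "(L2_norm ?D)\<^sup>2 \<le> C\<^sub>0 * (?P + ?Q) * (a j * Y\<^sup>2 + X\<^sup>2 * b j)"
        using C\<^sub>0_nonneg ab0 by (subst (asm) ennreal_le_iff) auto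
      define p where "p = 2 powr (- (\<delta>\<^sub>1 + \<delta>\<^sub>2) * real_of_int j)"
      define q where "q = s powr ((\<alpha> - \<zeta>) / \<kappa>) * 2 powr (- (\<delta>\<^sub>1 + \<delta>\<^sub>2 + \<zeta> - \<alpha>) * real_of_int j)"
      have pq: "0 \<le> p" "0 \<le> q" by (auto simp: p_def q_def)
      have R2: "R powr (- 2 * t) = (2 powr (- t * real_of_int j))\<^sup>2" for t
      proof -
        have "R = 2 powr (real_of_int j)" by (simp add: R_def powr_real_of_int')
        then have "R powr (- 2 * t) = 2 powr (- t * real_of_int j + - t * real_of_int j)"
          by (simp add: powr_powr algebra_simps)
        then show ?thesis by (simp only: powr_add power2_eq_square)
      qed
      have P: "?P = p\<^sup>2" unfolding p_def by (rule R2)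
      have Q: "?Q = (lam powr (1 - \<zeta> / \<alpha>) * q)\<^sup>2"
      proof -
        \<comment> \<open>The power of s in the theorem: \<tau> contains s^(\<alpha>/\<kappa>) and
          is raised to 1 - \<zeta>/\<alpha>.\<close>
        have "\<alpha> / \<kappa> * (1 - \<zeta> / \<alpha>) = (\<alpha> - \<zeta>) / \<kappa>" using \<alpha> assms(3) by (simp add: field_simps)
        then have "\<tau> powr (1 - \<zeta> / \<alpha>) = lam powr (1 - \<zeta> / \<alpha>) * s powr ((\<alpha> - \<zeta>) / \<kappa>)"
          using assms(2) s unfolding \<tau>_def by (simp only: powr_mult powr_powr)
        then show ?thesis unfolding R2 q_def by (simp add: power_mult_distrib)
      qed
      have "?P + ?Q \<le> (c\<^sub>0 * (q + p))\<^sup>2"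
      proof -
        have "p \<le> c\<^sub>0 * p" "lam powr (1 - \<zeta> / \<alpha>) * q \<le> c\<^sub>0 * q"
          using pq by (auto simp: c\<^sub>0_def mult_le_cancel_right1 intro!: mult_right_mono)
        then have "p\<^sup>2 + (lam powr (1 - \<zeta> / \<alpha>) * q)\<^sup>2 \<le> (c\<^sub>0 * p)\<^sup>2 + (c\<^sub>0 * q)\<^sup>2"
          using pq by (intro add_mono power_mono) auto
        also have "\<dots> \<le> (c\<^sub>0 * p + c\<^sub>0 * q)\<^sup>2"
          using pq by (simp add: power2_sum c\<^sub>0_def)
        finally show ?thesis unfolding P Q by (simp add: distrib_left add.commute)
      qed
      then have "C\<^sub>0 * (?P + ?Q) * (44 * d j * X\<^sup>2 * Y\<^sup>2) \<le> C\<^sub>0 * (c\<^sub>0 * (q + p))\<^sup>2 * (44 * d j * X\<^sup>2 * Y\<^sup>2)"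
        using C\<^sub>0_nonneg d0[of j] by (intro mult_right_mono mult_left_mono) auto
      also have "\<dots> = (C * c j * X * Y * (q + p))\<^sup>2"
        using C\<^sub>0_nonneg by (simp add: C_def power_mult_distrib c2 mult_ac)
      finally have "(L2_norm ?D)\<^sup>2 \<le> (C * c j * X * Y * (q + p))\<^sup>2"
        using le unfolding mix by linarith
      moreover have "0 \<le> C * c j * X * Y * (q + p)"
        using XY pq C\<^sub>0_nonneg d0[of j] by (simp add: C_def c_def c\<^sub>0_def)
      ultimately have "L2_norm ?D \<le> C * c j * X * Y * (q + p)" by (rule power2_le_imp_le)
      then show "L2_norm (mult_commutator f (gevrey lam \<kappa> \<alpha> s \<circ> lp_block \<psi> j) g)
             \<le> C * c j * Hdot_norm (1 + \<delta>\<^sub>1) (gevrey lam \<kappa> \<alpha> s f)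
                 * Hdot_norm \<delta>\<^sub>2 (gevrey lam \<kappa> \<alpha> s g)
                 * (s powr ((\<alpha> - \<zeta>) / \<kappa>) * 2 powr (- (\<delta>\<^sub>1 + \<delta>\<^sub>2 + \<zeta> - \<alpha>) * real_of_int j)
                    + 2 powr (- (\<delta>\<^sub>1 + \<delta>\<^sub>2) * real_of_int j))"
        unfolding D_eq X_def Y_def p_def q_def .
    qed
  qed
qed

end
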